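(* Let $n\geqslant2$, $\lambda\in\mathbb R_+$, and let $u\in\mathring B^\ast_2$ solve \[\left(-\Delta-\lambda\right)u=f\quad\text{in }\mathbb R^n,\] where $e^{\gamma_0\left\langle\cdot\right\rangle}f\in L^2(\mathbb R^n)$ for some $\gamma_0\in\mathbb R_+$, and suppose that $f$ vanishes in $\mathbb R^{n-1}\times\mathbb R_-$. Then $u$ also vanishes in $\mathbb R^{n-1}\times\mathbb R_-$.
   Context: For $x\in\mathbb R^n$, $\left\langle x\right\rangle=\sqrt{1+|x|^2}$, and $\mathbb R_-=\left]-\infty,0\right[$. The space $\mathring B^\ast$ consists of those $u\in L^2_{\mathrm{loc}}(\mathbb R^n)$ with $\frac1R\int_{B(0,R)}|u|^2\to0$ as $R\to\infty$, where $B(0,R)$ is the open ball of radius $R$ centered at the origin. The notation $u\in\mathring B^\ast_2$ means that $u$ and all its (distributional) partial derivatives of order at most $2$ belong to $\mathring B^\ast$. *)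

theory Defs
  imports "HOL-Analysis.Analysis"
begin

definition jbracket :: "'a::real_normed_vector \<Rightarrow> real" where
  "jbracket x = sqrt (1 + (norm x)\<^sup>2)"

definition pdiff :: "'n::finite \<Rightarrow> (real^'n \<Rightarrow> real) \<Rightarrow> real^'n \<Rightarrow> real" where
  "pdiff i \<phi> x = deriv (\<lambda>t. \<phi> (x + t *\<^sub>R axis i 1)) 0"

definition smooth_fun :: "(real^'n::finite \<Rightarrow> real) \<Rightarrow> bool" where
  "smooth_fun \<phi> \<longleftrightarrow> (\<forall>is :: 'n list. \<forall>x. foldr pdiff is \<phi> differentiable (at x))"

definition test_fun :: "(real^'n::finite \<Rightarrow> real) \<Rightarrow> bool" where
  "test_fun \<phi> \<longleftrightarrow> smooth_fun \<phi> \<and> compact (closure {x. \<phi> x \<noteq> 0})"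

definition weak_pdiff :: "'n::finite \<Rightarrow> (real^'n \<Rightarrow> complex) \<Rightarrow> (real^'n \<Rightarrow> complex) \<Rightarrow> bool" where
  "weak_pdiff i u g \<longleftrightarrow>
     (\<forall>\<phi>. test_fun \<phi> \<longrightarrow>
        (LINT x|lebesgue. u x * complex_of_real (pdiff i \<phi> x))
          = - (LINT x|lebesgue. g x * complex_of_real (\<phi> x)))"

definition L2_loc :: "(real^'n::finite \<Rightarrow> complex) \<Rightarrow> bool" where
  "L2_loc u \<longleftrightarrow> u \<in> borel_measurable lebesgue \<and>
     (\<forall>R. set_integrable lebesgue (ball 0 R) (\<lambda>x. (norm (u x))\<^sup>2))"

definition L2 :: "(real^'n::finite \<Rightarrow> complex) \<Rightarrow> bool" where
  "L2 u \<longleftrightarrow> u \<in> borel_measurable lebesgue \<and> integrable lebesgue (\<lambda>x. (norm (u x))\<^sup>2)"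

definition Bstar0 :: "(real^'n::finite \<Rightarrow> complex) \<Rightarrow> bool" where
  "Bstar0 u \<longleftrightarrow> L2_loc u \<and>
     ((\<lambda>R. (1 / R) * (LINT x:ball 0 R|lebesgue. (norm (u x))\<^sup>2)) \<longlongrightarrow> 0) at_top"

definition Bstar0_2_with ::
  "(real^'n::finite \<Rightarrow> complex) \<Rightarrow> ('n \<Rightarrow> real^'n \<Rightarrow> complex) \<Rightarrow> ('n \<Rightarrow> 'n \<Rightarrow> real^'n \<Rightarrow> complex) \<Rightarrow> bool" where
  "Bstar0_2_with u Du D2u \<longleftrightarrow> Bstar0 u \<and>
     (\<forall>i. weak_pdiff i u (Du i) \<and> Bstar0 (Du i)) \<and>
     (\<forall>i j. weak_pdiff j (Du i) (D2u i j) \<and> Bstar0 (D2u i j))"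

end

theory Submission
  imports Defs "HOL-Probability.Probability" "HOL-Complex_Analysis.Complex_Analysis"
begin

text \<open>On the Fourier side the equation reads \<open>(|\<xi>|\<^sup>2 - \<lambda>) \<cdot> ft u = ft f\<close>. By a quantitative
  Plancherel estimate, membership in the space \<open>B*\<^sub>0\<close> means that \<open>ft u\<close> pairs to \<open>o(1)\<close> with
  cutoffs to the shells \<open>\<bar>|\<xi>|\<^sup>2 - \<lambda>\<bar> \<le> \<epsilon>\<close>. Hence \<open>ft f\<close> vanishes on the sphere \<open>|\<xi>|\<^sup>2 = \<lambda>\<close>, and \<open>ft u\<close>
  is the bounded function \<open>ft f / (|\<xi>|\<^sup>2 - \<lambda>)\<close> without a singular part on the sphere.

  As \<open>f\<close> decays exponentially and lives in the half-space \<open>x \<bullet> e \<ge> 0\<close>, \<open>ft f\<close> extends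
  holomorphically in the variable dual to \<open>e\<close> to the upper half-plane and slightly below the
  real axis. In the plane spanned by \<open>e\<close> and a unit vector \<open>\<omega>\<close> orthogonal to \<open>e\<close>, the points
  \<open>\<surd>\<lambda> (sin \<theta>, cos \<theta>)\<close> with \<open>\<theta>\<close> real are zeros of \<open>ft f\<close>; by analytic continuation in \<open>\<theta>\<close> so are
  the zeros \<open>(\<rho>, is)\<close>, \<open>\<rho>\<^sup>2 = \<lambda> + s\<^sup>2\<close>, of the symbol. The quotient is therefore holomorphic in
  the upper half-plane on every line parallel to \<open>e\<close>. Testing \<open>u\<close> against a Gaussian of width
  \<open>\<surd>t\<close> centred at \<open>a\<close> with \<open>a \<bullet> e < 0\<close> and shifting the contour by \<open>-(a \<bullet> e) / (2t)\<close> gives the bound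
  \<open>exp (- (a \<bullet> e)\<^sup>2 / (4t))\<close> up to powers of \<open>t\<close>, and \<open>t \<rightarrow> 0\<close> shows that \<open>u\<close> vanishes there.\<close>

text \<open>As \<open>u\<close> may fail to be integrable, its transform is never formed:
  \<open>u\<close> is only paired with \<open>ft H\<close> for Lipschitz \<open>H\<close> of
  Gaussian decay. A cutoff of width eps about the sphere has squared norm O(eps), and its difference
  quotients have squared norm O(1/eps); the weight 1 + eps^2 |x|^2 balances the two, and the
  mean-square condition on \<open>u\<close> supplies the remaining little o.

  The exponential decay of \<open>f\<close> gives room around the real points. The identity theorem
  needs an open set of complex angles containing a real interval, and there both dual variables
  leave the region that the support alone controls. How far the angle must travel depends on the
  zero to be reached, so the strip is made thinner as the zero moves up.

  For rho^2 > lambda only the upper zero of the symbol is removed. The lower one survives, so the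
  quotient is holomorphic only down to a depth that shrinks as rho^2 tends to lambda. The estimates
  therefore use the closed upper half-plane alone, where they are uniform in rho.\<close>

section \<open>Gaussians and the Plancherel inequality\<close>

text \<open>Lebesgue measure is the image of the product of one-dimensional measures indexed by
  \<open>Basis\<close>, so an integrand that factors over the coordinates reduces to the product
  theorems.\<close>

lemma lborel_integral_prod:
  fixes g :: "'a::euclidean_space \<Rightarrow> real \<Rightarrow> complex"
  assumes "\<And>b. b \<in> Basis \<Longrightarrow> integrable lborel (g b)"
  shows "integrable lborel (\<lambda>x::'a. \<Prod>b\<in>Basis. g b (x \<bullet> b))"
    and "(LINT x|lborel. (\<Prod>b\<in>Basis. g b (x \<bullet> b))) = (\<Prod>b\<in>Basis. LINT t|lborel. g b t)"
proof -
  interpret product_sigma_finite "\<lambda>_::'a. lborel :: real measure" ..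
  have m: "(\<lambda>x::'a. \<Prod>b\<in>Basis. g b (x \<bullet> b)) \<in> borel_measurable borel"
    using assms[THEN borel_measurable_integrable] by measurable
  have d: "(\<lambda>f. \<Sum>b\<in>Basis. f b *\<^sub>R b) \<in> (\<Pi>\<^sub>M b\<in>(Basis::'a set). lborel) \<rightarrow>\<^sub>M borel"
    by measurable
  have e: "(\<Prod>b\<in>Basis. g b ((\<Sum>c\<in>Basis. f c *\<^sub>R c) \<bullet> b)) = (\<Prod>b\<in>Basis. g b (f b))" for f :: "'a \<Rightarrow> real"
    by (intro prod.cong) (auto simp: inner_sum_left_Basis)
  show "integrable lborel (\<lambda>x::'a. \<Prod>b\<in>Basis. g b (x \<bullet> b))"
    apply (subst lborel_eq)
    apply (subst integrable_distr_eq[OF d m])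
    unfolding e
    by (rule product_integrable_prod) (use assms in auto)
  show "(LINT x|lborel. (\<Prod>b\<in>Basis. g b (x \<bullet> b))) = (\<Prod>b\<in>Basis. LINT t|lborel. g b t)"
    apply (subst lborel_eq)
    apply (subst integral_distr[OF d m])
    unfolding e
    by (rule product_integral_prod) (use assms in auto)
qed

lemma borel_measurable_cis[measurable]:
  "f \<in> borel_measurable M \<Longrightarrow> (\<lambda>x. cis (f x)) \<in> borel_measurable M"
  by (rule borel_measurable_continuous_on[of cis]) (auto intro!: continuous_intros)

text \<open>The characteristic function of the standard normal law, rescaled by
  \<open>k = sqrt (2 * c)\<close> so that (k t)^2 / 2 becomes c t^2.\<close>

lemma gauss_char_real:
  fixes c s :: real
  assumes "c > 0"
  shows "integrable lborel (\<lambda>t. complex_of_real (exp (- c * t\<^sup>2)) * cis (t * s))" (is ?I)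
    and "(LINT t|lborel. complex_of_real (exp (- c * t\<^sup>2)) * cis (t * s)) = sqrt (pi / c) * exp (- s\<^sup>2 / (4 * c))" (is ?E)
proof -
  define k where "k = sqrt (2 * c)"
  have k: "k > 0" "k\<^sup>2 = 2 * c" using assms by (auto simp: k_def)
  have i1: "integrable lborel (\<lambda>t::real. exp (- t\<^sup>2 / 2))"
  proof -
    have "integrable lborel (\<lambda>t. std_normal_density t * sqrt (2 * pi))" by simp
    also have "(\<lambda>t. std_normal_density t * sqrt (2 * pi)) = (\<lambda>t. exp (- t\<^sup>2 / 2))"
      by (auto simp: std_normal_density_def)
    finally show ?thesis .
  qed
  have i2: "integrable lborel (\<lambda>t. complex_of_real (exp (- t\<^sup>2 / 2)) * cis (t * (s / k)))"
    by (rule Bochner_Integration.integrable_bound[OF i1]) (auto simp: norm_mult)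
  have "exp (- ((s/k)\<^sup>2) / 2) = char std_normal_distribution (s / k)"
    by (simp add: char_std_normal_distribution)
  also have "\<dots> = (LINT t|lborel. std_normal_density t *\<^sub>R iexp (s / k * t))"
    unfolding char_def by (subst integral_density) (auto)
  also have "\<dots> = (LINT t|lborel. complex_of_real (exp (- t\<^sup>2 / 2)) * cis (t * (s / k)) / sqrt (2 * pi))"
    by (intro Bochner_Integration.integral_cong) (auto simp: std_normal_density_def cis_conv_exp mult_ac scaleR_conv_of_real)
  finally have v: "(LINT t|lborel. complex_of_real (exp (- t\<^sup>2 / 2)) * cis (t * (s / k))) = sqrt (2 * pi) * exp (- ((s/k)\<^sup>2) / 2)"
    by (simp add: field_simps)
  have q: "- (k * t)\<^sup>2 / 2 = - c * t\<^sup>2" for t by (simp add: power_mult_distrib k)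
  have q2: "k * t * (s / k) = t * s" for t using k by simp
  show ?I
    using lborel_integrable_real_affine[OF i2, of k 0] k by (simp add: q q2 power_mult_distrib)
  have "(LINT t|lborel. complex_of_real (exp (- c * t\<^sup>2)) * cis (t * s)) = sqrt (2 * pi) * exp (- ((s/k)\<^sup>2) / 2) / k"
    using lborel_integral_real_affine[of k "\<lambda>t. complex_of_real (exp (- t\<^sup>2 / 2)) * cis (t * (s / k))" 0] k v
    by (simp add: q q2 power_mult_distrib scaleR_conv_of_real field_simps)
  also have "sqrt (2 * pi) * exp (- ((s/k)\<^sup>2) / 2) / k = sqrt (pi / c) * exp (- s\<^sup>2 / (4 * c))"
    using assms by (simp add: k power_divide) (simp add: k_def real_sqrt_mult real_sqrt_divide)
  finally show ?E by (simp only: of_real_mult of_real_divide)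
qed

lemma inner_eq_sum_Basis: "(\<Sum>b\<in>Basis. (x \<bullet> b) * (y \<bullet> b)) = x \<bullet> (y::'a::euclidean_space)"
  by (rule euclidean_inner[symmetric])

lemma exp_norm_sum: "(\<Prod>b\<in>Basis. exp (- c * (x \<bullet> b)\<^sup>2)) = exp (- c * (norm (x::'a::euclidean_space))\<^sup>2)"
proof -
  have "(\<Prod>b\<in>Basis. exp (- c * (x \<bullet> b)\<^sup>2)) = exp (\<Sum>b\<in>Basis. - c * (x \<bullet> b)\<^sup>2)"
    by (rule exp_sum[symmetric]) auto
  also have "(\<Sum>b\<in>Basis. - c * (x \<bullet> b)\<^sup>2) = - c * (norm x)\<^sup>2"
    unfolding power2_norm_eq_inner sum_distrib_left[symmetric]
    using inner_eq_sum_Basis[of x x] by (simp add: power2_eq_square)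
  finally show ?thesis .
qed

lemma cis_inner_prod: "(\<Prod>b\<in>Basis. cis ((x \<bullet> b) * (y \<bullet> b))) = cis (x \<bullet> (y::'a::euclidean_space))"
proof -
  have "(\<Prod>b\<in>Basis. cis ((x \<bullet> b) * (y \<bullet> b))) = exp (\<Sum>b\<in>Basis. \<i> * ((x \<bullet> b) * (y \<bullet> b)))"
    by (subst exp_sum) (auto simp: cis_conv_exp)
  also have "(\<Sum>b\<in>Basis. \<i> * ((x \<bullet> b) * (y \<bullet> b))) = \<i> * (x \<bullet> y)"
    by (simp only: sum_distrib_left[symmetric] of_real_sum[symmetric] of_real_mult[symmetric] inner_eq_sum_Basis)
  finally show ?thesis by (simp add: cis_conv_exp)
qed

lemma gauss_char:
  fixes y :: "'a::euclidean_space"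
  assumes "c > 0"
  shows "integrable lborel (\<lambda>x::'a. complex_of_real (exp (- c * (norm x)\<^sup>2)) * cis (x \<bullet> y))" (is ?I)
    and "(LINT x|lborel. complex_of_real (exp (- c * (norm x)\<^sup>2)) * cis (x \<bullet> y))
          = complex_of_real (sqrt (pi / c) ^ DIM('a) * exp (- (norm y)\<^sup>2 / (4 * c)))" (is ?E)
proof -
  have eq: "(\<Prod>b\<in>Basis. complex_of_real (exp (- c * (x \<bullet> b)\<^sup>2)) * cis ((x \<bullet> b) * (y \<bullet> b)))
     = complex_of_real (exp (- c * (norm x)\<^sup>2)) * cis (x \<bullet> y)" for x :: 'a
    by (simp only: prod.distrib cis_inner_prod exp_norm_sum of_real_prod[symmetric])
  note * = lborel_integral_prod[of "\<lambda>b t. complex_of_real (exp (- c * t\<^sup>2)) * cis (t * (y \<bullet> b))",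
      OF gauss_char_real(1)[OF assms], unfolded eq]
  show ?I by (rule *(1))
  have "(\<Prod>b\<in>Basis. LINT t|lborel. complex_of_real (exp (- c * t\<^sup>2)) * cis (t * (y \<bullet> b)))
     = complex_of_real (\<Prod>b\<in>(Basis::'a set). sqrt (pi / c) * exp (- (1 / (4 * c)) * (y \<bullet> b)\<^sup>2))"
    unfolding of_real_prod by (intro prod.cong refl) (subst gauss_char_real(2)[OF assms], simp)
  also have "(\<Prod>b\<in>(Basis::'a set). sqrt (pi / c) * exp (- (1 / (4 * c)) * (y \<bullet> b)\<^sup>2))
      = sqrt (pi / c) ^ DIM('a) * exp (- (norm y)\<^sup>2 / (4 * c))"
    by (simp only: prod.distrib exp_norm_sum prod_constant) simp
  finally show ?E using *(2) by simp
qed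

lemma gauss_integral:
  assumes "c > 0"
  shows "integrable lborel (\<lambda>x::'a::euclidean_space. exp (- c * (norm x)\<^sup>2))" (is ?I)
    and "(LINT x|lborel. exp (- c * (norm (x::'a::euclidean_space))\<^sup>2)) = sqrt (pi / c) ^ DIM('a)" (is ?E)
proof -
  have "integrable lborel (\<lambda>x::'a. complex_of_real (exp (- c * (norm x)\<^sup>2)))"
    using gauss_char(1)[OF assms, of "0::'a"] by simp
  from integrable_Re[OF this] show ?I by simp
  have "complex_of_real (LINT x|lborel. exp (- c * (norm (x::'a))\<^sup>2)) = complex_of_real (sqrt (pi / c) ^ DIM('a))"
    using gauss_char(2)[OF assms, of "0::'a"] by (simp flip: integral_complex_of_real)
  then show ?E by (simp only: of_real_eq_iff)
qed

section \<open>The Fourier transform and its multiplication formula\<close>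

text \<open>The kernel has a plus sign in the exponent and no normalisation, whence the factor (2
  pi)^n in the Plancherel bounds.\<close>

definition ft :: "('a::euclidean_space \<Rightarrow> complex) \<Rightarrow> 'a \<Rightarrow> complex" where
  "ft H x = (LINT y|lborel. H y * cis (y \<bullet> x))"

lemma borel_measurable_ft[measurable]:
  assumes [measurable]: "H \<in> borel_measurable borel"
  shows "ft H \<in> borel_measurable borel"
  unfolding ft_def by measurable

lemma integrable_ft_kernel:
  assumes "integrable lborel H"
  shows "integrable lborel (\<lambda>y. H y * cis (y \<bullet> x))"
proof -
  have [measurable]: "H \<in> borel_measurable borel" using assms by auto
  show ?thesis
    by (rule Bochner_Integration.integrable_bound[OF assms]) (auto simp: norm_mult)
qed

lemma norm_ft_le:
  shows "norm (ft H x) \<le> (LINT y|lborel. norm (H y))"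
  unfolding ft_def by (rule integral_norm_bound[THEN order_trans]) (simp add: norm_mult)

text \<open>Fubini for \<open>g x * H y * cis (y \<bullet> x)\<close>, which is absolutely
  integrable because \<open>cis\<close> has modulus one. This symmetry does the work for which an
  inversion formula would otherwise be called.\<close>

lemma ft_mult:
  fixes H g :: "'a::euclidean_space \<Rightarrow> complex"
  assumes H: "integrable lborel H" and g: "integrable lborel g"
  shows "(LINT x|lborel. g x * ft H x) = (LINT y|lborel. H y * ft g y)"
proof -
  have [measurable]: "H \<in> borel_measurable borel" "g \<in> borel_measurable borel"
    using H g by auto
  have i: "integrable (lborel \<Otimes>\<^sub>M lborel) (\<lambda>(x, y). g x * (H y * cis (y \<bullet> x)))"
    apply (rule lborel_pair.Fubini_integrable)
      apply measurable
    using integrable_norm[OF H] integrable_norm[OF g] integrable_ft_kernel[OF H]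
    by (auto simp: norm_mult)
  have "(LINT x|lborel. g x * ft H x) = (LINT x|lborel. LINT y|lborel. g x * (H y * cis (y \<bullet> x)))"
    unfolding ft_def by simp
  also have "\<dots> = (LINT y|lborel. LINT x|lborel. g x * (H y * cis (y \<bullet> x)))"
    by (rule lborel_pair.Fubini_integral[symmetric]) (rule i)
  also have "\<dots> = (LINT y|lborel. H y * ft g y)"
    unfolding ft_def
    by (intro Bochner_Integration.integral_cong refl, subst integral_mult_right_zero[symmetric])
       (simp add: mult_ac inner_commute)
  finally show ?thesis .
qed

lemma nn_integral_lborel_translate:
  assumes [measurable]: "f \<in> borel_measurable borel"
  shows "(\<integral>\<^sup>+x. f (a + x::'a::euclidean_space) \<partial>lborel) = (\<integral>\<^sup>+x. f x \<partial>lborel)"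
  by (subst (2) lborel_distr_plus[of a, symmetric], subst nn_integral_distr) auto

lemma lborel_uminus: "distr lborel borel uminus = (lborel :: 'a::euclidean_space measure)"
proof -
  show ?thesis
    using lborel_affine[of "-1::real" "0::'a"] by (simp add: density_1)
qed

lemma nn_integral_lborel_uminus:
  assumes [measurable]: "f \<in> borel_measurable borel"
  shows "(\<integral>\<^sup>+x. f (- x::'a::euclidean_space) \<partial>lborel) = (\<integral>\<^sup>+x. f x \<partial>lborel)"
  by (subst (2) lborel_uminus[symmetric], subst nn_integral_distr) auto

lemma integrable_lborel_uminus:
  fixes f :: "'a::euclidean_space \<Rightarrow> 'b::{banach, second_countable_topology}"
  assumes f: "integrable lborel f"
  shows "integrable lborel (\<lambda>x. f (- x))"
proof -
  have m: "f \<in> borel_measurable borel" using f by auto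
  have "integrable (distr lborel borel uminus) f" using f by (simp add: lborel_uminus)
  then show ?thesis by (subst (asm) integrable_distr_eq) (use m in auto)
qed

lemma integral_lborel_uminus:
  fixes f :: "'a::euclidean_space \<Rightarrow> 'b::{banach, second_countable_topology}"
  assumes [measurable]: "f \<in> borel_measurable borel"
  shows "(LINT x|lborel. f (- x)) = (LINT x|lborel. f x)"
  by (subst (2) lborel_uminus[symmetric], subst integral_distr) auto

lemma integral_lborel_translate:
  fixes f :: "'a::euclidean_space \<Rightarrow> 'b::{banach, second_countable_topology}"
  assumes [measurable]: "f \<in> borel_measurable borel"
  shows "(LINT x|lborel. f (a + x)) = (LINT x|lborel. f x)"
  by (subst (2) lborel_distr_plus[of a, symmetric], subst integral_distr) auto

lemma integrable_lborel_translate: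
  fixes f :: "'a::euclidean_space \<Rightarrow> 'b::{banach, second_countable_topology}"
  assumes f: "integrable lborel f"
  shows "integrable lborel (\<lambda>x. f (a + x))"
proof -
  have m: "f \<in> borel_measurable borel" using f by auto
  have "integrable (distr lborel borel ((+) a)) f" using f by (simp add: lborel_distr_plus)
  then show ?thesis by (subst (asm) integrable_distr_eq) (use m in auto)
qed

text \<open>Fatou's lemma, arranged to carry a uniform bound to a pointwise limit. It serves to
  remove Gaussian damping and to pass from difference quotients to a multiplication by a
  coordinate.\<close>

lemma nn_integral_limit_le:
  fixes f :: "nat \<Rightarrow> 'a \<Rightarrow> ennreal"
  assumes [measurable]: "\<And>i. f i \<in> borel_measurable M"
    and lim: "\<And>x. (\<lambda>i. f i x) \<longlonglongrightarrow> g x"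
    and le: "\<And>i. (\<integral>\<^sup>+x. f i x \<partial>M) \<le> C"
  shows "(\<integral>\<^sup>+x. g x \<partial>M) \<le> C"
proof -
  have "g x = liminf (\<lambda>i. f i x)" for x
    using lim_imp_Liminf[OF _ lim[of x]] by simp
  then have "(\<integral>\<^sup>+x. g x \<partial>M) = (\<integral>\<^sup>+x. liminf (\<lambda>i. f i x) \<partial>M)" by simp
  also have "\<dots> \<le> liminf (\<lambda>i. \<integral>\<^sup>+x. f i x \<partial>M)" by (rule nn_integral_liminf) auto
  also have "\<dots> \<le> limsup (\<lambda>i. \<integral>\<^sup>+x. f i x \<partial>M)" by (rule Liminf_le_Limsup) auto
  also have "\<dots> \<le> C" by (rule Limsup_bounded) (use le in auto)
  finally show ?thesis .
qed

lemma borel_measurable_cnj[measurable]: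
  "f \<in> borel_measurable M \<Longrightarrow> (\<lambda>x. cnj (f x)) \<in> borel_measurable M"
  by (rule borel_measurable_continuous_on[of cnj]) (auto intro!: continuous_intros)

lemma cnj_ft:
  assumes [measurable]: "H \<in> borel_measurable borel"
  shows "cnj (ft H x) = ft (\<lambda>y. cnj (H (- y))) x"
proof -
  have "cnj (ft H x) = (LINT y|lborel. cnj (H y) * cis (- (y \<bullet> x)))"
    unfolding ft_def by (subst Bochner_Integration.integral_cnj[symmetric]) (simp add: cis_cnj)
  also have "\<dots> = (LINT y|lborel. cnj (H (- y)) * cis (y \<bullet> x))"
    by (subst integral_lborel_uminus[symmetric]) (auto)
  finally show ?thesis by (simp add: ft_def)
qed

text \<open>The Schur test: split the product by the arithmetic-geometric inequality and integrate
  \<open>K\<close> in the variable that each half does not contain. The reflection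
  \<open>- y\<close> is there because the conjugate of \<open>ft H\<close> is the transform of the
  reflected conjugate of \<open>H\<close>.\<close>

lemma schur_gauss:
  fixes h :: "'a::euclidean_space \<Rightarrow> real" and K :: "'a \<Rightarrow> ennreal"
  assumes [measurable]: "h \<in> borel_measurable borel" "K \<in> borel_measurable borel"
    and h0: "\<And>x. 0 \<le> h x"
  shows "(\<integral>\<^sup>+x. \<integral>\<^sup>+y. ennreal (h x * h (- y)) * K (x + y) \<partial>lborel \<partial>lborel)
     \<le> (\<integral>\<^sup>+x. ennreal ((h x)\<^sup>2) \<partial>lborel) * (\<integral>\<^sup>+x. K x \<partial>lborel)"
proof -
  let ?A = "\<integral>\<^sup>+x. ennreal ((h x)\<^sup>2) \<partial>lborel"
  let ?K = "\<integral>\<^sup>+x. K x \<partial>lborel"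
  have s: "h x * h (-y) \<le> (h x)\<^sup>2 / 2 + (h (-y))\<^sup>2 / 2" for x y
    using sum_squares_bound[of "h x" "h (-y)"] by (simp add: field_simps)
  have "(\<integral>\<^sup>+x. \<integral>\<^sup>+y. ennreal (h x * h (- y)) * K (x + y) \<partial>lborel \<partial>lborel)
    \<le> (\<integral>\<^sup>+x. \<integral>\<^sup>+y. ennreal ((h x)\<^sup>2 / 2) * K (x + y) + ennreal ((h (-y))\<^sup>2 / 2) * K (y + x) \<partial>lborel \<partial>lborel)"
  proof (intro nn_integral_mono)
    fix x y
    have "ennreal (h x * h (- y)) * K (x + y) \<le> ennreal ((h x)\<^sup>2 / 2 + (h (-y))\<^sup>2 / 2) * K (x + y)"
      by (intro mult_right_mono ennreal_leI s) auto
    then show "ennreal (h x * h (- y)) * K (x + y) \<le> ennreal ((h x)\<^sup>2 / 2) * K (x + y) + ennreal ((h (-y))\<^sup>2 / 2) * K (y + x)"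
      by (simp add: ennreal_plus distrib_right add.commute)
  qed
  also have "\<dots> = (\<integral>\<^sup>+x. ennreal ((h x)\<^sup>2 / 2) * (\<integral>\<^sup>+y. K (x + y) \<partial>lborel) \<partial>lborel)
     + (\<integral>\<^sup>+x. \<integral>\<^sup>+y. ennreal ((h (-y))\<^sup>2 / 2) * K (y + x) \<partial>lborel \<partial>lborel)"
    by (subst nn_integral_add[symmetric]) (auto simp: nn_integral_add nn_integral_cmult)
  also have "(\<integral>\<^sup>+x. \<integral>\<^sup>+y. ennreal ((h (-y))\<^sup>2 / 2) * K (y + x) \<partial>lborel \<partial>lborel)
     = (\<integral>\<^sup>+y. \<integral>\<^sup>+x. ennreal ((h (-y))\<^sup>2 / 2) * K (y + x) \<partial>lborel \<partial>lborel)"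
    by (rule lborel_pair.Fubini') measurable
  also have "\<dots> = (\<integral>\<^sup>+y. ennreal ((h (-y))\<^sup>2 / 2) * ?K \<partial>lborel)"
    by (simp add: nn_integral_cmult nn_integral_lborel_translate)
  also have "\<dots> = (\<integral>\<^sup>+y. ennreal ((h y)\<^sup>2 / 2) * ?K \<partial>lborel)"
    by (rule nn_integral_lborel_uminus) measurable
  also have "(\<integral>\<^sup>+x. ennreal ((h x)\<^sup>2 / 2) * (\<integral>\<^sup>+y. K (x + y) \<partial>lborel) \<partial>lborel) = (\<integral>\<^sup>+y. ennreal ((h y)\<^sup>2 / 2) * ?K \<partial>lborel)"
    by (simp add: nn_integral_lborel_translate)
  also have "(\<integral>\<^sup>+y. ennreal ((h y)\<^sup>2 / 2) * ?K \<partial>lborel) + (\<integral>\<^sup>+y. ennreal ((h y)\<^sup>2 / 2) * ?K \<partial>lborel) = ?A * ?K"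
    by (subst nn_integral_add[symmetric])
       (auto simp: nn_integral_multc distrib_right[symmetric] simp flip: ennreal_plus)
  finally show ?thesis .
qed

text \<open>The damped square of \<open>ft H\<close> is the product of \<open>ft H\<close> with a
  Gaussian times its own conjugate. The multiplication formula turns its integral into a double
  integral of \<open>H\<close> against the transform \<open>K\<close> of the Gaussian, and the Schur
  test applies. Since \<open>ft H\<close> is bounded, the damping makes everything integrable
  beforehand.\<close>

lemma plancherel_gauss:
  fixes H :: "'a::euclidean_space \<Rightarrow> complex"
  assumes H: "integrable lborel H" and d: "d > 0"
  shows "(\<integral>\<^sup>+x. ennreal (exp (- d * (norm x)\<^sup>2) * (norm (ft H x))\<^sup>2) \<partial>lborel)
     \<le> ennreal ((2 * pi) ^ DIM('a)) * (\<integral>\<^sup>+x. ennreal ((norm (H x))\<^sup>2) \<partial>lborel)"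
proof -
  have [measurable]: "H \<in> borel_measurable borel" using H by auto
  define K :: "'a \<Rightarrow> real" where "K y = sqrt (pi / d) ^ DIM('a) * exp (- (norm y)\<^sup>2 / (4 * d))" for y
  have [measurable]: "K \<in> borel_measurable borel" unfolding K_def by measurable
  have K0: "K y \<ge> 0" for y unfolding K_def using d by simp
  define g where "g x = complex_of_real (exp (- d * (norm x)\<^sup>2)) * cnj (ft H x)" for x :: 'a
  have [measurable]: "g \<in> borel_measurable borel" unfolding g_def by measurable
  let ?I = "LINT y|lborel. norm (H y)"
  have gi: "integrable lborel g"
    by (rule Bochner_Integration.integrable_bound[OF integrable_mult_right[OF gauss_integral(1)[OF d], of ?I]])
       (auto simp: g_def norm_mult abs_mult intro!: mult_right_mono norm_ft_le[THEN order_trans] abs_ge_self)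
  let ?H = "\<lambda>y. cnj (H (- y))"
  have Hi: "integrable lborel ?H" using integrable_lborel_uminus[OF H] by simp
  have fg: "ft g y = (LINT z|lborel. ?H z * complex_of_real (K (y + z)))" for y
  proof -
    have "ft g y = (LINT x|lborel. (complex_of_real (exp (- d * (norm x)\<^sup>2)) * cis (x \<bullet> y)) * ft ?H x)"
      unfolding ft_def[of g] g_def by (subst cnj_ft) (auto simp: mult_ac)
    also have "\<dots> = (LINT z|lborel. ?H z * ft (\<lambda>x. complex_of_real (exp (- d * (norm x)\<^sup>2)) * cis (x \<bullet> y)) z)"
      by (rule ft_mult[OF Hi gauss_char(1)[OF d]])
    also have "(\<lambda>z. ft (\<lambda>x. complex_of_real (exp (- d * (norm x)\<^sup>2)) * cis (x \<bullet> y)) z) = (\<lambda>z. complex_of_real (K (y + z)))"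
      unfolding ft_def K_def gauss_char(2)[OF d, symmetric]
      by (simp add: mult.assoc cis_mult inner_add_right)
    finally show ?thesis .
  qed
  have fgi: "ennreal (norm (H y) * norm (ft g y)) \<le> (\<integral>\<^sup>+z. ennreal (norm (H y) * norm (H (-z))) * ennreal (K (y + z)) \<partial>lborel)" for y
  proof -
    \<comment> \<open>The case split covers a non-integrable integrand, whose Bochner integral is 0
      by default.\<close>
    have "ennreal (norm (ft g y)) \<le> (\<integral>\<^sup>+z. ennreal (norm (?H z * complex_of_real (K (y + z)))) \<partial>lborel)"
      unfolding fg by (cases "integrable lborel (\<lambda>z. ?H z * complex_of_real (K (y + z)))")
        (auto intro: integral_norm_bound_ennreal simp: not_integrable_integral_eq)
    also have "\<dots> = (\<integral>\<^sup>+z. ennreal (norm (H (-z))) * ennreal (K (y + z)) \<partial>lborel)"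
      by (simp add: norm_mult K0 ennreal_mult)
    finally have "ennreal (norm (H y)) * ennreal (norm (ft g y)) \<le> ennreal (norm (H y)) * (\<integral>\<^sup>+z. ennreal (norm (H (-z))) * ennreal (K (y + z)) \<partial>lborel)"
      by (rule mult_left_mono) simp
    then show ?thesis
      by (simp add: nn_integral_cmult[symmetric] ennreal_mult mult.assoc)
  qed
  \<comment> \<open>The total mass of \<open>K\<close> does not depend on \<open>d\<close>, since
    sqrt (pi / d) sqrt (4 pi d) = 2 pi; so the damping can be removed later.\<close>
  have KK: "(\<integral>\<^sup>+x. ennreal (K x) \<partial>lborel) = ennreal ((2 * pi) ^ DIM('a))"
  proof -
    have d4: "1 / (4 * d) > 0" using d by simp
    have 1: "K x = sqrt (pi / d) ^ DIM('a) * exp (- (1 / (4 * d)) * (norm x)\<^sup>2)" for x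
      by (simp add: K_def)
    have "(LINT x|lborel. K x) = sqrt (pi / d) ^ DIM('a) * sqrt (pi / (1 / (4 * d))) ^ DIM('a)"
      unfolding 1 by (subst integral_mult_right_zero, subst gauss_integral(2)[OF d4]) simp
    also have "\<dots> = (2 * pi) ^ DIM('a)"
    proof -
      have "sqrt (pi / d) * sqrt (pi / (1 / (4 * d))) = sqrt ((2 * pi)\<^sup>2)"
        unfolding real_sqrt_mult[symmetric] using d by (simp add: power2_eq_square)
      then have "sqrt (pi / d) * sqrt (pi / (1 / (4 * d))) = 2 * pi" by (subst (asm) real_sqrt_abs) simp
      then show ?thesis unfolding power_mult_distrib[symmetric] by simp
    qed
    finally have "(LINT x|lborel. K x) = (2 * pi) ^ DIM('a)" .
    moreover have "integrable lborel K"
      unfolding 1[abs_def] by (intro integrable_mult_right gauss_integral d4)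
    ultimately show ?thesis using nn_integral_eq_integral[of lborel K] K0 by simp
  qed
  have "(\<integral>\<^sup>+x. ennreal (exp (- d * (norm x)\<^sup>2) * (norm (ft H x))\<^sup>2) \<partial>lborel)
      = (\<integral>\<^sup>+x. ennreal (Re (g x * ft H x)) \<partial>lborel)"
    unfolding g_def by (simp add: mult.assoc mult.commute[of "cnj _"] flip: complex_norm_square of_real_power of_real_mult)
  also have "\<dots> = ennreal (LINT x|lborel. Re (g x * ft H x))"
  proof (rule nn_integral_eq_integral)
    have "integrable lborel (\<lambda>x. g x * ft H x)"
      by (rule Bochner_Integration.integrable_bound[OF integrable_mult_right[OF integrable_norm[OF gi], of ?I]])
         (auto simp: norm_mult abs_mult mult.commute[of "norm (g _)"] intro!: mult_right_mono norm_ft_le[THEN order_trans] abs_ge_self)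
    then show "integrable lborel (\<lambda>x. Re (g x * ft H x))" by (rule integrable_Re)
    show "AE x in lborel. 0 \<le> Re (g x * ft H x)"
      unfolding g_def by (simp add: mult.assoc mult.commute[of "cnj _"] flip: complex_norm_square of_real_power of_real_mult)
  qed
  also have "\<dots> \<le> ennreal (norm (LINT x|lborel. g x * ft H x))"
  proof -
    have "integrable lborel (\<lambda>x. g x * ft H x)"
      by (rule Bochner_Integration.integrable_bound[OF integrable_mult_right[OF integrable_norm[OF gi], of ?I]])
         (auto simp: norm_mult abs_mult mult.commute[of "norm (g _)"] intro!: mult_right_mono norm_ft_le[THEN order_trans] abs_ge_self)
    from integral_Re[OF this] show ?thesis by (metis complex_Re_le_cmod ennreal_leI)
  qed
  also have "\<dots> = ennreal (norm (LINT y|lborel. H y * ft g y))"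
    by (simp add: ft_mult[OF H gi])
  also have "\<dots> \<le> (\<integral>\<^sup>+y. ennreal (norm (H y * ft g y)) \<partial>lborel)"
    by (cases "integrable lborel (\<lambda>y. H y * ft g y)")
       (auto intro: integral_norm_bound_ennreal simp: not_integrable_integral_eq)
  also have "\<dots> \<le> (\<integral>\<^sup>+y. \<integral>\<^sup>+z. ennreal (norm (H y) * norm (H (-z))) * ennreal (K (y + z)) \<partial>lborel \<partial>lborel)"
    using fgi by (intro nn_integral_mono) (simp add: norm_mult)
  also have "\<dots> \<le> (\<integral>\<^sup>+x. ennreal ((norm (H x))\<^sup>2) \<partial>lborel) * (\<integral>\<^sup>+x. ennreal (K x) \<partial>lborel)"
    by (rule schur_gauss) auto
  finally show ?thesis by (simp add: KK mult.commute)
qed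

text \<open>Fatou along the damping constants 1 / (i + 1).\<close>

lemma plancherel_le:
  fixes H :: "'a::euclidean_space \<Rightarrow> complex"
  assumes H: "integrable lborel H"
  shows "(\<integral>\<^sup>+x. ennreal ((norm (ft H x))\<^sup>2) \<partial>lborel)
     \<le> ennreal ((2 * pi) ^ DIM('a)) * (\<integral>\<^sup>+x. ennreal ((norm (H x))\<^sup>2) \<partial>lborel)"
proof (rule nn_integral_limit_le)
  have [measurable]: "H \<in> borel_measurable borel" using H by auto
  show "(\<lambda>x. ennreal (exp (- (1 / real (Suc i)) * (norm x)\<^sup>2) * (norm (ft H x))\<^sup>2)) \<in> borel_measurable lborel" for i
    by measurable
  show "(\<integral>\<^sup>+x. ennreal (exp (- (1 / real (Suc i)) * (norm x)\<^sup>2) * (norm (ft H x))\<^sup>2) \<partial>lborel) \<le>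
     ennreal ((2 * pi) ^ DIM('a)) * (\<integral>\<^sup>+x. ennreal ((norm (H x))\<^sup>2) \<partial>lborel)" for i
    by (rule plancherel_gauss[OF H]) simp
  fix x
  have "(\<lambda>i. exp (- (1 / real (Suc i)) * (norm x)\<^sup>2) * (norm (ft H x))\<^sup>2) \<longlonglongrightarrow> exp (- 0 * (norm x)\<^sup>2) * (norm (ft H x))\<^sup>2"
    by (intro tendsto_intros LIMSEQ_Suc[OF lim_1_over_n])
  then show "(\<lambda>i. ennreal (exp (- (1 / real (Suc i)) * (norm x)\<^sup>2) * (norm (ft H x))\<^sup>2)) \<longlonglongrightarrow> ennreal ((norm (ft H x))\<^sup>2)"
    by (intro tendsto_ennrealI) simp
qed

lemma ft_translate:
  assumes H: "integrable lborel H"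
  shows "ft (\<lambda>y. H (a + y)) x = cis (- (a \<bullet> x)) * ft H x"
proof -
  have [measurable]: "H \<in> borel_measurable borel" using H by auto
  have "ft (\<lambda>y. H (a + y)) x = (LINT y|lborel. H (a + y) * cis ((- a + (a + y)) \<bullet> x))"
    by (simp add: ft_def)
  also have "\<dots> = (LINT y|lborel. H y * cis ((- a + y) \<bullet> x))"
    by (rule integral_lborel_translate) measurable
  also have "(\<lambda>y. H y * cis ((- a + y) \<bullet> x)) = (\<lambda>y. cis (- (a \<bullet> x)) * (H y * cis (y \<bullet> x)))"
    unfolding inner_add_left inner_minus_left cis_mult[symmetric] by (simp add: mult_ac)
  also have "(LINT y|lborel. cis (- (a \<bullet> x)) * (H y * cis (y \<bullet> x))) = cis (- (a \<bullet> x)) * ft H x"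
    unfolding ft_def by simp
  finally show ?thesis .
qed

lemma ft_diff:
  assumes "integrable lborel H" "integrable lborel G"
  shows "ft (\<lambda>y. H y - G y) x = ft H x - ft G x"
  unfolding ft_def left_diff_distrib
  by (rule Bochner_Integration.integral_diff) (intro integrable_ft_kernel assms)+

lemma ft_add:
  assumes "integrable lborel H" "integrable lborel G"
  shows "ft (\<lambda>y. H y + G y) x = ft H x + ft G x"
  unfolding ft_def distrib_right
  by (rule Bochner_Integration.integral_add) (intro integrable_ft_kernel assms)+

text \<open>Translation by h e multiplies \<open>ft H\<close> by a phase, so a difference quotient
  of \<open>H\<close> has transform (cis (- h (x . e)) - 1) / h times \<open>ft H\<close>, which
  tends in modulus to |x . e| |ft H|. A square-integrable difference bound \<open>D\<close> thus
  takes the place of a derivative of \<open>H\<close>.\<close>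

lemma plancherel_diff:
  fixes H :: "'a::euclidean_space \<Rightarrow> complex"
  assumes H: "integrable lborel H" and [measurable]: "D \<in> borel_measurable borel"
    and h0: "h0 > 0"
    and D: "\<And>h y. 0 < h \<Longrightarrow> h < h0 \<Longrightarrow> norm (H (y + h *\<^sub>R e) - H y) \<le> h * D y"
  shows "(\<integral>\<^sup>+x. ennreal ((x \<bullet> e)\<^sup>2 * (norm (ft H x))\<^sup>2) \<partial>lborel)
     \<le> ennreal ((2 * pi) ^ DIM('a)) * (\<integral>\<^sup>+x. ennreal ((D x)\<^sup>2) \<partial>lborel)"
proof (rule nn_integral_limit_le)
  have [measurable]: "H \<in> borel_measurable borel" using H by auto
  \<comment> \<open>The denominator starts at 2, so that every step is strictly below
    \<open>h0\<close>.\<close>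
  define h where "h i = h0 / real (Suc (Suc i))" for i
  have h: "0 < h i" "h i < h0" for i using h0 by (auto simp: h_def field_simps intro: add_pos_nonneg)
  have hlim: "h \<longlonglongrightarrow> 0" unfolding h_def
    using LIMSEQ_Suc[OF LIMSEQ_Suc[OF lim_const_over_n[of h0]]] by simp
  let ?f = "\<lambda>i x. ennreal ((norm ((cis (- (h i * (x \<bullet> e))) - 1) / h i))\<^sup>2 * (norm (ft H x))\<^sup>2)"
  show "?f i \<in> borel_measurable lborel" for i by measurable
  show "(\<integral>\<^sup>+x. ?f i x \<partial>lborel) \<le> ennreal ((2 * pi) ^ DIM('a)) * (\<integral>\<^sup>+x. ennreal ((D x)\<^sup>2) \<partial>lborel)" for i
  proof -
    let ?G = "\<lambda>y. H (h i *\<^sub>R e + y) - H y"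
    have Gi: "integrable lborel (\<lambda>y. H (h i *\<^sub>R e + y))" by (rule integrable_lborel_translate[OF H])
    have Gf: "ft ?G x = (cis (- (h i * (x \<bullet> e))) - 1) * ft H x" for x
      using ft_diff[OF Gi H] ft_translate[OF H] by (simp add: left_diff_distrib inner_commute)
    have "(\<integral>\<^sup>+x. ?f i x \<partial>lborel) = (\<integral>\<^sup>+x. ennreal (1 / (h i)\<^sup>2) * ennreal ((norm (ft ?G x))\<^sup>2) \<partial>lborel)"
      unfolding Gf by (subst ennreal_mult[symmetric]) (auto simp: norm_mult norm_divide power_mult_distrib power_divide)
    also have "\<dots> = ennreal (1 / (h i)\<^sup>2) * (\<integral>\<^sup>+x. ennreal ((norm (ft ?G x))\<^sup>2) \<partial>lborel)"
      by (rule nn_integral_cmult) measurable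
    also have "\<dots> \<le> ennreal (1 / (h i)\<^sup>2) * (ennreal ((2 * pi) ^ DIM('a)) * (\<integral>\<^sup>+x. ennreal ((norm (?G x))\<^sup>2) \<partial>lborel))"
      by (intro mult_left_mono plancherel_le Bochner_Integration.integrable_diff Gi H) auto
    also have "\<dots> \<le> ennreal (1 / (h i)\<^sup>2) * (ennreal ((2 * pi) ^ DIM('a)) * (\<integral>\<^sup>+x. ennreal ((h i)\<^sup>2) * ennreal ((D x)\<^sup>2) \<partial>lborel))"
    proof (intro mult_left_mono nn_integral_mono)
      fix x
      have "norm (?G x) \<le> h i * D x" using D[OF h(1)[of i] h(2)[of i], of x] by (simp add: add.commute)
      then have "(norm (?G x))\<^sup>2 \<le> (h i * D x)\<^sup>2" by (intro power_mono) auto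
      then show "ennreal ((norm (?G x))\<^sup>2) \<le> ennreal ((h i)\<^sup>2) * ennreal ((D x)\<^sup>2)"
        by (subst ennreal_mult[symmetric]) (auto simp: power_mult_distrib intro: ennreal_leI)
    qed auto
    also have "\<dots> = (ennreal (1 / (h i)\<^sup>2) * ennreal ((h i)\<^sup>2)) * (ennreal ((2 * pi) ^ DIM('a)) * (\<integral>\<^sup>+x. ennreal ((D x)\<^sup>2) \<partial>lborel))"
      by (subst nn_integral_cmult) (auto simp: mult_ac)
    also have "ennreal (1 / (h i)\<^sup>2) * ennreal ((h i)\<^sup>2) = 1"
      using h(1)[of i] by (subst ennreal_mult[symmetric]) auto
    finally show ?thesis by simp
  qed
  fix x
  let ?t = "x \<bullet> e"
  \<comment> \<open>The limit of the quotients is the derivative of the complex exponential at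
    0.\<close>
  have "((\<lambda>z. exp (- \<i> * ?t * z)) has_field_derivative (- \<i> * ?t)) (at 0)"
    by (auto intro!: derivative_eq_intros)
  then have "((\<lambda>z. (exp (- \<i> * ?t * z) - 1) / z) \<longlongrightarrow> - \<i> * ?t) (at 0)"
    by (simp add: has_field_derivative_iff)
  then have "(\<lambda>i. (exp (- \<i> * ?t * complex_of_real (h i)) - 1) / complex_of_real (h i)) \<longlonglongrightarrow> - \<i> * ?t"
    by (rule filterlim_compose)
       (auto simp: filterlim_at h less_imp_neq[OF h(1), symmetric] intro!: always_eventually tendsto_of_real[OF hlim, where 'a=complex, simplified])
  moreover have "exp (- \<i> * ?t * complex_of_real (h i)) = cis (- (h i * ?t))" for i
    by (simp add: cis_conv_exp mult_ac)
  ultimately have "(\<lambda>i. (cis (- (h i * ?t)) - 1) / complex_of_real (h i)) \<longlonglongrightarrow> - \<i> * ?t" by simp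
  then have "(\<lambda>i. (norm ((cis (- (h i * ?t)) - 1) / h i))\<^sup>2 * (norm (ft H x))\<^sup>2) \<longlonglongrightarrow> (norm (- \<i> * ?t))\<^sup>2 * (norm (ft H x))\<^sup>2"
    by (intro tendsto_intros)
  then show "(\<lambda>i. ?f i x) \<longlonglongrightarrow> ennreal (?t\<^sup>2 * (norm (ft H x))\<^sup>2)"
    by (intro tendsto_ennrealI) (simp add: norm_mult)
qed

text \<open>Sum of the coordinate bounds over \<open>Basis\<close>. The weight is the reciprocal of
  the one in \<open>weighted_norm2\<close>, and \<epsilon> will be the width of a shell, so that
  \<epsilon>^2 compensates for \<open>D\<close> of size 1/\<epsilon>.\<close>

lemma plancherel_weighted:
  fixes H :: "'a::euclidean_space \<Rightarrow> complex"
  assumes H: "integrable lborel H" and [measurable]: "D \<in> borel_measurable borel"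
    and h0: "h0 > 0"
    and D: "\<And>e h y. e \<in> Basis \<Longrightarrow> 0 < h \<Longrightarrow> h < h0 \<Longrightarrow> norm (H (y + h *\<^sub>R e) - H y) \<le> h * D y"
  shows "(\<integral>\<^sup>+x. ennreal ((1 + \<epsilon>\<^sup>2 * (norm x)\<^sup>2) * (norm (ft H x))\<^sup>2) \<partial>lborel)
     \<le> ennreal ((2 * pi) ^ DIM('a)) * ((\<integral>\<^sup>+x. ennreal ((norm (H x))\<^sup>2) \<partial>lborel)
          + ennreal (\<epsilon>\<^sup>2 * DIM('a)) * (\<integral>\<^sup>+x. ennreal ((D x)\<^sup>2) \<partial>lborel))"
proof -
  have [measurable]: "H \<in> borel_measurable borel" using H by auto
  let ?P = "ennreal ((2 * pi) ^ DIM('a))"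
  have n: "(norm x)\<^sup>2 = (\<Sum>e\<in>Basis. (x \<bullet> e)\<^sup>2)" for x :: 'a
    unfolding power2_norm_eq_inner using inner_eq_sum_Basis[of x x] by (simp add: power2_eq_square)
  have "(\<integral>\<^sup>+x. ennreal ((1 + \<epsilon>\<^sup>2 * (norm x)\<^sup>2) * (norm (ft H x))\<^sup>2) \<partial>lborel)
    = (\<integral>\<^sup>+x. (ennreal ((norm (ft H x))\<^sup>2) + ennreal (\<epsilon>\<^sup>2) * (\<Sum>e\<in>Basis. ennreal ((x \<bullet> e)\<^sup>2 * (norm (ft H x))\<^sup>2))) \<partial>lborel)"
    by (intro nn_integral_cong)
       (simp add: n distrib_right sum_distrib_right sum_distrib_left mult.assoc sum_nonneg flip: ennreal_mult ennreal_plus)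
  also have "\<dots> = (\<integral>\<^sup>+x. ennreal ((norm (ft H x))\<^sup>2) \<partial>lborel)
    + ennreal (\<epsilon>\<^sup>2) * (\<Sum>e\<in>Basis. (\<integral>\<^sup>+x. ennreal ((x \<bullet> e)\<^sup>2 * (norm (ft H x))\<^sup>2) \<partial>lborel))"
    by (subst nn_integral_add, measurable, subst nn_integral_cmult, measurable, subst nn_integral_sum, measurable)
  also have "\<dots> \<le> ?P * (\<integral>\<^sup>+x. ennreal ((norm (H x))\<^sup>2) \<partial>lborel)
     + ennreal (\<epsilon>\<^sup>2) * (\<Sum>e\<in>(Basis::'a set). ?P * (\<integral>\<^sup>+x. ennreal ((D x)\<^sup>2) \<partial>lborel))"
    by (intro add_mono mult_left_mono sum_mono plancherel_le[OF H] plancherel_diff[OF H _ h0]) (auto intro: D)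
  also have "\<dots> = ?P * ((\<integral>\<^sup>+x. ennreal ((norm (H x))\<^sup>2) \<partial>lborel)
          + ennreal (\<epsilon>\<^sup>2 * DIM('a)) * (\<integral>\<^sup>+x. ennreal ((D x)\<^sup>2) \<partial>lborel))"
    by (simp add: distrib_left ennreal_mult mult_ac flip: ennreal_of_nat_eq_real_of_nat)
  finally show ?thesis .
qed

section \<open>Pairing functions of small mean square with Fourier transforms\<close>

text \<open>A smooth substitute for the squared norm over the ball of radius 1/\<epsilon>.\<close>

definition weighted_norm2 :: "real \<Rightarrow> ('a::euclidean_space \<Rightarrow> complex) \<Rightarrow> ennreal" where
  "weighted_norm2 \<epsilon> u = (\<integral>\<^sup>+x. ennreal ((norm (u x))\<^sup>2 / (1 + \<epsilon>\<^sup>2 * (norm x)\<^sup>2)) \<partial>lborel)"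

lemma weighted_cauchy_schwarz:
  assumes [measurable]: "u \<in> borel_measurable borel" "v \<in> borel_measurable borel"
  shows "(\<integral>\<^sup>+x. ennreal (norm (u x * v x)) \<partial>lborel)\<^sup>2
    \<le> weighted_norm2 \<epsilon> u * (\<integral>\<^sup>+x. ennreal ((1 + \<epsilon>\<^sup>2 * (norm x)\<^sup>2) * (norm (v x))\<^sup>2) \<partial>lborel)"
proof -
  let ?w = "\<lambda>x. 1 + \<epsilon>\<^sup>2 * (norm x)\<^sup>2"
  have w: "?w x > 0" for x by (intro add_pos_nonneg) auto
  have w': "?w x \<noteq> 0" for x using w[of x] by linarith
  have "(\<integral>\<^sup>+x. ennreal (norm (u x * v x)) \<partial>lborel) = (\<integral>\<^sup>+x. ennreal (norm (u x) / sqrt (?w x)) * ennreal (sqrt (?w x) * norm (v x)) \<partial>lborel)"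
    using w by (intro nn_integral_cong, subst ennreal_mult[symmetric]) (auto simp: norm_mult less_imp_le w')
  moreover have "(\<integral>\<^sup>+x. (ennreal (norm (u x) / sqrt (?w x)))\<^sup>2 \<partial>lborel) = weighted_norm2 \<epsilon> u"
    unfolding weighted_norm2_def using w by (intro nn_integral_cong, subst ennreal_power) (auto simp: power_divide less_imp_le)
  moreover have "(\<integral>\<^sup>+x. (ennreal (sqrt (?w x) * norm (v x)))\<^sup>2 \<partial>lborel) = (\<integral>\<^sup>+x. ennreal (?w x * (norm (v x))\<^sup>2) \<partial>lborel)"
    using w by (intro nn_integral_cong, subst ennreal_power) (auto simp: power_mult_distrib less_imp_le)
  ultimately show ?thesis
    using Cauchy_Schwarz_nn_integral[of "\<lambda>x. ennreal (norm (u x) / sqrt (?w x))" lborel "\<lambda>x. ennreal (sqrt (?w x) * norm (v x))"]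
    by simp
qed

text \<open>Growth o(R) is encoded by linear bounds with arbitrarily small slope, valid for all
  positive radii; in this form they can be summed over dyadic balls. The integral is a nonnegative
  one, so local square integrability is included.\<close>

definition Bstar0_borel :: "('a::euclidean_space \<Rightarrow> complex) \<Rightarrow> bool" where
  "Bstar0_borel u \<longleftrightarrow> u \<in> borel_measurable borel \<and>
     (\<forall>\<eta>>0. \<exists>C\<ge>0. \<forall>R>0. (\<integral>\<^sup>+x. ennreal ((norm (u x))\<^sup>2) * indicator (ball 0 R) x \<partial>lborel) \<le> ennreal (\<eta> * R + C))"

text \<open>If 2^j/\<epsilon> is the first dyadic radius beyond \<open>norm x\<close>, then either j
  = 0 or \<epsilon> |x| is at least 2^(j-1); in both cases the weight is at most 4 / 4^j, the single
  term of index j.\<close>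

lemma dyadic_weight_le:
  fixes x :: "'a::euclidean_space"
  assumes e: "\<epsilon> > 0"
  shows "ennreal (a\<^sup>2 / (1 + \<epsilon>\<^sup>2 * (norm x)\<^sup>2)) \<le> (\<Sum>j. ennreal (4 * (1/4)^j) * (ennreal (a\<^sup>2) * indicator (ball 0 (2^j/\<epsilon>)) x))"
proof -
  define y where "y = \<epsilon> * norm x"
  have y0: "y \<ge> 0" using e by (simp add: y_def)
  have "\<exists>j. y < 2^j" using real_arch_pow[of 2 y] by auto
  then obtain j where j: "y < 2^j" "\<And>i. i < j \<Longrightarrow> \<not> y < 2^i"
    using exists_least_iff[of "\<lambda>j. y < 2^j"] by auto
  have "1 / (1 + y\<^sup>2) \<le> 4 * (1/4)^j"
  proof (cases j)
    case 0
    have "1 / (1 + y\<^sup>2) \<le> 1 / 1" by (intro divide_left_mono) (auto intro: add_pos_nonneg)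
    then show ?thesis using 0 by simp
  next
    case (Suc i)
    have "2^i \<le> y" using j(2)[of i] Suc by auto
    then have "(2^i)\<^sup>2 \<le> y\<^sup>2" by (intro power_mono) auto
    then have "4^i \<le> 1 + y\<^sup>2" by (simp add: power_even_eq[symmetric] power2_eq_square power_mult_distrib[symmetric])
    then have "1 / (1 + y\<^sup>2) \<le> 1 / 4^i" by (intro divide_left_mono mult_pos_pos) (auto intro: add_pos_nonneg)
    then show ?thesis using Suc by (simp add: power_divide)
  qed
  then have "a\<^sup>2 * (1 / (1 + y\<^sup>2)) \<le> a\<^sup>2 * (4 * (1/4)^j)" by (intro mult_left_mono) auto
  then have "ennreal (a\<^sup>2 / (1 + \<epsilon>\<^sup>2 * (norm x)\<^sup>2)) \<le> ennreal (4 * (1/4)^j * a\<^sup>2)"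
    by (intro ennreal_leI) (simp add: y_def power_mult_distrib mult_ac)
  also have "\<dots> = ennreal (4 * (1/4)^j) * (ennreal (a\<^sup>2) * indicator (ball 0 (2^j/\<epsilon>)) x)"
    using j(1) e by (subst ennreal_mult) (auto simp: y_def field_simps)
  also have "\<dots> \<le> (\<Sum>j. ennreal (4 * (1/4)^j) * (ennreal (a\<^sup>2) * indicator (ball 0 (2^j/\<epsilon>)) x))"
    using sum_le_suminf[of "\<lambda>j. ennreal (4 * (1/4)^j) * (ennreal (a\<^sup>2) * indicator (ball 0 (2^j/\<epsilon>)) x)" "{j}"] by auto
  finally show ?thesis .
qed

text \<open>Summing the dyadic bounds gives two geometric series: ratio 1/2 yields 8 \<eta> /
  \<epsilon>, and ratio 1/4 yields 16 C / 3.\<close>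

lemma weighted_norm2_le:
  fixes u :: "'a::euclidean_space \<Rightarrow> complex"
  assumes [measurable]: "u \<in> borel_measurable borel" and e: "\<epsilon> > 0" and C: "C \<ge> 0" "\<eta> > 0"
    and le: "\<And>R. R > 0 \<Longrightarrow> (\<integral>\<^sup>+x. ennreal ((norm (u x))\<^sup>2) * indicator (ball 0 R) x \<partial>lborel) \<le> ennreal (\<eta> * R + C)"
  shows "weighted_norm2 \<epsilon> u \<le> ennreal (8 * \<eta> / \<epsilon> + 16 / 3 * C)"
proof -
  have [measurable]: "Measurable.pred borel (\<lambda>x. x \<in> ball (0::'a) r)" for r by (simp add: pred_def)
  have "weighted_norm2 \<epsilon> u \<le> (\<integral>\<^sup>+x. (\<Sum>j. ennreal (4 * (1/4)^j) * (ennreal ((norm (u x))\<^sup>2) * indicator (ball 0 (2^j/\<epsilon>)) x)) \<partial>lborel)"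
    unfolding weighted_norm2_def by (intro nn_integral_mono dyadic_weight_le e)
  also have "\<dots> = (\<Sum>j. ennreal (4 * (1/4)^j) * (\<integral>\<^sup>+x. ennreal ((norm (u x))\<^sup>2) * indicator (ball 0 (2^j/\<epsilon>)) x \<partial>lborel))"
    by (subst nn_integral_suminf, measurable, intro suminf_cong nn_integral_cmult, measurable)
  also have "\<dots> \<le> (\<Sum>j. ennreal (4 * (1/4)^j) * ennreal (\<eta> * (2^j/\<epsilon>) + C))"
    using e by (intro suminf_le mult_left_mono le) auto
  also have "\<dots> = (\<Sum>j. ennreal (4 * \<eta> / \<epsilon> * (1/2)^j + 4 * C * (1/4)^j))"
  proof (intro suminf_cong)
    fix j :: nat
    have "(1/4)^j * 2^j = (1/2::real)^j" by (simp flip: power_mult_distrib)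
    then have "4 * (1/4)^j * (\<eta> * (2^j/\<epsilon>) + C) = 4 * \<eta> / \<epsilon> * (1/2)^j + 4 * C * (1/4)^j"
      by (simp add: algebra_simps)
    then show "ennreal (4 * (1/4)^j) * ennreal (\<eta> * (2^j/\<epsilon>) + C) = ennreal (4 * \<eta> / \<epsilon> * (1/2)^j + 4 * C * (1/4)^j)"
      using C e by (subst ennreal_mult[symmetric]) auto
  qed
  also have "\<dots> = ennreal (4 * \<eta> / \<epsilon> * (1 / (1 - 1/2)) + 4 * C * (1 / (1 - 1/4)))"
    by (intro suminf_ennreal_eq sums_add sums_mult geometric_sums) (use C e in auto)
  finally show ?thesis by simp
qed

lemma Bstar0_borel_weighted_norm2_small:
  assumes "Bstar0_borel u" and d: "\<delta> > 0"
  shows "\<exists>e0>0. \<forall>\<epsilon>. 0 < \<epsilon> \<and> \<epsilon> < e0 \<longrightarrow> ennreal \<epsilon> * weighted_norm2 \<epsilon> u \<le> ennreal \<delta>"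
proof -
  have m: "u \<in> borel_measurable borel" using assms by (simp add: Bstar0_borel_def)
  \<comment> \<open>Slope \<delta>/16 makes the first series contribute \<delta>/2; the choice of
    \<open>e0\<close> below keeps the second at most \<delta>/3.\<close>
  have "\<delta>/16 > 0" using d by simp
  with assms(1) obtain C where C: "C \<ge> 0" "\<And>R. R > 0 \<Longrightarrow> (\<integral>\<^sup>+x. ennreal ((norm (u x))\<^sup>2) * indicator (ball 0 R) x \<partial>lborel) \<le> ennreal (\<delta>/16 * R + C)"
    unfolding Bstar0_borel_def by blast
  define e0 where "e0 = \<delta> / (16 * (C + 1))"
  have e0: "e0 > 0" using d C by (simp add: e0_def)
  show ?thesis
  proof (intro exI conjI allI impI)
    show "e0 > 0" by fact
    fix \<epsilon> assume e: "0 < \<epsilon> \<and> \<epsilon> < e0"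
    then have "ennreal \<epsilon> * weighted_norm2 \<epsilon> u \<le> ennreal \<epsilon> * ennreal (8 * (\<delta>/16) / \<epsilon> + 16 / 3 * C)"
      using C d by (intro mult_left_mono weighted_norm2_le m) auto
    also have "\<dots> = ennreal (\<epsilon> * (8 * (\<delta>/16) / \<epsilon> + 16 / 3 * C))"
      using e C d by (subst ennreal_mult) auto
    also have "\<epsilon> * (8 * (\<delta>/16) / \<epsilon> + 16 / 3 * C) = \<delta> / 2 + 16/3 * C * \<epsilon>"
      using e by (simp add: field_simps)
    also have "\<dots> \<le> \<delta>"
    proof -
      have "C * \<epsilon> \<le> (C + 1) * e0" using e C by (intro mult_mono) auto
      also have "\<dots> = \<delta> / 16"
      proof -
        have "C + 1 > 0" using C by simp
        then show ?thesis unfolding e0_def by (simp add: divide_simps)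
      qed
      finally show ?thesis using d by (simp add: field_simps)
    qed
    finally show "ennreal \<epsilon> * weighted_norm2 \<epsilon> u \<le> ennreal \<delta>" by (simp add: ennreal_leI)
  qed
qed

lemma Bstar0_borel_weighted_norm2_finite:
  assumes "Bstar0_borel u" shows "weighted_norm2 1 u < \<infinity>"
proof -
  have m: "u \<in> borel_measurable borel" using assms by (simp add: Bstar0_borel_def)
  obtain C where C: "C \<ge> 0" "\<And>R. R > 0 \<Longrightarrow> (\<integral>\<^sup>+x. ennreal ((norm (u x))\<^sup>2) * indicator (ball 0 R) x \<partial>lborel) \<le> ennreal (1 * R + C)"
    using assms zero_less_one unfolding Bstar0_borel_def by blast
  have "weighted_norm2 1 u \<le> ennreal (8 * 1 / 1 + 16 / 3 * C)" by (rule weighted_norm2_le[OF m _ C(1) _ C(2)]) auto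
  from le_less_trans[OF this ennreal_less_top] show ?thesis by simp
qed

text \<open>Cauchy-Schwarz with \<epsilon> = 1. This gives a meaning to the pairing of a growing
  \<open>u\<close> with \<open>ft H\<close>.\<close>

lemma integrable_ft_pairing:
  fixes u :: "'a::euclidean_space \<Rightarrow> complex"
  assumes "Bstar0_borel u" and H: "integrable lborel H" and [measurable]: "D \<in> borel_measurable borel"
    and h0: "h0 > 0"
    and D: "\<And>e h y. e \<in> Basis \<Longrightarrow> 0 < h \<Longrightarrow> h < h0 \<Longrightarrow> norm (H (y + h *\<^sub>R e) - H y) \<le> h * D y"
    and fin: "(\<integral>\<^sup>+x. ennreal ((norm (H x))\<^sup>2) \<partial>lborel) < \<infinity>" "(\<integral>\<^sup>+x. ennreal ((D x)\<^sup>2) \<partial>lborel) < \<infinity>"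
  shows "integrable lborel (\<lambda>x. u x * ft H x)"
proof (rule integrableI_bounded)
  have m[measurable]: "H \<in> borel_measurable borel" "u \<in> borel_measurable borel"
    using H assms(1) by (auto simp: Bstar0_borel_def)
  show "(\<lambda>x. u x * ft H x) \<in> borel_measurable lborel" by measurable
  have "(\<integral>\<^sup>+x. ennreal (norm (u x * ft H x)) \<partial>lborel)\<^sup>2
    \<le> weighted_norm2 1 u * (\<integral>\<^sup>+x. ennreal ((1 + 1\<^sup>2 * (norm x)\<^sup>2) * (norm (ft H x))\<^sup>2) \<partial>lborel)"
    by (rule weighted_cauchy_schwarz) measurable
  also have "\<dots> \<le> weighted_norm2 1 u * (ennreal ((2 * pi) ^ DIM('a)) * ((\<integral>\<^sup>+x. ennreal ((norm (H x))\<^sup>2) \<partial>lborel)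
          + ennreal ((1::real)\<^sup>2 * DIM('a)) * (\<integral>\<^sup>+x. ennreal ((D x)\<^sup>2) \<partial>lborel)))"
    by (rule mult_left_mono, rule plancherel_weighted[OF H _ h0 D]) simp_all
  also have "\<dots> < \<infinity>" using fin Bstar0_borel_weighted_norm2_finite[OF assms(1)] by (auto simp: ennreal_mult_less_top)
  finally show "(\<integral>\<^sup>+x. ennreal (norm (u x * ft H x)) \<partial>lborel) < \<infinity>"
    by (simp add: power_less_top_ennreal)
qed

lemma ennreal_power2_le_imp_le:
  assumes "a ^ 2 \<le> ennreal d ^ 2" and d: "d \<ge> 0"
  shows "a \<le> ennreal d"
proof (cases a)
  case (real r)
  then have "r\<^sup>2 \<le> d\<^sup>2" using assms by (simp add: ennreal_power)
  then show ?thesis using real d power2_le_imp_le by (auto intro: ennreal_leI)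
next
  case top
  with assms show ?thesis by (simp add: ennreal_power top_unique)
qed

text \<open>The bounds A \<epsilon> and A / \<epsilon> have the size found for a bump of width
  \<epsilon> across a hypersurface. They make the weighted norm of \<open>ft H\<close> of order
  \<epsilon>, while \<open>weighted_norm2\<close> of \<open>u\<close> is o(1/\<epsilon>). The
  threshold \<open>e0\<close> is chosen before \<open>H\<close>, because the cutoffs vary with
  \<epsilon>.\<close>

lemma Bstar0_borel_ft_small:
  fixes u :: "'a::euclidean_space \<Rightarrow> complex"
  assumes u: "Bstar0_borel u" and d: "\<delta> > 0" and A: "A > 0"
  shows "\<exists>e0>0. \<forall>\<epsilon>. 0 < \<epsilon> \<and> \<epsilon> < e0 \<longrightarrow> (\<forall>H D h0. integrable lborel H \<longrightarrow> D \<in> borel_measurable borel \<longrightarrow>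
      h0 > 0 \<longrightarrow> (\<forall>e\<in>Basis. \<forall>h y. 0 < h \<and> h < h0 \<longrightarrow> norm (H (y + h *\<^sub>R e) - H y) \<le> h * D y) \<longrightarrow>
      (\<integral>\<^sup>+x. ennreal ((norm (H x))\<^sup>2) \<partial>lborel) \<le> ennreal (A * \<epsilon>) \<longrightarrow>
      (\<integral>\<^sup>+x. ennreal ((D x)\<^sup>2) \<partial>lborel) \<le> ennreal (A / \<epsilon>) \<longrightarrow>
      norm (LINT x|lborel. u x * ft H x) \<le> \<delta>)"
proof -
  let ?n = "real DIM('a)"
  define B where "B = (2 * pi) ^ DIM('a) * (A * (1 + ?n))"
  have B: "B > 0" using A by (auto simp: B_def intro!: mult_pos_pos add_pos_nonneg)
  then have "\<delta>\<^sup>2 / B > 0" using d by simp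
  from Bstar0_borel_weighted_norm2_small[OF u this] obtain e0 where e0: "e0 > 0"
    "\<And>\<epsilon>. 0 < \<epsilon> \<Longrightarrow> \<epsilon> < e0 \<Longrightarrow> ennreal \<epsilon> * weighted_norm2 \<epsilon> u \<le> ennreal (\<delta>\<^sup>2 / B)" by auto
  show ?thesis
  proof (intro exI[of _ e0] conjI allI impI e0(1))
    fix \<epsilon> H D h0
    assume e: "0 < \<epsilon> \<and> \<epsilon> < e0" and H: "integrable lborel H" and [measurable]: "D \<in> borel_measurable borel"
      and h0: "(h0::real) > 0" and D: "\<forall>e\<in>Basis. \<forall>h y. 0 < h \<and> h < h0 \<longrightarrow> norm (H (y + h *\<^sub>R e) - H y :: complex) \<le> h * D (y::'a)"
      and HA: "(\<integral>\<^sup>+x. ennreal ((norm (H x))\<^sup>2) \<partial>lborel) \<le> ennreal (A * \<epsilon>)"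
      and DA: "(\<integral>\<^sup>+x. ennreal ((D x)\<^sup>2) \<partial>lborel) \<le> ennreal (A / \<epsilon>)"
    have m[measurable]: "H \<in> borel_measurable borel" "u \<in> borel_measurable borel"
      using H u by (auto simp: Bstar0_borel_def)
    have D': "norm (H (y + h *\<^sub>R e) - H y) \<le> h * D y" if "e \<in> Basis" "0 < h" "h < h0" for e h y
      using D that by auto
    have "(\<integral>\<^sup>+x. ennreal (norm (u x * ft H x)) \<partial>lborel)\<^sup>2
      \<le> weighted_norm2 \<epsilon> u * (\<integral>\<^sup>+x. ennreal ((1 + \<epsilon>\<^sup>2 * (norm x)\<^sup>2) * (norm (ft H x))\<^sup>2) \<partial>lborel)"
      by (rule weighted_cauchy_schwarz) measurable
    also have "\<dots> \<le> weighted_norm2 \<epsilon> u * (ennreal ((2 * pi) ^ DIM('a)) * ((\<integral>\<^sup>+x. ennreal ((norm (H x))\<^sup>2) \<partial>lborel)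
            + ennreal (\<epsilon>\<^sup>2 * DIM('a)) * (\<integral>\<^sup>+x. ennreal ((D x)\<^sup>2) \<partial>lborel)))"
      by (intro mult_left_mono plancherel_weighted[OF H _ h0 D']) auto
    also have "\<dots> \<le> weighted_norm2 \<epsilon> u * (ennreal ((2 * pi) ^ DIM('a)) * (ennreal (A * \<epsilon>)
            + ennreal (\<epsilon>\<^sup>2 * DIM('a)) * ennreal (A / \<epsilon>)))"
      by (intro mult_left_mono add_mono HA DA) auto
    also have "ennreal (A * \<epsilon>) + ennreal (\<epsilon>\<^sup>2 * DIM('a)) * ennreal (A / \<epsilon>) = ennreal (A * \<epsilon> + \<epsilon>\<^sup>2 * ?n * (A / \<epsilon>))"
      using e A by (subst ennreal_mult[symmetric], simp, simp, subst ennreal_plus[symmetric]) auto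
    also have "A * \<epsilon> + \<epsilon>\<^sup>2 * ?n * (A / \<epsilon>) = A * (1 + ?n) * \<epsilon>"
      using e by (simp add: field_simps power2_eq_square)
    also have "weighted_norm2 \<epsilon> u * (ennreal ((2 * pi) ^ DIM('a)) * ennreal (A * (1 + ?n) * \<epsilon>)) = ennreal B * (ennreal \<epsilon> * weighted_norm2 \<epsilon> u)"
      unfolding B_def using e A by (simp add: ennreal_mult mult_ac)
    also have "\<dots> \<le> ennreal B * ennreal (\<delta>\<^sup>2 / B)"
      using e by (intro mult_left_mono e0) auto
    also have "\<dots> = ennreal \<delta> ^ 2" using B d by (simp flip: ennreal_mult add: ennreal_power)
    finally have "(\<integral>\<^sup>+x. ennreal (norm (u x * ft H x)) \<partial>lborel) \<le> ennreal \<delta>"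
      by (rule ennreal_power2_le_imp_le) (use d in simp)
    moreover have "ennreal (norm (LINT x|lborel. u x * ft H x)) \<le> (\<integral>\<^sup>+x. ennreal (norm (u x * ft H x)) \<partial>lborel)"
      by (cases "integrable lborel (\<lambda>x. u x * ft H x)")
         (auto intro: integral_norm_bound_ennreal simp: not_integrable_integral_eq)
    ultimately have "ennreal (norm (LINT x|lborel. u x * ft H x)) \<le> ennreal \<delta>" by (rule order_trans[rotated])
    then show "norm (LINT x|lborel. u x * ft H x) \<le> \<delta>" using d by (subst (asm) ennreal_le_iff) auto
  qed
qed

text \<open>Test functions on the Fourier side are only Lipschitz: the weight \<open>1 + \<epsilon>\<^sup>2|x|\<^sup>2\<close> costs one
  difference quotient, and products with multipliers in \<open>poly_class\<close> stay in the class.\<close>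

definition gauss_class :: "('a::euclidean_space \<Rightarrow> complex) \<Rightarrow> bool" where
  "gauss_class H \<longleftrightarrow> H \<in> borel_measurable borel \<and> (\<exists>C c. C \<ge> 0 \<and> c > 0 \<and>
     (\<forall>y. norm (H y) \<le> C * exp (- c * (norm y)\<^sup>2)) \<and>
     (\<forall>y v. norm v \<le> 1 \<longrightarrow> norm (H (y + v) - H y) \<le> C * norm v * exp (- c * (norm y)\<^sup>2)))"

definition poly_class :: "('a::euclidean_space \<Rightarrow> complex) \<Rightarrow> bool" where
  "poly_class m \<longleftrightarrow> m \<in> borel_measurable borel \<and> (\<exists>C k. C \<ge> 0 \<and>
     (\<forall>y. norm (m y) \<le> C * (1 + norm y) ^ k) \<and>
     (\<forall>y v. norm v \<le> 1 \<longrightarrow> norm (m (y + v) - m y) \<le> C * norm v * (1 + norm y) ^ k))"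

lemma gauss_classE:
  assumes "gauss_class H"
  obtains C c where "C \<ge> 0" "c > 0" "\<And>y. norm (H y) \<le> C * exp (- c * (norm y)\<^sup>2)"
    "\<And>y v. norm v \<le> 1 \<Longrightarrow> norm (H (y + v) - H y) \<le> C * norm v * exp (- c * (norm y)\<^sup>2)"
  using assms unfolding gauss_class_def by auto

lemma gauss_class_measurable: "gauss_class H \<Longrightarrow> H \<in> borel_measurable borel"
  by (simp add: gauss_class_def)

lemma gauss_class_integrable:
  fixes H :: "'a::euclidean_space \<Rightarrow> complex"
  assumes "gauss_class H" shows "integrable lborel H"
proof -
  have [measurable]: "H \<in> borel_measurable borel" by (rule gauss_class_measurable[OF assms])
  obtain C c where *: "C \<ge> 0" "c > 0" "\<And>y. norm (H y) \<le> C * exp (- c * (norm y)\<^sup>2)"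
    by (rule gauss_classE[OF assms], rule that)
  show ?thesis
    by (rule Bochner_Integration.integrable_bound[OF integrable_mult_right[OF gauss_integral(1)[OF *(2)], of C]])
       (use *(3) in \<open>auto intro: order_trans[OF _ abs_ge_self]\<close>)
qed

lemma gauss_square_finite:
  assumes c: "c > 0"
  shows "(\<integral>\<^sup>+x. ennreal ((C * exp (- c * (norm (x::'a::euclidean_space))\<^sup>2))\<^sup>2) \<partial>lborel) < \<infinity>"
proof -
  have e: "(C * exp (- c * (norm x)\<^sup>2))\<^sup>2 = C\<^sup>2 * exp (- (2*c) * (norm x)\<^sup>2)" for x :: 'a
    by (simp add: power_mult_distrib exp_double[symmetric] mult.assoc)
  have "integrable lborel (\<lambda>x::'a. C\<^sup>2 * exp (- (2*c) * (norm x)\<^sup>2))"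
    by (intro integrable_mult_right gauss_integral) (use c in simp)
  from nn_integral_eq_integral[OF this] show ?thesis unfolding e by simp
qed

lemma gauss_class_pairing_integrable:
  fixes u :: "'a::euclidean_space \<Rightarrow> complex"
  assumes u: "Bstar0_borel u" and H: "gauss_class H"
  shows "integrable lborel (\<lambda>x. u x * ft H x)"
proof -
  have [measurable]: "H \<in> borel_measurable borel" by (rule gauss_class_measurable[OF H])
  obtain C c where *: "C \<ge> 0" "c > 0" "\<And>y. norm (H y) \<le> C * exp (- c * (norm y)\<^sup>2)"
      "\<And>y v. norm v \<le> 1 \<Longrightarrow> norm (H (y + v) - H y) \<le> C * norm v * exp (- c * (norm y)\<^sup>2)"
    by (rule gauss_classE[OF H], rule that)
  let ?D = "\<lambda>y::'a. C * exp (- c * (norm y)\<^sup>2)"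
  show ?thesis
  proof (rule integrable_ft_pairing[OF u gauss_class_integrable[OF H], of ?D 1])
    show "norm (H (y + h *\<^sub>R e) - H y) \<le> h * ?D y" if "e \<in> Basis" "0 < h" "h < 1" for e h y
      using *(4)[of "h *\<^sub>R e" y] that by (simp add: mult_ac)
    show "(\<integral>\<^sup>+x. ennreal ((?D x)\<^sup>2) \<partial>lborel) < \<infinity>" by (rule gauss_square_finite[OF *(2)])
    have "(\<integral>\<^sup>+x. ennreal ((norm (H x))\<^sup>2) \<partial>lborel) \<le> (\<integral>\<^sup>+x. ennreal ((?D x)\<^sup>2) \<partial>lborel)"
      using *(3) by (intro nn_integral_mono ennreal_leI power_mono) auto
    also have "\<dots> < \<infinity>" by (rule gauss_square_finite[OF *(2)])
    finally show "(\<integral>\<^sup>+x. ennreal ((norm (H x))\<^sup>2) \<partial>lborel) < \<infinity>" .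
  qed (auto)
qed

text \<open>Completing the square gives 1 + r \<le> 1 + 1/(4t) + t r^2, hence a constant times exp
  (t r^2); then take the k-th power.\<close>

lemma poly_le_gauss:
  fixes c :: real
  assumes "c > 0"
  obtains A where "A \<ge> 0" "\<And>r. r \<ge> 0 \<Longrightarrow> (1 + r) ^ k \<le> A * exp (c * r\<^sup>2)"
proof
  \<comment> \<open>Dividing by k + 1 gives k t \<le> c and also covers k = 0.\<close>
  define t where "t = c / (real k + 1)"
  have t: "t > 0" "real k * t \<le> c" using assms by (auto simp: t_def field_simps)
  let ?A = "(1 + 1 / (4 * t)) ^ k"
  show "?A \<ge> 0" using t by simp
  fix r :: real assume r: "r \<ge> 0"
  have "0 \<le> t * (r - 1 / (2 * t))\<^sup>2" using t by simp
  also have "t * (r - 1 / (2 * t))\<^sup>2 = t * r\<^sup>2 - r + 1 / (4 * t)"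
    using t by (simp add: power2_eq_square field_simps)
  finally have "1 + r \<le> 1 + 1 / (4 * t) + t * r\<^sup>2" by simp
  also have "\<dots> \<le> (1 + 1 / (4 * t)) * (1 + t * r\<^sup>2)" using t by (simp add: field_simps)
  also have "\<dots> \<le> (1 + 1 / (4 * t)) * exp (t * r\<^sup>2)"
    using t by (intro mult_left_mono exp_ge_add_one_self) (auto intro: add_nonneg_nonneg)
  finally have "(1 + r) ^ k \<le> ((1 + 1 / (4 * t)) * exp (t * r\<^sup>2)) ^ k"
    using r by (intro power_mono) auto
  also have "\<dots> = ?A * exp (real k * t * r\<^sup>2)"
    by (simp add: power_mult_distrib exp_of_nat_mult mult.assoc)
  also have "\<dots> \<le> ?A * exp (c * r\<^sup>2)"
    using t by (intro mult_left_mono) (auto intro: mult_right_mono)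
  finally show "(1 + r) ^ k \<le> ?A * exp (c * r\<^sup>2)" .
qed

text \<open>Half of the Gaussian rate absorbs the polynomial growth of the multiplier.\<close>

lemma gauss_class_mult:
  assumes m: "poly_class m" and H: "gauss_class H"
  shows "gauss_class (\<lambda>y. m y * H y)"
proof -
  obtain C c where C: "C \<ge> 0" "c > 0" "\<And>y. norm (H y) \<le> C * exp (- c * (norm y)\<^sup>2)"
      "\<And>y v. norm v \<le> 1 \<Longrightarrow> norm (H (y + v) - H y) \<le> C * norm v * exp (- c * (norm y)\<^sup>2)"
    by (rule gauss_classE[OF H], rule that)
  obtain B k where B: "B \<ge> 0" "\<And>y. norm (m y) \<le> B * (1 + norm y) ^ k"
      "\<And>y v. norm v \<le> 1 \<Longrightarrow> norm (m (y + v) - m y) \<le> B * norm v * (1 + norm y) ^ k"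
    using m unfolding poly_class_def by auto
  have [measurable]: "m \<in> borel_measurable borel" "H \<in> borel_measurable borel"
    using m H by (auto simp: poly_class_def gauss_class_def)
  have c2: "c / 2 > 0" using C by simp
  obtain A where A: "A \<ge> 0" "\<And>r. r \<ge> 0 \<Longrightarrow> (1 + r) ^ k \<le> A * exp (c / 2 * r\<^sup>2)"
    by (rule poly_le_gauss[OF c2, of k], rule that)
  have A': "(1 + norm y) ^ k * exp (- c * (norm y)\<^sup>2) \<le> A * exp (- (c / 2) * (norm y)\<^sup>2)" for y :: 'a
  proof -
    have "(1 + norm y) ^ k * exp (- c * (norm y)\<^sup>2) \<le> A * exp (c / 2 * (norm y)\<^sup>2) * exp (- c * (norm y)\<^sup>2)"
      by (intro mult_right_mono A) auto
    also have "\<dots> = A * exp (- (c / 2) * (norm y)\<^sup>2)" by (simp add: mult.assoc flip: exp_add)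
    finally show ?thesis .
  qed
  \<comment> \<open>The factor 2^k stems from 1 + |y + v| \<le> 2 (1 + |y|) for unit steps, the
    summand 1 from the difference of the multiplier.\<close>
  define K where "K = (2 ^ k + 1) * B * C * A"
  have K: "K \<ge> 0" "B * C * A \<le> K" using A B C by (auto simp: K_def distrib_right)
  show ?thesis unfolding gauss_class_def
  proof (rule conjI[rotated], rule exI[of _ K], rule exI[of _ "c / 2"], intro conjI allI impI)
    show "(\<lambda>y. m y * H y) \<in> borel_measurable borel" by measurable
    show "K \<ge> 0" "c / 2 > 0" using K C by auto
    fix y
    have "norm (m y * H y) \<le> (B * (1 + norm y) ^ k) * (C * exp (- c * (norm y)\<^sup>2))"
      unfolding norm_mult by (intro mult_mono B C) (use B in auto)
    also have "\<dots> = B * C * ((1 + norm y) ^ k * exp (- c * (norm y)\<^sup>2))" by (simp add: mult_ac)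
    also have "\<dots> \<le> B * C * (A * exp (- (c / 2) * (norm y)\<^sup>2))" using B C by (intro mult_left_mono A') auto
    also have "\<dots> \<le> K * exp (- (c / 2) * (norm y)\<^sup>2)" using K(2) by (simp add: mult.assoc[symmetric])
    finally show "norm (m y * H y) \<le> K * exp (- (c / 2) * (norm y)\<^sup>2)" .
    fix v :: 'a assume v: "norm v \<le> 1"
    have "norm (m (y + v)) \<le> B * (1 + norm (y + v)) ^ k" by (rule B)
    also have "\<dots> \<le> B * (2 * (1 + norm y)) ^ k"
    proof (intro mult_left_mono power_mono)
      show "1 + norm (y + v) \<le> 2 * (1 + norm y)"
      proof -
        have a: "norm (y + v) \<le> norm y + 1" using v norm_triangle_ineq[of y v] by simp
        have b: "0 \<le> norm y" by simp
        from a b show ?thesis by argo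
      qed
    qed (use B in auto)
    finally have 1: "norm (m (y + v)) \<le> 2 ^ k * B * (1 + norm y) ^ k" by (simp only: power_mult_distrib mult_ac)
    have "m (y + v) * H (y + v) - m y * H y = m (y + v) * (H (y + v) - H y) + (m (y + v) - m y) * H y"
      by (simp add: algebra_simps)
    then have "norm (m (y + v) * H (y + v) - m y * H y) \<le> norm (m (y + v)) * norm (H (y + v) - H y) + norm (m (y + v) - m y) * norm (H y)"
      by (metis norm_mult norm_triangle_ineq)
    also have "\<dots> \<le> (2 ^ k * B * (1 + norm y) ^ k) * (C * norm v * exp (- c * (norm y)\<^sup>2)) + (B * norm v * (1 + norm y) ^ k) * (C * exp (- c * (norm y)\<^sup>2))"
      by (intro add_mono mult_mono 1 B C v) (use B in auto)
    also have "\<dots> = (2 ^ k + 1) * B * C * norm v * ((1 + norm y) ^ k * exp (- c * (norm y)\<^sup>2))" by (simp add: algebra_simps)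
    also have "\<dots> \<le> (2 ^ k + 1) * B * C * norm v * (A * exp (- (c / 2) * (norm y)\<^sup>2))" using B C by (intro mult_left_mono A') auto
    finally show "norm (m (y + v) * H (y + v) - m y * H y) \<le> K * norm v * exp (- (c / 2) * (norm y)\<^sup>2)"
      by (simp add: K_def mult_ac)
  qed
qed

lemma norm_sq_diff:
  fixes y v :: "'a::euclidean_space"
  shows "\<bar>(norm (y + v))\<^sup>2 - (norm y)\<^sup>2\<bar> \<le> norm v * (2 * norm y + norm v)"
proof -
  have "(norm (y + v))\<^sup>2 - (norm y)\<^sup>2 = 2 * (y \<bullet> v) + (norm v)\<^sup>2"
    by (simp add: power2_norm_eq_inner inner_add_left inner_add_right inner_commute)
  also have "\<bar>\<dots>\<bar> \<le> 2 * \<bar>y \<bullet> v\<bar> + (norm v)\<^sup>2"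
    using abs_triangle_ineq[of "2 * (y \<bullet> v)" "(norm v)\<^sup>2"] by (simp add: abs_mult)
  also have "\<dots> \<le> 2 * (norm y * norm v) + (norm v)\<^sup>2" using Cauchy_Schwarz_ineq2[of y v] by simp
  finally show ?thesis by (simp add: power2_eq_square algebra_simps)
qed

lemma norm_sq_diff1:
  fixes y v :: "'a::euclidean_space"
  assumes "norm v \<le> 1"
  shows "\<bar>(norm (y + v))\<^sup>2 - (norm y)\<^sup>2\<bar> \<le> 2 * norm v * (1 + norm y)"
proof -
  have "norm v * (2 * norm y + norm v) \<le> norm v * (2 * (1 + norm y))"
    using assms by (intro mult_left_mono) auto
  with norm_sq_diff[of y v] show ?thesis by (simp add: mult_ac)
qed

text \<open>On unit steps the squared norm changes by at most 2 |v| (1 + |y|), so the composition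
  costs one power of 1 + |y|.\<close>

lemma poly_class_lipschitz:
  fixes b :: "real \<Rightarrow> real"
  assumes b: "\<And>s. \<bar>b s\<bar> \<le> B" "\<And>s t. \<bar>b s - b t\<bar> \<le> L * \<bar>s - t\<bar>"
  shows "poly_class (\<lambda>y::'a::euclidean_space. complex_of_real (b ((norm y)\<^sup>2 - lam)))"
proof -
  have L: "L \<ge> 0" using b(2)[of 1 0] abs_ge_zero[of "b 1 - b 0"] by simp
  have B: "B \<ge> 0" using b(1)[of 0] by linarith
  have "continuous_on UNIV b"
    unfolding continuous_on_iff
  proof (intro ballI allI impI)
    fix x e :: real assume e: "e > 0"
    have "L * \<bar>x' - x\<bar> < e" if "\<bar>x' - x\<bar> < e / (L + 1)" for x'
    proof -
      have "L * \<bar>x' - x\<bar> \<le> (L + 1) * \<bar>x' - x\<bar>" by (intro mult_right_mono) auto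
      also have "\<dots> < e" using that L by (simp add: field_simps)
      finally show ?thesis .
    qed
    then show "\<exists>d>0. \<forall>x'\<in>UNIV. dist x' x < d \<longrightarrow> dist (b x') (b x) < e"
      using e L b(2) by (intro exI[of _ "e / (L + 1)"]) (auto simp: dist_real_def intro: le_less_trans)
  qed
  then have [measurable]: "b \<in> borel_measurable borel" by (rule borel_measurable_continuous_onI)
  show ?thesis unfolding poly_class_def
  proof (intro conjI exI[of _ "B + 2 * L"] exI[of _ 1] allI impI)
    show "(\<lambda>y::'a. complex_of_real (b ((norm y)\<^sup>2 - lam))) \<in> borel_measurable borel" by measurable
    show "B + 2 * L \<ge> 0" using B L by simp
    fix y v :: 'a
    have "B \<le> (B + 2 * L) * (1 + norm y) ^ 1" using B L by (simp add: distrib_left distrib_right add_nonneg_nonneg)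
    then show "norm (complex_of_real (b ((norm y)\<^sup>2 - lam))) \<le> (B + 2 * L) * (1 + norm y) ^ 1"
      using b(1) order_trans by (auto simp: norm_of_real)
    assume v: "norm v \<le> 1"
    have "norm (complex_of_real (b ((norm (y + v))\<^sup>2 - lam)) - complex_of_real (b ((norm y)\<^sup>2 - lam))) \<le> L * \<bar>(norm (y + v))\<^sup>2 - (norm y)\<^sup>2\<bar>"
      using b(2)[of "(norm (y + v))\<^sup>2 - lam" "(norm y)\<^sup>2 - lam"] by (simp flip: of_real_diff)
    also have "\<dots> \<le> L * (2 * norm v * (1 + norm y))" by (intro mult_left_mono norm_sq_diff1 v L)
    also have "\<dots> \<le> (B + 2 * L) * norm v * (1 + norm y) ^ 1" using B L by (simp add: algebra_simps)
    finally show "norm (complex_of_real (b ((norm (y + v))\<^sup>2 - lam)) - complex_of_real (b ((norm y)\<^sup>2 - lam))) \<le> (B + 2 * L) * norm v * (1 + norm y) ^ 1" .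
  qed
qed

lemma poly_class_norm_sq: "poly_class (\<lambda>y::'a::euclidean_space. complex_of_real ((norm y)\<^sup>2 - lam))"
  unfolding poly_class_def
proof (intro conjI exI[of _ "2 + \<bar>lam\<bar>"] exI[of _ 2] allI impI)
  fix y v :: 'a
  have "\<bar>(norm y)\<^sup>2 - lam\<bar> \<le> (norm y)\<^sup>2 + \<bar>lam\<bar>" using abs_triangle_ineq4[of "(norm y)\<^sup>2" lam] by simp
  also have "\<dots> \<le> (2 + \<bar>lam\<bar>) * (1 + norm y) ^ 2" by (simp add: power2_eq_square algebra_simps)
  finally show "norm (complex_of_real ((norm y)\<^sup>2 - lam)) \<le> (2 + \<bar>lam\<bar>) * (1 + norm y) ^ 2"
    by (simp only: norm_of_real)
  assume v: "norm v \<le> 1"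
  have "norm (complex_of_real ((norm (y + v))\<^sup>2 - lam) - complex_of_real ((norm y)\<^sup>2 - lam)) = \<bar>(norm (y + v))\<^sup>2 - (norm y)\<^sup>2\<bar>"
    by (simp only: norm_of_real of_real_diff[symmetric])
  also have "\<dots> \<le> 2 * norm v * (1 + norm y)" by (rule norm_sq_diff1[OF v])
  also have "\<dots> \<le> (2 + \<bar>lam\<bar>) * norm v * (1 + norm y) ^ 2"
    by (intro mult_mono) (auto simp: power2_eq_square algebra_simps)
  finally show "norm (complex_of_real ((norm (y + v))\<^sup>2 - lam) - complex_of_real ((norm y)\<^sup>2 - lam)) \<le> (2 + \<bar>lam\<bar>) * norm v * (1 + norm y) ^ 2" .
qed (auto)

lemma poly_class_inner: "poly_class (\<lambda>y::'a::euclidean_space. complex_of_real (y \<bullet> e))"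
  unfolding poly_class_def
proof (intro conjI exI[of _ "norm e"] exI[of _ 1] allI impI)
  fix y v :: 'a
  have "\<bar>y \<bullet> e\<bar> \<le> norm y * norm e" by (rule Cauchy_Schwarz_ineq2)
  also have "\<dots> \<le> norm e * (1 + norm y) ^ 1" by (simp add: algebra_simps)
  finally show "norm (complex_of_real (y \<bullet> e)) \<le> norm e * (1 + norm y) ^ 1" by simp
  have "\<bar>v \<bullet> e\<bar> \<le> norm v * norm e" by (rule Cauchy_Schwarz_ineq2)
  also have "\<dots> \<le> norm e * norm v * (1 + norm y) ^ 1" by (simp add: algebra_simps)
  finally show "norm (complex_of_real ((y + v) \<bullet> e) - complex_of_real (y \<bullet> e)) \<le> norm e * norm v * (1 + norm y) ^ 1"
    by (simp add: inner_add_left)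
qed auto

text \<open>A chord of the unit circle has length 2 |sin ((a - b) / 2)|, at most the length of its
  arc.\<close>

lemma norm_cis_diff: "norm (cis a - cis b) \<le> \<bar>a - b\<bar>"
proof -
  have "cis a - cis b = cis b * (cis (a - b) - 1)" by (simp add: algebra_simps cis_mult)
  then have "norm (cis a - cis b) = norm (cis (a - b) - 1)" by (simp add: norm_mult)
  also have "\<dots> = 2 * \<bar>sin ((a - b) / 2)\<bar>"
    using dist_exp_i_1[of "a - b"] by (simp add: cis_conv_exp)
  also have "\<dots> \<le> \<bar>a - b\<bar>" using abs_sin_x_le_abs_x[of "(a-b)/2"] by simp
  finally show ?thesis .
qed

lemma poly_class_cis: "poly_class (\<lambda>y::'a::euclidean_space. cis (y \<bullet> e))"
  unfolding poly_class_def
proof (intro conjI exI[of _ "1 + norm e"] exI[of _ 0] allI impI)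
  fix y v :: 'a
  have "norm (cis ((y + v) \<bullet> e) - cis (y \<bullet> e)) \<le> \<bar>v \<bullet> e\<bar>"
    using norm_cis_diff[of "(y + v) \<bullet> e" "y \<bullet> e"] by (simp add: inner_add_left)
  also have "\<dots> \<le> norm v * norm e" by (rule Cauchy_Schwarz_ineq2)
  also have "\<dots> \<le> (1 + norm e) * norm v * (1 + norm y) ^ 0" by (simp add: algebra_simps)
  finally show "norm (cis ((y + v) \<bullet> e) - cis (y \<bullet> e)) \<le> (1 + norm e) * norm v * (1 + norm y) ^ 0" .
qed auto

text \<open>For a unit step |y + v|^2 is at least |y|^2 / 2 - 1, so both exponents stay below t -
  (t/2) |y|^2. The mean value bound then carries a factor 1 + |y|, which uses up another quarter of
  the rate.\<close>

lemma gauss_class_gauss: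
  assumes t: "t > 0"
  shows "gauss_class (\<lambda>y::'a::euclidean_space. complex_of_real (exp (- t * (norm y)\<^sup>2)))"
proof -
  have t4: "t / 4 > 0" using t by simp
  obtain A where A: "A \<ge> 0" "\<And>r. r \<ge> 0 \<Longrightarrow> (1 + r) ^ 1 \<le> A * exp (t / 4 * r\<^sup>2)"
    by (rule poly_le_gauss[OF t4, of 1], rule that)
  let ?K = "1 + 2 * t * A * exp t"
  show ?thesis unfolding gauss_class_def
  proof (rule conjI[rotated], rule exI[of _ ?K], rule exI[of _ "t / 4"], intro conjI allI impI)
    show "?K \<ge> 0" "t / 4 > 0" using t A by auto
    fix y v :: 'a
    have "exp (- t * (norm y)\<^sup>2) \<le> exp (- (t / 4) * (norm y)\<^sup>2)" using t by (simp add: mult_right_mono)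
    also have "\<dots> \<le> ?K * exp (- (t / 4) * (norm y)\<^sup>2)" using t A by simp
    finally show "norm (complex_of_real (exp (- t * (norm y)\<^sup>2))) \<le> ?K * exp (- (t / 4) * (norm y)\<^sup>2)" by simp
    assume v: "norm v \<le> 1"
    have ed: "\<bar>exp a - exp b\<bar> \<le> \<bar>a - b\<bar> * exp M" if "a \<le> M" "b \<le> M" for a b M :: real
    proof -
      have *: "exp a - exp b \<le> (a - b) * exp M" if "b \<le> a" "a \<le> M" for a b :: real
      proof -
        have "exp a * (1 + (b - a)) \<le> exp a * exp (b - a)" by (intro mult_left_mono exp_ge_add_one_self) auto
        then have "exp a - exp b \<le> (a - b) * exp a" by (simp add: exp_diff algebra_simps)
        also have "\<dots> \<le> (a - b) * exp M" using that by (intro mult_left_mono) auto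
        finally show ?thesis .
      qed
      show ?thesis using *[of a b] *[of b a] that by (cases "a \<le> b") auto
    qed
    have "norm y \<le> norm (y + v) + norm v" by (metis add_diff_cancel norm_triangle_ineq4)
    then have "norm y \<le> norm (y + v) + 1" using v by simp
    then have "(norm y)\<^sup>2 \<le> (norm (y + v) + 1)\<^sup>2" by (intro power_mono) auto
    also have "\<dots> \<le> 2 * (norm (y + v))\<^sup>2 + 2"
      using sum_squares_bound[of "norm (y+v)" 1] by (simp add: power2_eq_square algebra_simps)
    finally have h: "(norm y)\<^sup>2 / 2 - 1 \<le> (norm (y + v))\<^sup>2" by simp
    have h1: "- t * (norm (y + v))\<^sup>2 \<le> t - t / 2 * (norm y)\<^sup>2"
      using mult_left_mono[OF h, of t] t by (simp add: algebra_simps)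
    have h2: "- t * (norm y)\<^sup>2 \<le> t - t / 2 * (norm y)\<^sup>2"
    proof -
      have "0 \<le> t * (norm y)\<^sup>2" using t by simp
      with t show ?thesis by linarith
    qed
    have "\<bar>exp (- t * (norm (y + v))\<^sup>2) - exp (- t * (norm y)\<^sup>2)\<bar> \<le> \<bar>- t * (norm (y + v))\<^sup>2 - (- t * (norm y)\<^sup>2)\<bar> * exp (t - t / 2 * (norm y)\<^sup>2)"
      by (rule ed[OF h1 h2])
    also have "- t * (norm (y + v))\<^sup>2 - (- t * (norm y)\<^sup>2) = - t * ((norm (y + v))\<^sup>2 - (norm y)\<^sup>2)" by (simp add: algebra_simps)
    also have "\<bar>\<dots>\<bar> = t * \<bar>(norm (y + v))\<^sup>2 - (norm y)\<^sup>2\<bar>" using t by (simp add: abs_mult)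
    also have "t * \<bar>(norm (y + v))\<^sup>2 - (norm y)\<^sup>2\<bar> * exp (t - t / 2 * (norm y)\<^sup>2) \<le> t * (2 * norm v * (1 + norm y)) * exp (t - t / 2 * (norm y)\<^sup>2)"
      using t by (intro mult_right_mono mult_left_mono norm_sq_diff1 v) auto
    also have "\<dots> \<le> t * (2 * norm v * (A * exp (t / 4 * (norm y)\<^sup>2))) * exp (t - t / 2 * (norm y)\<^sup>2)"
      using A(2)[of "norm y"] t by (intro mult_right_mono mult_left_mono) auto
    also have "\<dots> = 2 * t * A * norm v * (exp (t / 4 * (norm y)\<^sup>2) * exp (t - t / 2 * (norm y)\<^sup>2))" by (simp add: mult_ac)
    also have "exp (t / 4 * (norm y)\<^sup>2) * exp (t - t / 2 * (norm y)\<^sup>2) = exp t * exp (- (t / 4) * (norm y)\<^sup>2)"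
      by (simp flip: exp_add)
    also have "2 * t * A * norm v * (exp t * exp (- (t / 4) * (norm y)\<^sup>2)) \<le> ?K * norm v * exp (- (t / 4) * (norm y)\<^sup>2)"
      by (simp add: algebra_simps)
    finally show "norm (complex_of_real (exp (- t * (norm (y + v))\<^sup>2)) - complex_of_real (exp (- t * (norm y)\<^sup>2))) \<le> ?K * norm v * exp (- (t / 4) * (norm y)\<^sup>2)"
      by (simp only: of_real_diff[symmetric] norm_of_real)
  qed measurable
qed

text \<open>Beyond radius |R| + 1 a unit step cannot reach the support; inside it, the factor exp of
  the squared radius compensates for the Gaussian.\<close>

lemma gauss_class_compact:
  fixes H :: "'a::euclidean_space \<Rightarrow> complex"
  assumes [measurable]: "H \<in> borel_measurable borel"
    and B: "\<And>y. norm (H y) \<le> B" and L: "\<And>y v. norm (H (y + v) - H y) \<le> L * norm v"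
    and R: "\<And>y. norm y > R \<Longrightarrow> H y = 0"
  shows "gauss_class H"
proof -
  let ?R = "(\<bar>R\<bar> + 1)"
  let ?C = "(\<bar>B\<bar> + \<bar>L\<bar>) * exp (?R\<^sup>2)"
  have e: "1 \<le> exp (?R\<^sup>2) * exp (- 1 * (norm y)\<^sup>2)" if "norm y \<le> ?R" for y :: 'a
    using that power_mono[OF that, of 2] by (simp flip: exp_add)
  show ?thesis unfolding gauss_class_def
  proof (rule conjI[rotated], rule exI[of _ ?C], rule exI[of _ "1::real"], intro conjI allI impI)
    fix y v :: 'a
    have *: "(\<bar>B\<bar> + \<bar>L\<bar>) * norm z \<le> ?C * norm z * exp (- 1 * (norm y)\<^sup>2)" if "norm y \<le> ?R" for z :: complex
      using mult_left_mono[OF e[OF that], of "(\<bar>B\<bar> + \<bar>L\<bar>) * norm z"] by (simp add: mult_ac)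
    show "norm (H y) \<le> ?C * exp (- 1 * (norm y)\<^sup>2)"
    proof (cases "norm y \<le> ?R")
      case True
      then show ?thesis using *[of 1] B[of y] by simp
    next
      case False
      then show ?thesis using R[of y] by simp
    qed
    assume v: "norm v \<le> 1"
    show "norm (H (y + v) - H y) \<le> ?C * norm v * exp (- 1 * (norm y)\<^sup>2)"
    proof (cases "norm y \<le> ?R")
      case True
      have "norm (H (y + v) - H y) \<le> L * norm v" by (rule L)
      also have "\<dots> \<le> (\<bar>B\<bar> + \<bar>L\<bar>) * norm (complex_of_real (norm v))" by (simp add: mult_right_mono)
      finally show ?thesis using *[OF True, of "complex_of_real (norm v)"] by simp
    next
      case False
      moreover have "norm y \<le> norm (y + v) + norm v" by (metis add_diff_cancel norm_triangle_ineq4)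
      ultimately have "norm (y + v) > R" "norm y > R" using v by linarith+
      then show ?thesis using R[of y] R[of "y+v"] by simp
    qed
  qed auto
qed

section \<open>Thin spherical shells\<close>

lemma power_diff_le:
  fixes a b :: real
  assumes "0 \<le> b" "b \<le> a"
  shows "a ^ n - b ^ n \<le> real n * a ^ (n - 1) * (a - b)"
proof (induction n)
  case (Suc n)
  have "a ^ Suc n - b ^ Suc n = a * (a ^ n - b ^ n) + b ^ n * (a - b)" by (simp add: algebra_simps)
  also have "\<dots> \<le> a * (real n * a ^ (n - 1) * (a - b)) + a ^ n * (a - b)"
    using assms by (intro add_mono mult_left_mono mult_right_mono Suc power_mono) auto
  also have "\<dots> = real (Suc n) * a ^ (Suc n - 1) * (a - b)"
    by (cases n) (auto simp: algebra_simps)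
  finally show ?case .
qed simp

text \<open>The shell lies between the radii sqrt (lam + t) and sqrt (lam - t), whose difference is
  2 t divided by their sum, hence O(t); the rest is a difference of ball volumes.\<close>

lemma emeasure_shell_le:
  assumes lam: "lam > 0"
  obtains A where "A > 0" "\<And>t. 0 < t \<Longrightarrow> t \<le> lam / 2 \<Longrightarrow>
    emeasure lborel {y::'a::euclidean_space. \<bar>(norm y)\<^sup>2 - lam\<bar> \<le> t} \<le> ennreal (A * t)"
proof
  let ?n = "DIM('a)"
  define V where "V = measure lborel (ball (0::'a) 1)"
  have V: "V \<ge> 0" by (simp add: V_def)
  \<comment> \<open>The summand 1 makes the constant positive, as only V \<ge> 0 is
    recorded.\<close>
  let ?A = "1 + V * (real ?n * (sqrt (2 * lam)) ^ (?n - 1) * (2 / sqrt lam))"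
  show "?A > 0" using V lam by (intro add_pos_nonneg) auto
  fix t assume t: "0 < t" "t \<le> lam / 2"
  define a b where "a = sqrt (lam + t)" and "b = sqrt (lam - t)"
  have ab: "0 \<le> b" "b \<le> a" "a > 0" using t lam by (auto simp: a_def b_def)
  have sub: "{y::'a. \<bar>(norm y)\<^sup>2 - lam\<bar> \<le> t} \<subseteq> cball 0 a - ball 0 b"
  proof
    fix y :: 'a assume "y \<in> {y. \<bar>(norm y)\<^sup>2 - lam\<bar> \<le> t}"
    then have "(norm y)\<^sup>2 \<le> lam + t" "lam - t \<le> (norm y)\<^sup>2" by auto
    then have "norm y \<le> a" "b \<le> norm y"
      unfolding a_def b_def by (auto intro: real_le_rsqrt real_le_lsqrt)
    then show "y \<in> cball 0 a - ball 0 b" by auto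
  qed
  have "emeasure lborel {y::'a. \<bar>(norm y)\<^sup>2 - lam\<bar> \<le> t} \<le> emeasure lborel (cball 0 a - ball (0::'a) b)"
    by (rule emeasure_mono[OF sub]) auto
  also have "\<dots> = emeasure lborel (cball (0::'a) a) - emeasure lborel (ball (0::'a) b)"
    using ab emeasure_lborel_ball_finite[of "0::'a" b] by (intro emeasure_Diff) (auto simp: subset_iff)
  also have "\<dots> = ennreal (V * a ^ ?n - V * b ^ ?n)"
  proof -
    have 1: "emeasure lborel (cball (0::'a) a) = ennreal (V * a ^ ?n)"
      using ab emeasure_lborel_cball_finite[of "0::'a" a]
      by (subst emeasure_eq_ennreal_measure) (auto simp: content_cball_conv_ball content_ball_conv_unit_ball[of a] V_def mult.commute less_top)
    have 2: "emeasure lborel (ball (0::'a) b) = ennreal (V * b ^ ?n)"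
      using ab emeasure_lborel_ball_finite[of "0::'a" b]
      by (subst emeasure_eq_ennreal_measure) (auto simp: content_ball_conv_unit_ball[of b] V_def mult.commute less_top)
    show ?thesis unfolding 1 2 using V ab by (subst ennreal_minus) auto
  qed
  also have "\<dots> \<le> ennreal (?A * t)"
  proof (rule ennreal_leI)
    have "(a - b) * (a + b) = 2 * t"
      using t lam by (simp add: a_def b_def algebra_simps flip: power2_eq_square)
    moreover have "sqrt lam \<le> a + b" using t lam ab by (simp add: a_def add_increasing2)
    ultimately have "(a - b) * sqrt lam \<le> 2 * t"
      using mult_left_mono[of "sqrt lam" "a + b" "a - b"] ab by simp
    then have d: "a - b \<le> 2 / sqrt lam * t" using lam by (simp add: field_simps)
    have "V * a ^ ?n - V * b ^ ?n = V * (a ^ ?n - b ^ ?n)" by (simp add: right_diff_distrib)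
    also have "\<dots> \<le> V * (real ?n * a ^ (?n - 1) * (a - b))"
      by (intro mult_left_mono power_diff_le ab V)
    also have "\<dots> \<le> V * (real ?n * (sqrt (2 * lam)) ^ (?n - 1) * (2 / sqrt lam * t))"
      using ab t lam by (intro mult_left_mono mult_mono power_mono d V) (auto simp: a_def)
    also have "\<dots> \<le> ?A * t" using t by (simp add: algebra_simps)
    finally show "V * a ^ ?n - V * b ^ ?n \<le> ?A * t" .
  qed
  finally show "emeasure lborel {y::'a. \<bar>(norm y)\<^sup>2 - lam\<bar> \<le> t} \<le> ennreal (?A * t)" .
qed

text \<open>The cut-off function lives on a set of measure O(\<epsilon>) and has difference
  quotients O(1/\<epsilon>) on the doubled shell, so its squared norms are O(\<epsilon>) and
  O(1/\<epsilon>), as \<open>Bstar0_borel_ft_small\<close> requires.\<close>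

lemma Bstar0_borel_shell_small:
  fixes u :: "'a::euclidean_space \<Rightarrow> complex"
  assumes u: "Bstar0_borel u" and G: "gauss_class G" and lam: "lam > 0" and d: "\<delta> > 0"
    and k: "\<And>t. \<bar>\<kappa> t\<bar> \<le> 1" "\<And>s t. \<bar>\<kappa> s - \<kappa> t\<bar> \<le> L * \<bar>s - t\<bar>" "\<And>t. \<bar>t\<bar> \<ge> 1 \<Longrightarrow> \<kappa> t = 0"
  shows "\<exists>e0>0. \<forall>\<epsilon>. 0 < \<epsilon> \<and> \<epsilon> < e0 \<longrightarrow>
     norm (LINT x|lborel. u x * ft (\<lambda>y. complex_of_real (\<kappa> (((norm y)\<^sup>2 - lam) / \<epsilon>)) * G y) x) \<le> \<delta>"
proof -
  have L: "L \<ge> 0" using k(2)[of 1 0] abs_ge_zero[of "\<kappa> 1 - \<kappa> 0"] by simp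
  obtain C c where C: "C \<ge> 0" "c > 0" "\<And>y. norm (G y) \<le> C * exp (- c * (norm y)\<^sup>2)"
      "\<And>y v. norm v \<le> 1 \<Longrightarrow> norm (G (y + v) - G y) \<le> C * norm v * exp (- c * (norm y)\<^sup>2)"
    by (rule gauss_classE[OF G], rule that)
  have Cb: "norm (G y) \<le> C" for y
    using C(1,2) by (intro order_trans[OF C(3)] mult_left_le) auto
  have Cl: "norm (G (y + v) - G y) \<le> C * norm v" if "norm v \<le> 1" for y v
    using C(1,2) by (intro order_trans[OF C(4)[OF that]] mult_left_le) auto
  obtain A0 where A0: "A0 > 0" "\<And>t. 0 < t \<Longrightarrow> t \<le> lam / 2 \<Longrightarrow>
    emeasure lborel {y::'a. \<bar>(norm y)\<^sup>2 - lam\<bar> \<le> t} \<le> ennreal (A0 * t)"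
    by (rule emeasure_shell_le[OF lam], rule that)
  \<comment> \<open>Bounds the change of |y|^2 per unit of step length: 2 |y| + h is at most 2 (lam
    + 2) + 1 near the shell.\<close>
  define M where "M = 2 * lam + 5"
  define K where "K = L * M * C + C"
  have K: "K \<ge> 0" "C \<le> K" using L C lam by (auto simp: K_def M_def)
  define A where "A = 2 * A0 * (K\<^sup>2 + 1)"
  have A: "A > 0" "A0 * C\<^sup>2 \<le> A" "2 * A0 * K\<^sup>2 \<le> A"
  proof -
    have "C\<^sup>2 \<le> K\<^sup>2" using K C by (intro power_mono)
    then have "A0 * C\<^sup>2 \<le> A0 * K\<^sup>2" using A0 by simp
    moreover have "A = 2 * (A0 * K\<^sup>2) + 2 * A0" by (simp add: A_def algebra_simps)
    moreover have "0 \<le> A0 * K\<^sup>2" using A0 by simp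
    ultimately show "A > 0" "A0 * C\<^sup>2 \<le> A" "2 * A0 * K\<^sup>2 \<le> A" using A0(1) by linarith+
  qed
  from Bstar0_borel_ft_small[OF u d A(1)] obtain e0 where e0: "e0 > 0" and small: "\<forall>\<epsilon>. 0 < \<epsilon> \<and> \<epsilon> < e0 \<longrightarrow> (\<forall>H D h0. integrable lborel H \<longrightarrow> D \<in> borel_measurable borel \<longrightarrow>
      h0 > 0 \<longrightarrow> (\<forall>e\<in>Basis. \<forall>h y. 0 < h \<and> h < h0 \<longrightarrow> norm (H (y + h *\<^sub>R e) - H y) \<le> h * D y) \<longrightarrow>
      (\<integral>\<^sup>+x. ennreal ((norm (H x))\<^sup>2) \<partial>lborel) \<le> ennreal (A * \<epsilon>) \<longrightarrow>
      (\<integral>\<^sup>+x. ennreal ((D x)\<^sup>2) \<partial>lborel) \<le> ennreal (A / \<epsilon>) \<longrightarrow>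
      norm (LINT x|lborel. u x * ft H x) \<le> \<delta>)" by (elim exE conjE)
  show ?thesis
  proof (intro exI[of _ "min e0 (min 1 (lam / 4))"] conjI allI impI)
    \<comment> \<open>The bound lam / 4 makes the doubled shell admissible for the volume
      estimate.\<close>
    show "min e0 (min 1 (lam / 4)) > 0" using e0 lam by simp
    fix \<epsilon> assume "0 < \<epsilon> \<and> \<epsilon> < min e0 (min 1 (lam / 4))"
    then have e: "0 < \<epsilon>" "\<epsilon> < e0" "\<epsilon> < 1" "\<epsilon> < lam / 4" by auto
    let ?s = "\<lambda>y::'a. (norm y)\<^sup>2 - lam"
    let ?H = "\<lambda>y. complex_of_real (\<kappa> (?s y / \<epsilon>)) * G y"
    have "poly_class (\<lambda>y::'a. complex_of_real (\<kappa> (?s y / \<epsilon>)))"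
      by (rule poly_class_lipschitz[of "\<lambda>s. \<kappa> (s / \<epsilon>)" 1 "L / \<epsilon>", OF k(1)])
         (use k(2)[of "_ / \<epsilon>" "_ / \<epsilon>"] e in \<open>simp flip: diff_divide_distrib\<close>)
    then have gH: "gauss_class ?H" by (rule gauss_class_mult[OF _ G])
    define S where "S t = {y::'a. \<bar>?s y\<bar> \<le> t}" for t
    have [measurable]: "S t \<in> sets borel" for t unfolding S_def by measurable
    \<comment> \<open>The doubled shell is used because \<open>y\<close> may lie outside the shell
      while the shifted point lies inside; a step shorter than \<epsilon> / M moves |y|^2 by less
      than \<epsilon>.\<close>
    let ?D = "\<lambda>y. K / \<epsilon> * indicator (S (2 * \<epsilon>)) y :: real"
    have z: "?H y = 0" if "y \<notin> S \<epsilon>" for y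
      using that e k(3)[of "?s y / \<epsilon>"] by (auto simp: S_def abs_divide field_simps)
    show "norm (LINT x|lborel. u x * ft ?H x) \<le> \<delta>"
    proof (rule small[THEN spec, THEN mp, OF conjI[OF e(1,2)], THEN spec, THEN spec[of _ ?D], THEN spec[of _ "\<epsilon> / M"], THEN mp, OF gauss_class_integrable[OF gH], THEN mp, THEN mp, THEN mp, THEN mp, THEN mp])
      show "\<epsilon> / M > 0" using e lam by (simp add: M_def)
      show "?D \<in> borel_measurable borel" by measurable
      show "(\<integral>\<^sup>+x. ennreal ((norm (?H x))\<^sup>2) \<partial>lborel) \<le> ennreal (A * \<epsilon>)"
      proof -
        have "(\<integral>\<^sup>+x. ennreal ((norm (?H x))\<^sup>2) \<partial>lborel) \<le> (\<integral>\<^sup>+x. ennreal (C\<^sup>2) * indicator (S \<epsilon>) x \<partial>lborel)"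
        proof (rule nn_integral_mono)
          fix x
          show "ennreal ((norm (?H x))\<^sup>2) \<le> ennreal (C\<^sup>2) * indicator (S \<epsilon>) x"
          proof (cases "x \<in> S \<epsilon>")
            case True
            have "norm (?H x) \<le> 1 * C" unfolding norm_mult norm_of_real
              by (intro mult_mono k Cb) auto
            then have "(norm (?H x))\<^sup>2 \<le> C\<^sup>2" by (intro power_mono) auto
            then show ?thesis using True by (simp add: ennreal_leI)
          qed (use z in simp)
        qed
        also have "\<dots> = ennreal (C\<^sup>2) * emeasure lborel (S \<epsilon>)" by (simp add: nn_integral_cmult_indicator)
        also have "\<dots> \<le> ennreal (C\<^sup>2) * ennreal (A0 * \<epsilon>)"
          unfolding S_def using e by (intro mult_left_mono A0) auto
        also have "\<dots> = ennreal (A0 * C\<^sup>2 * \<epsilon>)" using A0 e by (simp flip: ennreal_mult add: mult_ac)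
        also have "\<dots> \<le> ennreal (A * \<epsilon>)" using A e by (intro ennreal_leI mult_right_mono) auto
        finally show ?thesis .
      qed
      show "(\<integral>\<^sup>+x. ennreal ((?D x)\<^sup>2) \<partial>lborel) \<le> ennreal (A / \<epsilon>)"
      proof -
        have "(\<integral>\<^sup>+x. ennreal ((?D x)\<^sup>2) \<partial>lborel) = (\<integral>\<^sup>+x. ennreal ((K / \<epsilon>)\<^sup>2) * indicator (S (2 * \<epsilon>)) x \<partial>lborel)"
          by (intro nn_integral_cong) (auto simp: indicator_def)
        also have "\<dots> = ennreal ((K / \<epsilon>)\<^sup>2) * emeasure lborel (S (2 * \<epsilon>))" by (simp add: nn_integral_cmult_indicator)
        also have "\<dots> \<le> ennreal ((K / \<epsilon>)\<^sup>2) * ennreal (A0 * (2 * \<epsilon>))"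
          unfolding S_def using e by (intro mult_left_mono A0) auto
        also have "\<dots> = ennreal (2 * A0 * K\<^sup>2 / \<epsilon>)" using A0 e by (simp flip: ennreal_mult add: power2_eq_square mult_ac)
        also have "\<dots> \<le> ennreal (A / \<epsilon>)" using A e by (intro ennreal_leI divide_right_mono) auto
        finally show ?thesis .
      qed
      show "\<forall>e\<in>Basis. \<forall>h y. 0 < h \<and> h < \<epsilon> / M \<longrightarrow> norm (?H (y + h *\<^sub>R e) - ?H y) \<le> h * ?D y"
      proof (intro ballI allI impI)
        fix b y :: 'a and h assume b: "b \<in> Basis" and h: "0 < h \<and> h < \<epsilon> / M"
        let ?v = "h *\<^sub>R b"
        have v: "norm ?v = h" using b h by simp
        have M: "M > 5" using lam by (simp add: M_def)
        have hM: "h * M < \<epsilon>" using h M by (simp add: field_simps)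
        have "h * 5 \<le> h * M" using h M by (intro mult_left_mono) auto
        with hM have h1: "h * 5 < \<epsilon>" by linarith
        have h2: "h < 1" using h1 h e by linarith
        show "norm (?H (y + ?v) - ?H y) \<le> h * ?D y"
        proof (cases "y \<in> S \<epsilon> \<or> y + ?v \<in> S \<epsilon>")
          case False
          then have a: "?H (y + ?v) = 0" and b: "?H y = 0" using z by blast+
          have "norm (?H (y + ?v) - ?H y) = 0" unfolding a b by simp
          also have "0 \<le> h * ?D y" using h K e by simp
          finally show ?thesis .
        next
          case True
          have nb: "norm z \<le> lam + 1" if "z \<in> S \<epsilon>" for z
          proof (rule power2_le_imp_le)
            have "(norm z)\<^sup>2 \<le> lam + 1" using that e by (auto simp: S_def)
            also have "\<dots> \<le> (lam + 1)\<^sup>2" using lam by (simp add: power2_eq_square algebra_simps)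
            finally show "(norm z)\<^sup>2 \<le> (lam + 1)\<^sup>2" .
          qed (use lam in simp)
          have yb: "norm y \<le> lam + 2"
          proof (cases "y \<in> S \<epsilon>")
            case True then show ?thesis using nb[of y] by simp
          next
            case False
            with True have "norm (y + ?v) \<le> lam + 1" using nb by blast
            moreover have "norm y \<le> norm (y + ?v) + norm ?v" by (metis add_diff_cancel norm_triangle_ineq4)
            ultimately show ?thesis using v h2 by linarith
          qed
          have sd: "\<bar>?s (y + ?v) - ?s y\<bar> \<le> h * M"
          proof -
            have "\<bar>?s (y + ?v) - ?s y\<bar> \<le> h * (2 * norm y + h)" using norm_sq_diff[of y ?v] unfolding v by simp
            also have "\<dots> \<le> h * M" using yb h h2 by (intro mult_left_mono) (auto simp: M_def)
            finally show ?thesis .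
          qed
          have yS: "y \<in> S (2 * \<epsilon>)" using True sd hM e by (auto simp: S_def)
          have "\<bar>\<kappa> (?s (y + ?v) / \<epsilon>) - \<kappa> (?s y / \<epsilon>)\<bar> \<le> L * \<bar>?s (y + ?v) / \<epsilon> - ?s y / \<epsilon>\<bar>" by (rule k)
          also have "\<dots> = L * \<bar>?s (y + ?v) - ?s y\<bar> / \<epsilon>" using e by (simp flip: diff_divide_distrib)
          also have "\<dots> \<le> L * (h * M) / \<epsilon>" using e L sd by (intro divide_right_mono mult_left_mono) auto
          finally have kd: "\<bar>\<kappa> (?s (y + ?v) / \<epsilon>) - \<kappa> (?s y / \<epsilon>)\<bar> \<le> L * (h * M) / \<epsilon>" .
          have "?H (y + ?v) - ?H y = complex_of_real (\<kappa> (?s (y + ?v) / \<epsilon>)) * (G (y + ?v) - G y)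
             + complex_of_real (\<kappa> (?s (y + ?v) / \<epsilon>) - \<kappa> (?s y / \<epsilon>)) * G y"
            by (simp only: of_real_diff left_diff_distrib right_diff_distrib) simp
          then have "norm (?H (y + ?v) - ?H y) \<le> \<bar>\<kappa> (?s (y + ?v) / \<epsilon>)\<bar> * norm (G (y + ?v) - G y)
             + \<bar>\<kappa> (?s (y + ?v) / \<epsilon>) - \<kappa> (?s y / \<epsilon>)\<bar> * norm (G y)"
            by (simp only: norm_mult[symmetric] norm_of_real[symmetric, where 'a=complex] norm_triangle_ineq)
          also have "\<dots> \<le> 1 * (C * h) + (L * (h * M) / \<epsilon>) * C"
          proof (rule add_mono)
            show "\<bar>\<kappa> (?s (y + ?v) / \<epsilon>)\<bar> * norm (G (y + ?v) - G y) \<le> 1 * (C * h)"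
              by (rule mult_mono[OF k(1)]) (use Cl[of ?v y] v h2 in auto)
            have "0 \<le> L * (h * M) / \<epsilon>" using L h M e(1) by simp
            then show "\<bar>\<kappa> (?s (y + ?v) / \<epsilon>) - \<kappa> (?s y / \<epsilon>)\<bar> * norm (G y) \<le> (L * (h * M) / \<epsilon>) * C"
              by (intro mult_mono kd Cb) auto
          qed
          also have "\<dots> \<le> h * (K / \<epsilon>)"
          proof -
            have "C * h * \<epsilon> \<le> C * h * 1" using e C h by (intro mult_left_mono) auto
            then have "C * h \<le> C * h / \<epsilon>" using e(1) by (simp add: le_divide_eq)
            then show ?thesis using e(1) unfolding K_def by (simp add: add_divide_distrib distrib_left mult_ac)
          qed
          also have "\<dots> = h * ?D y" using yS by simp
          finally show ?thesis .
        qed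
      qed
    qed
  qed
qed

section \<open>Test functions and the weak equation\<close>

text \<open>The polynomial \<open>P\<close> makes the family closed under differentiation; \<open>P = 1\<close> is the usual flat function.\<close>

definition flat :: "real poly \<Rightarrow> real \<Rightarrow> real" where
  "flat P t = (if t \<le> 0 then 0 else poly P (inverse t) * exp (- inverse t))"

lemma poly_exp_tendsto_0: "((\<lambda>x. poly P x * exp (- x)) \<longlongrightarrow> 0) at_top" for P :: "real poly"
proof -
  have "((\<lambda>x. \<Sum>i\<le>degree P. coeff P i * (x ^ i / exp x)) \<longlongrightarrow> (\<Sum>i\<le>degree P. coeff P i * 0)) at_top"
    by (intro tendsto_intros tendsto_power_div_exp_0)
  then show ?thesis by (simp add: poly_altdef sum_distrib_right sum_divide_distrib exp_minus field_simps)
qed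

text \<open>With X = 1/t, the derivative of P(X) exp (- X) is X^2 (P - P')(X) exp (- X). At 0 the
  right difference quotient is X P(X) exp (- X), which tends to 0 as X grows.\<close>

lemma DERIV_flat:
  "(flat P has_real_derivative flat ([:0, 0, 1:] * (P - pderiv P)) t) (at t)"
proof (cases t "0::real" rule: linorder_cases)
  case less
  then have "((\<lambda>_. 0) has_real_derivative flat ([:0, 0, 1:] * (P - pderiv P)) t) (at t)"
    by (auto simp: flat_def)
  then show ?thesis
    by (rule has_field_derivative_transform_within_open[of _ _ _ "{..<0}"]) (use less in \<open>auto simp: flat_def\<close>)
next
  case greater
  have "((\<lambda>t. poly P (inverse t) * exp (- inverse t)) has_real_derivative flat ([:0, 0, 1:] * (P - pderiv P)) t) (at t)"
    using greater
    by (auto intro!: derivative_eq_intros simp: flat_def power2_eq_square algebra_simps)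
  then show ?thesis
    by (rule has_field_derivative_transform_within_open[of _ _ _ "{0<..}"]) (use greater in \<open>auto simp: flat_def\<close>)
next
  case equal
  have "((\<lambda>h. (flat P h - flat P 0) / (h - 0)) \<longlongrightarrow> 0) (at 0)"
  proof (rule filterlim_split_at)
    show "((\<lambda>h. (flat P h - flat P 0) / (h - 0)) \<longlongrightarrow> 0) (at_left 0)"
      by (rule tendsto_eventually) (auto simp: flat_def eventually_at_filter)
    have "((\<lambda>h. poly ([:0, 1:] * P) (inverse h) * exp (- inverse h)) \<longlongrightarrow> 0) (at_right 0)"
      by (rule filterlim_compose[OF poly_exp_tendsto_0 filterlim_inverse_at_top_right])
    then show "((\<lambda>h. (flat P h - flat P 0) / (h - 0)) \<longlongrightarrow> 0) (at_right 0)"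
      by (rule Lim_transform_eventually) (auto simp: flat_def eventually_at_filter field_simps)
  qed
  then show ?thesis using equal by (simp add: has_field_derivative_iff flat_def)
qed

lemmas has_vector_derivative_flat =
  DERIV_flat[unfolded has_real_derivative_iff_has_vector_derivative]

text \<open>Smoothness as a greatest fixed point: any family of functions that is closed under
  differentiation is smooth by coinduction, with no induction on the order.\<close>

coinductive smooth1 :: "(real \<Rightarrow> complex) \<Rightarrow> bool" where
  "\<lbrakk>\<And>t. (h has_vector_derivative h' t) (at t); smooth1 h'\<rbrakk> \<Longrightarrow> smooth1 h"

text \<open>Differentiating a bump times an exponential changes the two polynomials or brings down
  \<open>z\<close>; the span of such functions is therefore an invariant for coinduction.\<close>

inductive bump_exp_span :: "real \<Rightarrow> complex \<Rightarrow> (real \<Rightarrow> complex) \<Rightarrow> bool" for R z where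
  base: "bump_exp_span R z (\<lambda>t. complex_of_real (flat P (1 - t / R) * flat Q (1 + t / R)) * exp (z * t))"
| scale: "bump_exp_span R z h \<Longrightarrow> bump_exp_span R z (\<lambda>t. c * h t)"
| add: "bump_exp_span R z h \<Longrightarrow> bump_exp_span R z g \<Longrightarrow> bump_exp_span R z (\<lambda>t. h t + g t)"

lemma has_vector_derivative_bump:
  fixes z :: complex
  assumes "R \<noteq> 0"
  shows "((\<lambda>t. complex_of_real (flat P (1 - t / R) * flat Q (1 + t / R)) * exp (z * t)) has_vector_derivative
      (-1 / R) * (complex_of_real (flat ([:0, 0, 1:] * (P - pderiv P)) (1 - t / R) * flat Q (1 + t / R)) * exp (z * t))
    + ((1 / R) * (complex_of_real (flat P (1 - t / R) * flat ([:0, 0, 1:] * (Q - pderiv Q)) (1 + t / R)) * exp (z * t))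
    + z * (complex_of_real (flat P (1 - t / R) * flat Q (1 + t / R)) * exp (z * t)))) (at t)"
proof -
  have 1: "((\<lambda>t. flat P (1 - t / R)) has_real_derivative flat ([:0, 0, 1:] * (P - pderiv P)) (1 - t / R) * (- 1 / R)) (at t)"
    by (rule DERIV_chain'[OF _ DERIV_flat]) (use assms in \<open>auto intro!: derivative_eq_intros\<close>)
  have 2: "((\<lambda>t. flat Q (1 + t / R)) has_real_derivative flat ([:0, 0, 1:] * (Q - pderiv Q)) (1 + t / R) * (1 / R)) (at t)"
    by (rule DERIV_chain'[OF _ DERIV_flat]) (use assms in \<open>auto intro!: derivative_eq_intros\<close>)
  have 3: "((\<lambda>t. exp (z * complex_of_real t)) has_vector_derivative (z * exp (z * t))) (at t)"
    by (rule has_vector_derivative_real_field) (auto intro!: derivative_eq_intros)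
  have 4: "((\<lambda>t. complex_of_real (flat P (1 - t / R) * flat Q (1 + t / R))) has_vector_derivative
     complex_of_real (flat ([:0, 0, 1:] * (P - pderiv P)) (1 - t / R) * (- 1 / R) * flat Q (1 + t / R) +
        flat ([:0, 0, 1:] * (Q - pderiv Q)) (1 + t / R) * (1 / R) * flat P (1 - t / R))) (at t)"
    using DERIV_mult[OF 1 2] by (intro has_vector_derivative_of_real) (simp add: has_real_derivative_iff_has_vector_derivative)
  show ?thesis
    by (rule has_vector_derivative_eq_rhs[OF has_vector_derivative_mult[OF 4 3]])
       (simp add: algebra_simps)
qed

lemma bump_exp_span_deriv:
  assumes "bump_exp_span R z h" "R \<noteq> 0"
  shows "\<exists>h'. bump_exp_span R z h' \<and> (\<forall>t. (h has_vector_derivative h' t) (at t))"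
  using assms
proof induction
  case (base P Q)
  show ?case
    by (rule exI, rule conjI[rotated], rule allI, rule has_vector_derivative_bump[OF base])
       (intro bump_exp_span.intros)
next
  case (scale h c)
  then obtain h' where "bump_exp_span R z h'" "\<forall>t. (h has_vector_derivative h' t) (at t)" by auto
  then show ?case by (intro exI[of _ "\<lambda>t. c * h' t"]) (auto intro!: bump_exp_span.intros has_vector_derivative_mult_right)
next
  case (add h g)
  then obtain h' g' where "bump_exp_span R z h'" "\<forall>t. (h has_vector_derivative h' t) (at t)" "bump_exp_span R z g'" "\<forall>t. (g has_vector_derivative g' t) (at t)" by auto
  then show ?case by (intro exI[of _ "\<lambda>t. h' t + g' t"]) (auto intro!: bump_exp_span.intros has_vector_derivative_add)
qed

lemma bump_exp_span_smooth1:
  assumes "bump_exp_span R z h" "R \<noteq> 0" shows "smooth1 h"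
  using assms(1)
proof (coinduction arbitrary: h)
  case smooth1
  from bump_exp_span_deriv[OF this assms(2)] show ?case by auto
qed

text \<open>Test functions are real-valued; complex ones enter as real parts, with \<open>c\<close> recovering the imaginary part.\<close>

definition tensor_re :: "complex \<Rightarrow> ('n::finite \<Rightarrow> real \<Rightarrow> complex) \<Rightarrow> real^'n \<Rightarrow> real" where
  "tensor_re c h x = Re (c * (\<Prod>j\<in>UNIV. h j (x $ j)))"

lemma pdiff_tensor_re:
  assumes d: "\<And>t. (h i has_vector_derivative h' t) (at t)"
  shows "pdiff i (tensor_re c h) = tensor_re c (h(i := h'))"
proof
  fix x
  have p: "(\<Prod>j\<in>UNIV. h j ((x + t *\<^sub>R axis i 1) $ j)) = h i (x $ i + t) * (\<Prod>j\<in>UNIV-{i}. h j (x $ j))" for t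
    by (subst prod.remove[of _ i]) (auto simp: axis_def intro!: prod.cong)
  have p': "(\<Prod>j\<in>UNIV. (h(i := h')) j (x $ j)) = h' (x $ i) * (\<Prod>j\<in>UNIV-{i}. h j (x $ j))"
    by (subst prod.remove[of _ i]) (auto intro!: prod.cong)
  let ?A = "\<Prod>j\<in>UNIV-{i}. h j (x $ j)"
  have "((\<lambda>t. h i (x $ i + t)) has_vector_derivative h' (x $ i)) (at 0)"
  proof -
    have "((\<lambda>t. x $ i + t) has_vector_derivative 1) (at 0)"
      by (auto simp: has_real_derivative_iff_has_vector_derivative[symmetric] intro!: derivative_eq_intros)
    from vector_diff_chain_at[OF this, of "h i" "h' (x $ i)"] d[of "x $ i"] show ?thesis
      by (simp add: o_def)
  qed
  then have "((\<lambda>t. Re (c * (h i (x $ i + t) * ?A))) has_vector_derivative Re (c * (h' (x $ i) * ?A))) (at 0)"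
    by (intro bounded_linear.has_vector_derivative[OF bounded_linear_Re] has_vector_derivative_mult_right has_vector_derivative_mult_left)
  then have "((\<lambda>t. tensor_re c h (x + t *\<^sub>R axis i 1)) has_real_derivative tensor_re c (h(i := h')) x) (at 0)"
    unfolding tensor_re_def p p' has_real_derivative_iff_has_vector_derivative .
  then show "pdiff i (tensor_re c h) x = tensor_re c (h(i := h')) x"
    unfolding pdiff_def by (rule DERIV_imp_deriv)
qed

text \<open>Each partial derivative replaces one factor by its derivative, so iterated derivatives
  remain real parts of tensor products with \<open>smooth1\<close> factors.\<close>

lemma smooth_fun_tensor_re:
  assumes "\<And>j. smooth1 (h j)"
  shows "smooth_fun (tensor_re c h)"
  unfolding smooth_fun_def
proof (intro allI)
  fix "is" :: "'a list" and x :: "real^'a"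
  have "\<exists>g. (\<forall>j. smooth1 (g j)) \<and> foldr pdiff is (tensor_re c h) = tensor_re c g"
  proof (induction "is")
    case Nil
    then show ?case using assms by auto
  next
    case (Cons i "is")
    then obtain g where g: "\<forall>j. smooth1 (g j)" "foldr pdiff is (tensor_re c h) = tensor_re c g" by auto
    obtain g' where g': "\<And>t. (g i has_vector_derivative g' t) (at t)" "smooth1 g'"
      by (rule smooth1.cases[OF g(1)[rule_format, of i]]) blast
    show ?case
      using g g' by (intro exI[of _ "g(i := g')"]) (auto simp: pdiff_tensor_re[of g i g', OF g'(1)] simp del: fun_upd_apply, simp)
  qed
  then obtain g where g: "\<And>j. smooth1 (g j)" "foldr pdiff is (tensor_re c h) = tensor_re c g" by auto
  have "(\<lambda>x. g j (x $ j)) differentiable (at x)" for j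
  proof -
    obtain g' where "\<And>t. (g j has_vector_derivative g' t) (at t)"
      by (rule smooth1.cases[OF g(1)[of j]]) blast
    then have "(g j has_derivative (\<lambda>t. t *\<^sub>R g' (x $ j))) (at (x $ j))" by (simp add: has_vector_derivative_def)
    then have "((\<lambda>x. g j (x $ j)) has_derivative (\<lambda>y. (y $ j) *\<^sub>R g' (x $ j))) (at x)"
      by (rule has_derivative_compose[rotated]) (rule bounded_linear_imp_has_derivative, simp add: bounded_linear_vec_nth)
    then show ?thesis by (auto simp: differentiable_def)
  qed
  then have "((\<lambda>x. g j (x $ j)) has_derivative frechet_derivative (\<lambda>x. g j (x $ j)) (at x)) (at x)" for j
    by (simp add: frechet_derivative_works[symmetric])
  then obtain D where D: "\<And>j. ((\<lambda>x. g j (x $ j)) has_derivative D j) (at x)" by (rule that)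
  then have "((\<lambda>x. \<Prod>j\<in>UNIV. g j (x $ j)) has_derivative (\<lambda>y. \<Sum>i\<in>UNIV. D i y * (\<Prod>j\<in>UNIV - {i}. g j (x $ j)))) (at x)"
    by (intro has_derivative_prod)
  then have "((\<lambda>x. tensor_re c g x) has_derivative (\<lambda>y. Re (c * (\<Sum>i\<in>UNIV. D i y * (\<Prod>j\<in>UNIV - {i}. g j (x $ j)))))) (at x)"
    unfolding tensor_re_def by (intro has_derivative_Re has_derivative_mult_right)
  then show "foldr pdiff is (tensor_re c h) differentiable (at x)"
    unfolding g(2) by (auto simp: differentiable_def)
qed

lemma tensor_support:
  fixes x :: "real^'n::finite" and R :: real
  assumes R: "\<And>j t. \<bar>t\<bar> \<ge> R \<Longrightarrow> h j t = (0::complex)" and x: "norm x \<ge> CARD('n) * R"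
  shows "(\<Prod>j\<in>UNIV. h j (x $ j)) = 0"
proof (rule ccontr)
  assume "(\<Prod>j\<in>UNIV. h j (x $ j)) \<noteq> 0"
  then have "\<And>j. h j (x $ j) \<noteq> 0" by auto
  then have *: "\<And>j. \<bar>x $ j\<bar> < R" using R by (meson not_le)
  have "norm x \<le> (\<Sum>j\<in>UNIV. \<bar>x $ j\<bar>)" by (rule norm_le_l1_cart)
  also have "\<dots> < (\<Sum>j\<in>(UNIV::'n set). R)" using * by (intro sum_strict_mono) auto
  finally show False using x by simp
qed

lemma test_fun_tensor_re:
  fixes h :: "'n::finite \<Rightarrow> real \<Rightarrow> complex"
  assumes "\<And>j. smooth1 (h j)" and R: "\<And>j t. \<bar>t\<bar> \<ge> R \<Longrightarrow> h j t = 0"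
  shows "test_fun (tensor_re c h)"
  unfolding test_fun_def
proof (intro conjI smooth_fun_tensor_re assms(1))
  have "{x. tensor_re c h x \<noteq> 0} \<subseteq> ball 0 (CARD('n) * R)"
  proof
    fix x :: "real^'n" assume "x \<in> {x. tensor_re c h x \<noteq> 0}"
    then have "(\<Prod>j\<in>UNIV. h j (x $ j)) \<noteq> 0"
      by (intro notI) (simp add: tensor_re_def del: prod_zero_iff)
    then show "x \<in> ball 0 (CARD('n) * R)" using tensor_support[of R h x] R by fastforce
  qed
  then show "compact (closure {x. tensor_re c h x \<noteq> 0})"
    using bounded_subset[OF bounded_ball] by (auto simp: compact_eq_bounded_closed intro!: bounded_closure)
qed

lemma smooth1_continuous:
  assumes "smooth1 h" shows "continuous_on UNIV h"
proof -
  obtain h' where "\<And>t. (h has_vector_derivative h' t) (at t)"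
    by (rule smooth1.cases[OF assms]) blast
  then have "\<And>t. isCont h t" by (rule has_vector_derivative_continuous)
  then show ?thesis by (simp add: continuous_on_eq_continuous_at)
qed

lemma continuous_tensor:
  fixes h :: "'n::finite \<Rightarrow> real \<Rightarrow> complex"
  assumes "\<And>j. continuous_on UNIV (h j)"
  shows "continuous_on UNIV (\<lambda>x::real^'n. \<Prod>j\<in>UNIV. h j (x $ j))"
  by (intro continuous_on_prod continuous_on_compose2[OF assms]) (auto intro!: continuous_intros)

lemma L2_loc_integrable:
  fixes u \<psi> :: "real^'n::finite \<Rightarrow> complex"
  assumes u: "L2_loc u" and c: "continuous_on UNIV \<psi>" and R: "\<And>x. norm x \<ge> R \<Longrightarrow> \<psi> x = 0"
  shows "integrable lebesgue (\<lambda>x. u x * \<psi> x)"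
proof -
  have m[measurable]: "u \<in> borel_measurable lebesgue" using u by (simp add: L2_loc_def)
  have "\<psi> \<in> borel_measurable borel" using c by (rule borel_measurable_continuous_onI)
  then have [measurable]: "\<psi> \<in> borel_measurable lebesgue" by (simp add: measurable_completion)
  have "bounded (\<psi> ` cball 0 R)"
    by (intro compact_imp_bounded compact_continuous_image continuous_on_subset[OF c]) auto
  then obtain B where B: "B \<ge> 0" "\<And>x. x \<in> cball 0 R \<Longrightarrow> norm (\<psi> x) \<le> B"
  proof -
    assume *: "\<And>B. 0 \<le> B \<Longrightarrow> (\<And>x. x \<in> cball 0 R \<Longrightarrow> norm (\<psi> x) \<le> B) \<Longrightarrow> thesis"
    from \<open>bounded _\<close> obtain b where "b > 0" "\<forall>y\<in>\<psi> ` cball 0 R. norm y \<le> b" unfolding bounded_pos by blast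
    then show thesis by (intro *[of b]) auto
  qed
  have i1: "integrable lebesgue (\<lambda>x. indicator (ball 0 R) x *\<^sub>R (norm (u x))\<^sup>2)"
    using u unfolding L2_loc_def set_integrable_def by auto
  have "integrable lborel (indicator (ball (0::real^'n) R) :: _ \<Rightarrow> real)"
    using emeasure_lborel_ball_finite[of "0::real^'n" R] by simp
  then have i2: "integrable lebesgue (indicator (ball (0::real^'n) R) :: _ \<Rightarrow> real)"
    by (subst integrable_completion) auto
  have i3: "integrable lebesgue (\<lambda>x. B * (indicator (ball 0 R) x + indicator (ball 0 R) x *\<^sub>R (norm (u x))\<^sup>2))"
    by (intro integrable_mult_right Bochner_Integration.integrable_add i1 i2)
  show ?thesis
  proof (rule Bochner_Integration.integrable_bound[OF i3])
    show "AE x in lebesgue. norm (u x * \<psi> x) \<le> norm (B * (indicator (ball 0 R) x + indicator (ball 0 R) x *\<^sub>R (norm (u x))\<^sup>2))"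
    proof (rule AE_I2)
      fix x
      show "norm (u x * \<psi> x) \<le> norm (B * (indicator (ball 0 R) x + indicator (ball 0 R) x *\<^sub>R (norm (u x))\<^sup>2))"
      proof (cases "norm x < R")
        case True
        have "norm (u x) \<le> 1 + (norm (u x))\<^sup>2"
          using sum_squares_bound[of "norm (u x)" 1] zero_le_power2[of "norm (u x)"] by (simp add: power2_eq_square) (smt (verit) norm_ge_zero mult_nonneg_nonneg)
        then have "norm (u x) * norm (\<psi> x) \<le> (1 + (norm (u x))\<^sup>2) * B"
          using True B by (intro mult_mono) auto
        then show ?thesis using True B by (simp add: norm_mult mult.commute)
      next
        case False
        then show ?thesis using R[of x] by simp
      qed
    qed
  qed measurable
qed

lemma tensor_re_split:
  "(\<Prod>j\<in>UNIV. h j (x $ j)) = complex_of_real (tensor_re 1 h x) + \<i> * complex_of_real (tensor_re (- \<i>) h x)"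
  by (simp add: tensor_re_def complex_eq_iff)

text \<open>Linearity extends the definition from real to complex test functions: combine the
  identities for \<open>c = 1\<close> and \<open>c = - \<i>\<close>.\<close>

lemma weak_pdiff_tensor:
  fixes h :: "'n::finite \<Rightarrow> real \<Rightarrow> complex"
  assumes w: "weak_pdiff i u g" and u: "L2_loc u" and g: "L2_loc g"
    and h: "\<And>j. smooth1 (h j)" "\<And>j t. \<bar>t\<bar> \<ge> R \<Longrightarrow> h j t = 0"
    and h': "\<And>t. (h i has_vector_derivative h' t) (at t)" "smooth1 h'" "\<And>t. \<bar>t\<bar> \<ge> R \<Longrightarrow> h' t = 0"
  shows "(LINT x|lebesgue. u x * (\<Prod>j\<in>UNIV. (h(i := h')) j (x $ j))) = - (LINT x|lebesgue. g x * (\<Prod>j\<in>UNIV. h j (x $ j)))"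
proof -
  have k: "\<And>j. smooth1 ((h(i := h')) j)" "\<And>j t. \<bar>t\<bar> \<ge> R \<Longrightarrow> (h(i := h')) j t = 0"
    using h h' by auto
  have I: "integrable lebesgue (\<lambda>x. v x * complex_of_real (tensor_re c k x))"
    if "L2_loc v" "\<And>j. smooth1 (k j)" "\<And>j t. \<bar>t\<bar> \<ge> R \<Longrightarrow> k j t = 0" for v c and k :: "'n \<Rightarrow> real \<Rightarrow> complex"
  proof (rule L2_loc_integrable[OF that(1), of _ "CARD('n) * R"])
    show "continuous_on UNIV (\<lambda>x. complex_of_real (tensor_re c k x))"
      unfolding tensor_re_def by (intro continuous_intros continuous_tensor smooth1_continuous that)
    show "complex_of_real (tensor_re c k x) = 0" if "CARD('n) * R \<le> norm x" for x
      using tensor_support[of R k x] that \<open>\<And>j t. \<bar>t\<bar> \<ge> R \<Longrightarrow> k j t = 0\<close> by (simp add: tensor_re_def del: prod_zero_iff)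
  qed
  have W: "(LINT x|lebesgue. u x * complex_of_real (tensor_re c (h(i := h')) x)) = - (LINT x|lebesgue. g x * complex_of_real (tensor_re c h x))" for c
    using w[unfolded weak_pdiff_def, rule_format, OF test_fun_tensor_re[of h R c, OF h]]
    unfolding pdiff_tensor_re[of h i h', OF h'(1)] .
  have S: "(LINT x|lebesgue. v x * (\<Prod>j\<in>UNIV. k j (x $ j))) = (LINT x|lebesgue. v x * complex_of_real (tensor_re 1 k x)) + \<i> * (LINT x|lebesgue. v x * complex_of_real (tensor_re (-\<i>) k x))"
    if "L2_loc v" "\<And>j. smooth1 (k j)" "\<And>j t. \<bar>t\<bar> \<ge> R \<Longrightarrow> k j t = 0" for v and k :: "'n \<Rightarrow> real \<Rightarrow> complex"
  proof -
    have "(LINT x|lebesgue. v x * (\<Prod>j\<in>UNIV. k j (x $ j))) = (LINT x|lebesgue. v x * complex_of_real (tensor_re 1 k x) + \<i> * (v x * complex_of_real (tensor_re (-\<i>) k x)))"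
      unfolding tensor_re_split by (simp add: algebra_simps)
    also have "\<dots> = (LINT x|lebesgue. v x * complex_of_real (tensor_re 1 k x)) + (LINT x|lebesgue. \<i> * (v x * complex_of_real (tensor_re (-\<i>) k x)))"
      by (intro Bochner_Integration.integral_add integrable_mult_right I that)
    finally show ?thesis by simp
  qed
  have "(LINT x|lebesgue. u x * (\<Prod>j\<in>UNIV. (h(i := h')) j (x $ j)))
      = - (LINT x|lebesgue. g x * complex_of_real (tensor_re 1 h x)) + \<i> * (- (LINT x|lebesgue. g x * complex_of_real (tensor_re (-\<i>) h x)))"
    unfolding W[symmetric] by (rule S) (fact u k)+
  also have "\<dots> = - (LINT x|lebesgue. g x * (\<Prod>j\<in>UNIV. h j (x $ j)))"
    by (subst S[of g h]) (use g h in \<open>auto simp: algebra_simps\<close>)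
  finally show ?thesis .
qed

text \<open>Tensor products suffice because a plane wave is one.\<close>

definition weak_helm :: "real \<Rightarrow> (real^'n::finite \<Rightarrow> complex) \<Rightarrow> (real^'n \<Rightarrow> complex) \<Rightarrow> bool" where
  "weak_helm lam u f \<longleftrightarrow> (\<forall>h h' h'' R.
     (\<forall>j. smooth1 (h j) \<and> smooth1 (h' j) \<and> smooth1 (h'' j)) \<and>
     (\<forall>j t. (h j has_vector_derivative h' j t) (at t) \<and> (h' j has_vector_derivative h'' j t) (at t)) \<and>
     (\<forall>j t. \<bar>t\<bar> \<ge> R \<longrightarrow> h j t = 0 \<and> h' j t = 0 \<and> h'' j t = 0) \<longrightarrow>
     (LINT x|lborel. u x * (- (\<Sum>i\<in>UNIV. \<Prod>j\<in>UNIV. (h(i := h'' i)) j (x $ j)) - complex_of_real lam * (\<Prod>j\<in>UNIV. h j (x $ j))))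
       = (LINT x|lborel. f x * (\<Prod>j\<in>UNIV. h j (x $ j))))"

text \<open>The passage from the completed measure to \<open>lborel\<close>, where the Fubini
  theorems are applied to Borel representatives.\<close>

lemma lebesgue_lborel_integral:
  fixes u u0 :: "real^'n::finite \<Rightarrow> complex"
  assumes "AE x in lebesgue. u x = u0 x" "u \<in> borel_measurable lebesgue" "u0 \<in> borel_measurable borel" "continuous_on UNIV \<psi>"
  shows "(LINT x|lebesgue. u x * \<psi> x) = (LINT x|lborel. u0 x * \<psi> x)"
proof -
  have [measurable]: "\<psi> \<in> borel_measurable borel" using assms(4) by (rule borel_measurable_continuous_onI)
  note [measurable] = assms(2,3)
  have [measurable]: "\<psi> \<in> borel_measurable lebesgue" "u0 \<in> borel_measurable lebesgue"
    using assms(3) by (simp_all add: measurable_completion)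
  have "(LINT x|lebesgue. u x * \<psi> x) = (LINT x|lebesgue. u0 x * \<psi> x)"
    by (rule integral_cong_AE) (use assms(1) in auto)
  also have "\<dots> = (LINT x|lborel. u0 x * \<psi> x)" by (rule integral_completion) auto
  finally show ?thesis .
qed

lemma weak_helmholtz:
  fixes u f u0 f0 :: "real^'n::finite \<Rightarrow> complex"
  assumes B: "Bstar0_2_with u Du D2u"
    and eq: "AE x in lebesgue. - (\<Sum>i\<in>UNIV. D2u i i x) - complex_of_real lam * u x = f x"
    and u0: "AE x in lebesgue. u x = u0 x" "u0 \<in> borel_measurable borel"
    and f0: "AE x in lebesgue. f x = f0 x" "f0 \<in> borel_measurable borel"
    and f: "f \<in> borel_measurable lebesgue"
  shows "weak_helm lam u0 f0"
  unfolding weak_helm_def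
proof (intro allI impI, elim conjE)
  fix h h' h'' :: "'n \<Rightarrow> real \<Rightarrow> complex" and R :: real
  assume "\<forall>j. smooth1 (h j) \<and> smooth1 (h' j) \<and> smooth1 (h'' j)"
    "\<forall>j t. (h j has_vector_derivative h' j t) (at t) \<and> (h' j has_vector_derivative h'' j t) (at t)"
    "\<forall>j t. \<bar>t\<bar> \<ge> R \<longrightarrow> h j t = 0 \<and> h' j t = 0 \<and> h'' j t = 0"
  then have s: "\<And>j. smooth1 (h j)" "\<And>j. smooth1 (h' j)" "\<And>j. smooth1 (h'' j)"
    and d: "\<And>j t. (h j has_vector_derivative h' j t) (at t)" "\<And>j t. (h' j has_vector_derivative h'' j t) (at t)"
    and z: "\<And>j t. \<bar>t\<bar> \<ge> R \<Longrightarrow> h j t = 0" "\<And>j t. \<bar>t\<bar> \<ge> R \<Longrightarrow> h' j t = 0" "\<And>j t. \<bar>t\<bar> \<ge> R \<Longrightarrow> h'' j t = 0" by auto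
  have L: "L2_loc u" "\<And>i. L2_loc (Du i)" "\<And>i j. L2_loc (D2u i j)"
    and w: "\<And>i. weak_pdiff i u (Du i)" "\<And>i j. weak_pdiff j (Du i) (D2u i j)"
    using B by (auto simp: Bstar0_2_with_def Bstar0_def)
  have um: "u \<in> borel_measurable lebesgue" using L by (simp add: L2_loc_def)
  let ?P = "\<lambda>(h :: 'n \<Rightarrow> real \<Rightarrow> complex) (x :: real^'n). \<Prod>j\<in>UNIV. h j (x $ j)"
  have c: "continuous_on UNIV (?P k)" if "\<And>j. smooth1 (k j)" for k :: "'n \<Rightarrow> real \<Rightarrow> complex"
    by (intro continuous_tensor smooth1_continuous that)
  have I: "integrable lebesgue (\<lambda>x. v x * ?P k x)"
    if "L2_loc v" "\<And>j. smooth1 (k j)" "\<And>j t. \<bar>t\<bar> \<ge> R \<Longrightarrow> k j t = 0" for v and k :: "'n \<Rightarrow> real \<Rightarrow> complex"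
    by (rule L2_loc_integrable[OF that(1) c[OF that(2)], of "CARD('n) * R"]) (rule tensor_support[OF that(3)])
  \<comment> \<open>Two integrations by parts in the same variable; the first is tested on the
    product whose i-th factor is already \<open>h' i\<close>.\<close>
  have A: "(LINT x|lebesgue. u x * ?P (h(i := h'' i)) x) = (LINT x|lebesgue. D2u i i x * ?P h x)" for i
  proof -
    have "(LINT x|lebesgue. u x * ?P ((h(i := h' i))(i := h'' i)) x) = - (LINT x|lebesgue. Du i x * ?P (h(i := h' i)) x)"
      by (rule weak_pdiff_tensor[OF w(1) L(1,2), where R=R]) (use s z d in auto)
    also have "\<dots> = (LINT x|lebesgue. D2u i i x * ?P h x)"
      by (subst weak_pdiff_tensor[OF w(2) L(2,3), where R=R]) (use s z d in auto)
    finally show ?thesis by simp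
  qed
  have "(LINT x|lborel. u0 x * (- (\<Sum>i\<in>UNIV. ?P (h(i := h'' i)) x) - complex_of_real lam * ?P h x))
      = (LINT x|lebesgue. u x * (- (\<Sum>i\<in>UNIV. ?P (h(i := h'' i)) x) - complex_of_real lam * ?P h x))"
    by (rule lebesgue_lborel_integral[OF u0(1) um u0(2), symmetric]) (intro continuous_intros c, auto simp: s)
  also have "\<dots> = (LINT x|lebesgue. - (\<Sum>i\<in>UNIV. u x * ?P (h(i := h'' i)) x) - complex_of_real lam * (u x * ?P h x))"
    by (intro Bochner_Integration.integral_cong refl) (simp add: algebra_simps sum_distrib_left)
  also have "\<dots> = - (\<Sum>i\<in>UNIV. LINT x|lebesgue. u x * ?P (h(i := h'' i)) x) - complex_of_real lam * (LINT x|lebesgue. u x * ?P h x)"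
  proof -
    have 1: "integrable lebesgue (\<lambda>x. u x * ?P (h(i := h'' i)) x)" for i
      by (rule I[OF L(1)]) (use s z in auto)
    have 2: "integrable lebesgue (\<lambda>x. u x * ?P h x)" by (rule I[OF L(1)]) (use s z in auto)
    show ?thesis
      by (subst Bochner_Integration.integral_diff)
         (use 1 2 in \<open>auto simp: Bochner_Integration.integral_sum intro!: Bochner_Integration.integrable_minus Bochner_Integration.integrable_sum integrable_mult_right simp del: fun_upd_apply\<close>)
  qed
  also have "\<dots> = - (\<Sum>i\<in>UNIV. LINT x|lebesgue. D2u i i x * ?P h x) - complex_of_real lam * (LINT x|lebesgue. u x * ?P h x)"
    unfolding A ..
  also have "\<dots> = (LINT x|lebesgue. - (\<Sum>i\<in>UNIV. D2u i i x * ?P h x) - complex_of_real lam * (u x * ?P h x))"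
  proof -
    have 1: "integrable lebesgue (\<lambda>x. D2u i i x * ?P h x)" for i
      by (rule I[OF L(3)]) (use s z in auto)
    have 2: "integrable lebesgue (\<lambda>x. u x * ?P h x)" by (rule I[OF L(1)]) (use s z in auto)
    show ?thesis
      by (subst Bochner_Integration.integral_diff)
         (use 1 2 in \<open>auto simp: Bochner_Integration.integral_sum intro!: Bochner_Integration.integrable_minus Bochner_Integration.integrable_sum integrable_mult_right\<close>)
  qed
  also have "\<dots> = (LINT x|lebesgue. (- (\<Sum>i\<in>UNIV. D2u i i x) - complex_of_real lam * u x) * ?P h x)"
    by (intro Bochner_Integration.integral_cong refl) (simp add: algebra_simps sum_distrib_right)
  also have "\<dots> = (LINT x|lborel. f0 x * ?P h x)"
  proof (rule lebesgue_lborel_integral)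
    show "AE x in lebesgue. - (\<Sum>i\<in>UNIV. D2u i i x) - complex_of_real lam * u x = f0 x"
      using eq f0(1) by eventually_elim simp
    have [measurable]: "D2u i i \<in> borel_measurable lebesgue" for i using L(3)[of i i] by (simp add: L2_loc_def)
    note [measurable] = um
    show "(\<lambda>x. - (\<Sum>i\<in>UNIV. D2u i i x) - complex_of_real lam * u x) \<in> borel_measurable lebesgue" by measurable
  qed (use f0 c s in auto)
  finally show "(LINT x|lborel. u0 x * (- (\<Sum>i\<in>UNIV. ?P (h(i := h'' i)) x) - complex_of_real lam * ?P h x)) = (LINT x|lborel. f0 x * ?P h x)" .
qed

section \<open>Truncated plane waves as test functions\<close>

definition flat_deriv :: "real poly \<Rightarrow> real poly" where "flat_deriv P = [:0, 0, 1:] * (P - pderiv P)"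

definition bump :: "real \<Rightarrow> real" where "bump s = flat 1 (1 - s) * flat 1 (1 + s)"
definition bump1 :: "real \<Rightarrow> real" where
  "bump1 s = flat 1 (1 - s) * flat (flat_deriv 1) (1 + s) - flat (flat_deriv 1) (1 - s) * flat 1 (1 + s)"
definition bump2 :: "real \<Rightarrow> real" where
  "bump2 s = flat 1 (1 - s) * flat (flat_deriv (flat_deriv 1)) (1 + s) - 2 * flat (flat_deriv 1) (1 - s) * flat (flat_deriv 1) (1 + s)
     + flat (flat_deriv (flat_deriv 1)) (1 - s) * flat 1 (1 + s)"

lemma DERIV_flat_comp:
  shows "((\<lambda>s. flat P (1 - s)) has_real_derivative - flat (flat_deriv P) (1 - s)) (at s)"
    and "((\<lambda>s. flat P (1 + s)) has_real_derivative flat (flat_deriv P) (1 + s)) (at s)"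
proof -
  show "((\<lambda>s. flat P (1 - s)) has_real_derivative - flat (flat_deriv P) (1 - s)) (at s)"
    unfolding flat_deriv_def
    by (rule DERIV_cong[OF DERIV_chain'[OF _ DERIV_flat]]) (auto intro!: derivative_eq_intros)
  show "((\<lambda>s. flat P (1 + s)) has_real_derivative flat (flat_deriv P) (1 + s)) (at s)"
    unfolding flat_deriv_def
    by (rule DERIV_cong[OF DERIV_chain'[OF _ DERIV_flat]]) (auto intro!: derivative_eq_intros)
qed

lemma DERIV_bump: "(bump has_real_derivative bump1 s) (at s)"
  unfolding bump_def[abs_def] bump1_def
  by (rule DERIV_cong[OF DERIV_mult[OF DERIV_flat_comp]]) (simp add: algebra_simps)

lemma DERIV_bump1: "(bump1 has_real_derivative bump2 s) (at s)"
  unfolding bump1_def[abs_def] bump2_def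
  by (rule DERIV_cong[OF DERIV_diff[OF DERIV_mult[OF DERIV_flat_comp] DERIV_mult[OF DERIV_flat_comp]]]) (simp add: algebra_simps)

lemma bump_zero:
  assumes "\<bar>s\<bar> \<ge> 1" shows "bump s = 0" "bump1 s = 0" "bump2 s = 0"
proof -
  have "1 - s \<le> 0 \<or> 1 + s \<le> 0" using assms by (auto simp: abs_if split: if_splits)
  then have "(\<forall>P. flat P (1 - s) = 0) \<or> (\<forall>P. flat P (1 + s) = 0)" by (auto simp: flat_def)
  then show "bump s = 0" "bump1 s = 0" "bump2 s = 0" by (auto simp: bump_def bump1_def bump2_def)
qed

lemma bump_pos: "bump 0 > 0"
  by (simp add: bump_def flat_def)

lemma continuous_flat: "continuous_on UNIV (flat P)"
  by (intro continuous_at_imp_continuous_on ballI DERIV_isCont[OF DERIV_flat])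

lemma continuous_bump: "continuous_on UNIV bump" "continuous_on UNIV bump1" "continuous_on UNIV bump2"
  unfolding bump_def[abs_def] bump1_def[abs_def] bump2_def[abs_def]
  by (intro continuous_intros continuous_on_compose2[OF continuous_flat] subset_UNIV)+

lemma bounded_compact_support:
  fixes b :: "real \<Rightarrow> real"
  assumes "continuous_on UNIV b" "\<And>s. \<bar>s\<bar> \<ge> 1 \<Longrightarrow> b s = 0"
  shows "\<exists>M. \<forall>s. \<bar>b s\<bar> \<le> M"
proof -
  have "bounded (b ` {-1..1})"
    by (intro compact_imp_bounded compact_continuous_image continuous_on_subset[OF assms(1)]) auto
  then obtain M where M: "M > 0" "\<forall>y\<in>b ` {-1..1}. norm y \<le> M" unfolding bounded_pos by blast
  have "\<bar>b s\<bar> \<le> M" for s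
  proof (cases "\<bar>s\<bar> \<ge> 1")
    case True then show ?thesis using assms(2)[of s] M by simp
  next
    case False then have "s \<in> {-1..1}" by auto
    then show ?thesis using M by auto
  qed
  then show ?thesis by blast
qed

lemma bump_bounded:
  obtains M where "M \<ge> 1" "\<And>s. \<bar>bump s\<bar> \<le> M" "\<And>s. \<bar>bump1 s\<bar> \<le> M" "\<And>s. \<bar>bump2 s\<bar> \<le> M"
proof -
  obtain M0 M1 M2 where M: "\<And>s. \<bar>bump s\<bar> \<le> M0" "\<And>s. \<bar>bump1 s\<bar> \<le> M1" "\<And>s. \<bar>bump2 s\<bar> \<le> M2"
    using bounded_compact_support[OF continuous_bump(1) bump_zero(1)]
      bounded_compact_support[OF continuous_bump(2) bump_zero(2)]
      bounded_compact_support[OF continuous_bump(3) bump_zero(3)] by blast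
  show thesis
  proof (rule that[of "max 1 (max M0 (max M1 M2))"])
    fix s
    show "\<bar>bump s\<bar> \<le> max 1 (max M0 (max M1 M2))" using M(1)[of s] by (simp add: le_max_iff_disj)
    show "\<bar>bump1 s\<bar> \<le> max 1 (max M0 (max M1 M2))" using M(2)[of s] by (simp add: le_max_iff_disj)
    show "\<bar>bump2 s\<bar> \<le> max 1 (max M0 (max M1 M2))" using M(3)[of s] by (simp add: le_max_iff_disj)
  qed simp
qed

lemma smooth1_deriv:
  assumes "smooth1 h" "\<And>t. (h has_vector_derivative g t) (at t)"
  shows "smooth1 g"
proof (rule smooth1.cases[OF assms(1)])
  fix k h' assume *: "h = k" "\<And>t. (k has_vector_derivative h' t) (at t)" "smooth1 h'"
  have "g = h'" using assms(2) *(1,2) vector_derivative_unique_at by (intro ext) blast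
  then show ?thesis using * by simp
qed

lemma has_vector_derivative_bump_cis:
  assumes d: "\<And>s. (b has_real_derivative b' s) (at s)" and R: "R \<noteq> 0"
  shows "((\<lambda>t. complex_of_real (b (t / R)) * cis (y * t)) has_vector_derivative
     (complex_of_real (b' (t / R) / R) + \<i> * y * complex_of_real (b (t / R))) * cis (y * t)) (at t)"
proof -
  have 1: "((\<lambda>t. b (t / R)) has_real_derivative b' (t / R) * (1 / R)) (at t)"
    by (rule DERIV_chain'[OF _ d]) (use R in \<open>auto intro!: derivative_eq_intros\<close>)
  then have 2: "((\<lambda>t. complex_of_real (b (t / R))) has_vector_derivative complex_of_real (b' (t / R) * (1 / R))) (at t)"
    by (intro has_vector_derivative_of_real) (simp add: has_real_derivative_iff_has_vector_derivative)
  have 3: "((\<lambda>t. exp (\<i> * y * complex_of_real t)) has_vector_derivative (\<i> * y * exp (\<i> * y * t))) (at t)"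
    by (rule has_vector_derivative_real_field) (auto intro!: derivative_eq_intros)
  have e: "exp (\<i> * y * complex_of_real t) = cis (y * t)" for t by (simp add: cis_conv_exp mult_ac)
  show ?thesis
    by (rule has_vector_derivative_eq_rhs[OF has_vector_derivative_mult[OF 2 3[unfolded e]]])
       (simp add: algebra_simps)
qed

lemma bump_cis_smooth:
  assumes R: "R \<noteq> 0"
  shows "smooth1 (\<lambda>t. complex_of_real (bump (t / R)) * cis (y * t))"
proof -
  have "bump_exp_span R (\<i> * y) (\<lambda>t. complex_of_real (flat 1 (1 - t / R) * flat 1 (1 + t / R)) * exp (\<i> * y * t))"
    by (rule bump_exp_span.base)
  also have "(\<lambda>t. complex_of_real (flat 1 (1 - t / R) * flat 1 (1 + t / R)) * exp (\<i> * y * t)) = (\<lambda>t. complex_of_real (bump (t / R)) * cis (y * t))"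
    by (intro ext) (simp add: bump_def cis_conv_exp mult_ac)
  finally show ?thesis by (rule bump_exp_span_smooth1[OF _ R])
qed

text \<open>One coordinate factor of a plane wave of frequency \<open>y\<close>, truncated at |t| =
  R. The next two functions are its derivatives by the Leibniz rule.\<close>

definition bumpwave :: "real \<Rightarrow> real \<Rightarrow> real \<Rightarrow> complex" where
  "bumpwave R y t = complex_of_real (bump (t / R)) * cis (y * t)"
definition bumpwave1 :: "real \<Rightarrow> real \<Rightarrow> real \<Rightarrow> complex" where
  "bumpwave1 R y t = (complex_of_real (bump1 (t / R) / R) + \<i> * y * complex_of_real (bump (t / R))) * cis (y * t)"
definition bumpwave2 :: "real \<Rightarrow> real \<Rightarrow> real \<Rightarrow> complex" where
  "bumpwave2 R y t = (complex_of_real (bump2 (t / R) / R\<^sup>2) + 2 * \<i> * y * complex_of_real (bump1 (t / R) / R) - y\<^sup>2 * complex_of_real (bump (t / R))) * cis (y * t)"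

lemma bumpwave_deriv:
  assumes R: "R \<noteq> 0"
  shows "(bumpwave R y has_vector_derivative bumpwave1 R y t) (at t)"
    and "(bumpwave1 R y has_vector_derivative bumpwave2 R y t) (at t)"
proof -
  show "(bumpwave R y has_vector_derivative bumpwave1 R y t) (at t)"
    unfolding bumpwave_def[abs_def] bumpwave1_def by (rule has_vector_derivative_bump_cis[OF DERIV_bump R])
  have "((\<lambda>t. (1 / R) * (complex_of_real (bump1 (t / R)) * cis (y * t)) + \<i> * y * (complex_of_real (bump (t / R)) * cis (y * t))) has_vector_derivative
      (1 / R) * ((complex_of_real (bump2 (t / R) / R) + \<i> * y * complex_of_real (bump1 (t / R))) * cis (y * t))
      + \<i> * y * ((complex_of_real (bump1 (t / R) / R) + \<i> * y * complex_of_real (bump (t / R))) * cis (y * t))) (at t)"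
    by (intro has_vector_derivative_add has_vector_derivative_mult_right has_vector_derivative_bump_cis R DERIV_bump DERIV_bump1)
  then show "(bumpwave1 R y has_vector_derivative bumpwave2 R y t) (at t)"
    unfolding bumpwave1_def[abs_def] bumpwave2_def by (simp add: algebra_simps power2_eq_square)
qed

lemma bumpwave_smooth:
  assumes R: "R \<noteq> 0"
  shows "smooth1 (bumpwave R y)" "smooth1 (bumpwave1 R y)" "smooth1 (bumpwave2 R y)"
proof -
  show 0: "smooth1 (bumpwave R y)" unfolding bumpwave_def[abs_def] by (rule bump_cis_smooth[OF R])
  show 1: "smooth1 (bumpwave1 R y)" by (rule smooth1_deriv[OF 0 bumpwave_deriv(1)[OF R]])
  show "smooth1 (bumpwave2 R y)" by (rule smooth1_deriv[OF 1 bumpwave_deriv(2)[OF R]])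
qed

lemma bumpwave_zero:
  assumes "R > 0" "\<bar>t\<bar> \<ge> R"
  shows "bumpwave R y t = 0" "bumpwave1 R y t = 0" "bumpwave2 R y t = 0"
proof -
  have "\<bar>t / R\<bar> \<ge> 1" using assms by (simp add: abs_divide)
  from bump_zero[OF this] show "bumpwave R y t = 0" "bumpwave1 R y t = 0" "bumpwave2 R y t = 0"
    by (simp_all add: bumpwave_def bumpwave1_def bumpwave2_def)
qed

definition cutoff :: "real \<Rightarrow> real^'n::finite \<Rightarrow> real" where
  "cutoff R x = (\<Prod>j\<in>UNIV. bump (x $ j / R))"
text \<open>Collects the terms in which derivatives fall on the truncation: \<open>b\<close> will be
  \<open>bump1\<close> or \<open>bump2\<close> in the i-th coordinate.\<close>

definition cutoff' :: "(real \<Rightarrow> real) \<Rightarrow> real \<Rightarrow> 'n::finite \<Rightarrow> real^'n \<Rightarrow> real" where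
  "cutoff' b R i x = b (x $ i / R) * (\<Prod>j\<in>UNIV - {i}. bump (x $ j / R))"

lemma cis_inner_vec: "(\<Prod>j\<in>UNIV. cis (y $ j * x $ j)) = cis (x \<bullet> (y :: real^'n::finite))"
proof -
  have "(\<Prod>j\<in>UNIV. cis (y $ j * x $ j)) = exp (\<Sum>j\<in>UNIV. \<i> * (y $ j * x $ j))"
    by (subst exp_sum) (auto simp: cis_conv_exp)
  also have "(\<Sum>j\<in>UNIV. \<i> * (y $ j * x $ j)) = \<i> * (x \<bullet> y)"
    by (simp add: inner_vec_def sum_distrib_left mult_ac)
  finally show ?thesis by (simp add: cis_conv_exp)
qed

lemma bumpwave_prod: "(\<Prod>j\<in>UNIV. bumpwave R (y $ j) (x $ j)) = complex_of_real (cutoff R x) * cis (x \<bullet> (y :: real^'n::finite))"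
  unfolding bumpwave_def prod.distrib cis_inner_vec cutoff_def by simp

lemma bumpwave2_prod:
  fixes x y :: "real^'n::finite"
  shows "(\<Prod>j\<in>UNIV. ((\<lambda>j. bumpwave R (y $ j))(i := bumpwave2 R (y $ i))) j (x $ j))
     = (complex_of_real (cutoff' bump2 R i x) / R\<^sup>2 + 2 * \<i> * (y $ i) * complex_of_real (cutoff' bump1 R i x) / R
         - (y $ i)\<^sup>2 * complex_of_real (cutoff R x)) * cis (x \<bullet> y)"
proof -
  have 1: "(\<Prod>j\<in>UNIV. ((\<lambda>j. bumpwave R (y $ j))(i := bumpwave2 R (y $ i))) j (x $ j)) = bumpwave2 R (y $ i) (x $ i) * (\<Prod>j\<in>UNIV - {i}. bumpwave R (y $ j) (x $ j))"
    by (subst prod.remove[of _ i]) (auto intro!: prod.cong)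
  have 2: "cutoff R x = cutoff' bump R i x"
    unfolding cutoff_def cutoff'_def by (subst prod.remove[of _ i]) auto
  have 3: "cis (x \<bullet> y) = cis (y $ i * x $ i) * (\<Prod>j\<in>UNIV - {i}. cis (y $ j * x $ j))"
    unfolding cis_inner_vec[symmetric] by (subst prod.remove[of _ i]) auto
  show ?thesis unfolding 1 2 3 bumpwave_def bumpwave2_def cutoff'_def prod.distrib
    by (simp add: algebra_simps)
qed

text \<open>On a plane wave the operator acts as multiplication by |y|^2 - lam; the commutator with
  the truncation leaves terms carrying 1/R and 1/R^2.\<close>

lemma weak_helm_exp:
  fixes u f :: "real^'n::finite \<Rightarrow> complex"
  assumes w: "weak_helm lam u f" and R: "R > 0"
  shows "(LINT x|lborel. u x * (complex_of_real ((norm y)\<^sup>2 - lam) * complex_of_real (cutoff R x)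
       - (\<Sum>i\<in>UNIV. 2 * \<i> * (y $ i) / R * complex_of_real (cutoff' bump1 R i x))
       - (\<Sum>i\<in>UNIV. complex_of_real (cutoff' bump2 R i x)) / complex_of_real (R\<^sup>2)) * cis (x \<bullet> y))
     = (LINT x|lborel. f x * (complex_of_real (cutoff R x) * cis (x \<bullet> y)))"
proof -
  have R0: "R \<noteq> 0" using R by simp
  have n: "(norm y)\<^sup>2 = (\<Sum>i\<in>UNIV. (y $ i)\<^sup>2)"
    unfolding power2_norm_eq_inner by (simp add: inner_vec_def power2_eq_square)
  have *: "(LINT x|lborel. u x * (- (\<Sum>i\<in>UNIV. \<Prod>j\<in>UNIV. ((\<lambda>j. bumpwave R (y $ j))(i := bumpwave2 R (y $ i))) j (x $ j)) - complex_of_real lam * (\<Prod>j\<in>UNIV. bumpwave R (y $ j) (x $ j))))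
       = (LINT x|lborel. f x * (\<Prod>j\<in>UNIV. bumpwave R (y $ j) (x $ j)))"
    by (rule w[unfolded weak_helm_def, rule_format, of "\<lambda>j. bumpwave R (y $ j)" "\<lambda>j. bumpwave1 R (y $ j)" "\<lambda>j. bumpwave2 R (y $ j)" R])
       (auto simp: bumpwave_smooth[OF R0] bumpwave_deriv[OF R0] bumpwave_zero[OF R])
  show ?thesis
    unfolding *[unfolded bumpwave2_prod bumpwave_prod, symmetric] n
    by (intro Bochner_Integration.integral_cong refl)
       (simp add: algebra_simps sum_distrib_left sum_distrib_right sum_divide_distrib sum.distrib sum_subtractf)
qed

lemma Bstar0_borel_mult_integrable:
  fixes u :: "'a::euclidean_space \<Rightarrow> complex"
  assumes u: "Bstar0_borel u" and [measurable]: "m \<in> borel_measurable borel"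
    and b: "\<And>x. norm (m x) \<le> M" and z: "\<And>x. norm x \<ge> R \<Longrightarrow> m x = 0"
  shows "integrable lborel (\<lambda>x. u x * m x)"
proof (rule integrableI_bounded)
  have [measurable]: "u \<in> borel_measurable borel" using u by (simp add: Bstar0_borel_def)
  show "(\<lambda>x. u x * m x) \<in> borel_measurable lborel" by measurable
  have M: "M \<ge> 0" by (rule order_trans[OF norm_ge_zero b[of 0]])
  let ?R = "\<bar>R\<bar> + 1"
  have "?R > 0" by simp
  obtain C where C: "\<forall>R>0. (\<integral>\<^sup>+x. ennreal ((norm (u x))\<^sup>2) * indicator (ball 0 R) x \<partial>lborel) \<le> ennreal (1 * R + C)"
    using conjunct2[OF u[unfolded Bstar0_borel_def], THEN spec, THEN mp, OF zero_less_one] by (elim exE conjE)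
  have "(\<integral>\<^sup>+x. ennreal (norm (u x * m x)) \<partial>lborel)
     \<le> (\<integral>\<^sup>+x. ennreal M * (ennreal ((norm (u x))\<^sup>2) * indicator (ball 0 ?R) x + indicator (ball 0 ?R) x) \<partial>lborel)"
  proof (rule nn_integral_mono)
    fix x
    show "ennreal (norm (u x * m x)) \<le> ennreal M * (ennreal ((norm (u x))\<^sup>2) * indicator (ball 0 ?R) x + indicator (ball 0 ?R) x)"
    proof (cases "norm x < ?R")
      case True
      have "0 \<le> (norm (u x) - 1 / 2)\<^sup>2" by simp
      then have "norm (u x) \<le> (norm (u x))\<^sup>2 + 1" by (simp add: power2_eq_square algebra_simps)
      then have "norm (u x) * norm (m x) \<le> ((norm (u x))\<^sup>2 + 1) * M" by (intro mult_mono b) auto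
      then have "ennreal (norm (u x * m x)) \<le> ennreal (M * ((norm (u x))\<^sup>2 + 1))"
        by (intro ennreal_leI) (simp add: norm_mult mult.commute)
      then show ?thesis using True M by (simp add: ennreal_mult)
    next
      case False
      then show ?thesis using z[of x] by simp
    qed
  qed
  also have "\<dots> = ennreal M * ((\<integral>\<^sup>+x. ennreal ((norm (u x))\<^sup>2) * indicator (ball 0 ?R) x \<partial>lborel) + emeasure lborel (ball (0::'a) ?R))"
  proof -
    have 1: "(\<lambda>x. ennreal ((norm (u x))\<^sup>2) * indicator (ball 0 ?R) x) \<in> borel_measurable lborel"
      by (intro borel_measurable_times_ennreal borel_measurable_indicator) auto
    have 2: "indicator (ball 0 ?R) \<in> borel_measurable (lborel :: 'a measure)" by (rule borel_measurable_indicator) auto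
    show ?thesis
      unfolding nn_integral_cmult[OF borel_measurable_add[OF 1 2]] nn_integral_add[OF 1 2]
      by (subst nn_integral_indicator) auto
  qed
  also have "\<dots> \<le> ennreal M * (ennreal (1 * ?R + C) + emeasure lborel (ball (0::'a) ?R))"
    using C[rule_format, OF \<open>?R > 0\<close>] by (intro mult_left_mono add_right_mono) auto
  also have "\<dots> < \<infinity>"
    using emeasure_lborel_ball_finite[of "0::'a" ?R] by (simp add: ennreal_mult_less_top)
  finally show "(\<integral>\<^sup>+x. ennreal (norm (u x * m x)) \<partial>lborel) < \<infinity>" .
qed

lemma integrable_mult_ft:
  assumes H: "integrable lborel H" and g: "integrable lborel g"
  shows "integrable lborel (\<lambda>y. H y * ft g y)"
proof -
  have [measurable]: "H \<in> borel_measurable borel" "g \<in> borel_measurable borel" using H g by auto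
  show ?thesis
    by (rule Bochner_Integration.integrable_bound[OF integrable_mult_left[OF integrable_norm[OF H], of "LINT x|lborel. norm (g x)"]])
       (auto simp: norm_mult abs_mult intro!: mult_left_mono norm_ft_le[THEN order_trans])
qed

lemma tendsto_lborel_bounded_mult:
  fixes w :: "'a::euclidean_space \<Rightarrow> complex"
  assumes w: "integrable lborel w" and [measurable]: "\<And>N. m N \<in> borel_measurable borel"
    and b: "\<And>N x. norm (m N x) \<le> M" and l: "\<And>x. (\<lambda>N. m N x) \<longlonglongrightarrow> m0 x"
  shows "(\<lambda>N. LINT x|lborel. w x * m N x) \<longlonglongrightarrow> (LINT x|lborel. w x * m0 x)"
proof (rule integral_dominated_convergence[where w="\<lambda>x. norm (w x) * M"])
  have [measurable]: "w \<in> borel_measurable borel" using w by auto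
  have [measurable]: "m0 \<in> borel_measurable borel" by (rule borel_measurable_LIMSEQ_metric[OF _ l]) auto
  show "(\<lambda>x. w x * m0 x) \<in> borel_measurable lborel" "(\<lambda>x. w x * m N x) \<in> borel_measurable lborel" for N by measurable
  show "integrable lborel (\<lambda>x. norm (w x) * M)" by (intro integrable_mult_left integrable_norm w)
  show "AE x in lborel. (\<lambda>N. w x * m N x) \<longlonglongrightarrow> w x * m0 x" by (intro AE_I2 tendsto_intros l)
  show "AE x in lborel. norm (w x * m N x) \<le> norm (w x) * M" for N
    by (intro AE_I2) (simp add: norm_mult mult_left_mono b)
qed

lemma cutoff_measurable[measurable]:
  "cutoff R \<in> borel_measurable borel"
  "b \<in> borel_measurable borel \<Longrightarrow> cutoff' b R i \<in> borel_measurable borel"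
proof -
  have [measurable]: "bump \<in> borel_measurable borel" by (rule borel_measurable_continuous_onI[OF continuous_bump(1)])
  have [measurable]: "(\<lambda>x::real^'n. x $ j) \<in> borel_measurable borel" for j
    by (intro borel_measurable_continuous_onI continuous_intros)
  show "cutoff R \<in> borel_measurable borel" unfolding cutoff_def[abs_def] by measurable
  assume [measurable]: "b \<in> borel_measurable borel"
  show "cutoff' b R i \<in> borel_measurable borel" unfolding cutoff'_def[abs_def] by measurable
qed

lemma cutoff_bound:
  fixes x :: "real^'n::finite"
  assumes M: "M \<ge> 1" "\<And>s. \<bar>bump s\<bar> \<le> M"
  shows "\<bar>cutoff R x\<bar> \<le> M ^ CARD('n)" and "(\<And>s. \<bar>b s\<bar> \<le> M) \<Longrightarrow> \<bar>cutoff' b R i x\<bar> \<le> M ^ CARD('n)"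
proof -
  have p: "(\<Prod>j\<in>A. \<bar>bump (x $ j / R)\<bar>) \<le> M ^ card A" for A :: "'n set"
    using prod_mono[of A "\<lambda>j. \<bar>bump (x $ j / R)\<bar>" "\<lambda>_. M"] M by auto
  show "\<bar>cutoff R x\<bar> \<le> M ^ CARD('n)" unfolding cutoff_def abs_prod by (rule p)
  assume b: "\<And>s. \<bar>b s\<bar> \<le> M"
  have "\<bar>cutoff' b R i x\<bar> \<le> M * M ^ card (UNIV - {i})"
    unfolding cutoff'_def abs_mult abs_prod by (intro mult_mono b p) (use M in \<open>auto intro: prod_nonneg\<close>)
  also have "\<dots> = M ^ Suc (card (UNIV - {i}))" by (simp only: power_Suc)
  also have "Suc (card (UNIV - {i})) = CARD('n)" by (rule card_Suc_Diff1) auto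
  finally show "\<bar>cutoff' b R i x\<bar> \<le> M ^ CARD('n)" .
qed

lemma cutoff_zero:
  fixes x :: "real^'n::finite" and R :: real
  assumes R: "R > 0" and x: "norm x \<ge> CARD('n) * R"
  shows "cutoff R x = 0" and "(\<And>s. \<bar>s\<bar> \<ge> 1 \<Longrightarrow> b s = 0) \<Longrightarrow> cutoff' b R i x = 0"
proof -
  have "\<exists>j. \<bar>x $ j\<bar> \<ge> R"
  proof (rule ccontr)
    assume "\<not> ?thesis"
    then have *: "\<And>j. \<bar>x $ j\<bar> < R" by (meson not_le)
    have "norm x \<le> (\<Sum>j\<in>UNIV. \<bar>x $ j\<bar>)" by (rule norm_le_l1_cart)
    also have "\<dots> < (\<Sum>j\<in>(UNIV::'n set). R)" using * by (intro sum_strict_mono) auto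
    finally show False using x by simp
  qed
  then obtain j where "\<bar>x $ j\<bar> \<ge> R" by blast
  then have j: "\<bar>x $ j / R\<bar> \<ge> 1" using R by (simp add: abs_divide)
  show "cutoff R x = 0" unfolding cutoff_def using bump_zero(1)[OF j] by (intro prod_zero) auto
  assume b: "\<And>s. \<bar>s\<bar> \<ge> 1 \<Longrightarrow> b s = 0"
  show "cutoff' b R i x = 0"
  proof (cases "j = i")
    case True
    then show ?thesis using b[OF j] by (simp add: cutoff'_def)
  next
    case False
    then have "(\<Prod>j\<in>UNIV - {i}. bump (x $ j / R)) = 0" using bump_zero(1)[OF j] by (intro prod_zero) auto
    then show ?thesis by (simp add: cutoff'_def)
  qed
qed

text \<open>The truncated plane-wave identity is integrated against \<open>H\<close>. Since
  \<open>u\<close> itself has no transform, the transforms are moved onto \<open>H\<close> first and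
  only then is R sent to infinity; the commutator terms vanish by dominated convergence.\<close>

lemma helmholtz_pairing:
  fixes u f :: "real^'n::finite \<Rightarrow> complex"
  assumes w: "weak_helm lam u f" and u: "Bstar0_borel u" and f: "integrable lborel f" and H: "gauss_class H"
  shows "(LINT x|lborel. u x * ft (\<lambda>y. complex_of_real ((norm y)\<^sup>2 - lam) * H y) x) = (LINT x|lborel. f x * ft H x)"
proof -
  have [measurable]: "u \<in> borel_measurable borel" "f \<in> borel_measurable borel" "H \<in> borel_measurable borel"
    using u f H by (auto simp: Bstar0_borel_def gauss_class_def)
  have [measurable]: "bump1 \<in> borel_measurable borel" "bump2 \<in> borel_measurable borel"
    by (intro borel_measurable_continuous_onI continuous_bump)+
  obtain M where M: "M \<ge> 1" "\<And>s. \<bar>bump s\<bar> \<le> M" "\<And>s. \<bar>bump1 s\<bar> \<le> M" "\<And>s. \<bar>bump2 s\<bar> \<le> M"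
    by (rule bump_bounded, rule that)
  let ?M = "M ^ CARD('n)"
  let ?s = "\<lambda>y::real^'n. complex_of_real ((norm y)\<^sup>2 - lam)"
  let ?sH = "\<lambda>y. ?s y * H y"
  let ?K = "\<lambda>i y. complex_of_real (y $ i) * H y"
  have sH: "gauss_class ?sH" by (intro gauss_class_mult poly_class_norm_sq H)
  have KH: "gauss_class (?K i)" for i
    using gauss_class_mult[OF poly_class_inner[of "axis i 1"] H] by (simp add: inner_axis)
  note Hi = gauss_class_integrable[OF H] gauss_class_integrable[OF sH] gauss_class_integrable[OF KH]
  define R where "R N = real (Suc N)" for N
  have R: "R N > 0" for N by (simp add: R_def)
  have R1: "R N \<ge> 1" for N by (simp add: R_def)
  have Rinv: "(\<lambda>N. 1 / R N) \<longlonglongrightarrow> 0" unfolding R_def using LIMSEQ_Suc[OF lim_1_over_n, where 'a1=real] by simp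
  let ?c = "\<lambda>N x. complex_of_real (cutoff (R N) x)"
  let ?c1 = "\<lambda>N i x. complex_of_real (cutoff' bump1 (R N) i x)"
  let ?c2 = "\<lambda>N i x. complex_of_real (cutoff' bump2 (R N) i x)"
  have ci: "integrable lborel (\<lambda>x. u x * ?c N x)" for N
    by (rule Bstar0_borel_mult_integrable[OF u, of _ ?M "CARD('n) * R N"])
       (auto simp: cutoff_bound[OF M(1,2)] cutoff_zero[OF R])
  have c1i: "integrable lborel (\<lambda>x. u x * ?c1 N i x)" for N i
    by (rule Bstar0_borel_mult_integrable[OF u, of _ ?M "CARD('n) * R N"])
       (auto simp: cutoff_bound[OF M(1,2)] cutoff_zero[OF R] M bump_zero)
  have c2i: "integrable lborel (\<lambda>x. u x * ?c2 N i x)" for N i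
    by (rule Bstar0_borel_mult_integrable[OF u, of _ ?M "CARD('n) * R N"])
       (auto simp: cutoff_bound[OF M(1,2)] cutoff_zero[OF R] M bump_zero)
  have fi: "integrable lborel (\<lambda>x. f x * ?c N x)" for N
    by (rule Bochner_Integration.integrable_bound[OF integrable_mult_left[OF integrable_norm[OF f], of ?M]])
       (use M in \<open>auto simp: norm_mult abs_mult intro!: mult_left_mono cutoff_bound[THEN order_trans]\<close>)
  have main: "?s y * ft (\<lambda>x. u x * ?c N x) y - (\<Sum>i\<in>UNIV. 2 * \<i> * (y $ i) / R N * ft (\<lambda>x. u x * ?c1 N i x) y)
      - (\<Sum>i\<in>UNIV. ft (\<lambda>x. u x * ?c2 N i x) y / (R N)\<^sup>2) = ft (\<lambda>x. f x * ?c N x) y" for N y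
  proof -
    have "?s y * ft (\<lambda>x. u x * ?c N x) y - (\<Sum>i\<in>UNIV. 2 * \<i> * (y $ i) / R N * ft (\<lambda>x. u x * ?c1 N i x) y)
      - (\<Sum>i\<in>UNIV. ft (\<lambda>x. u x * ?c2 N i x) y / (R N)\<^sup>2)
      = (LINT x|lborel. ?s y * ((u x * ?c N x) * cis (x \<bullet> y)) - (\<Sum>i\<in>UNIV. 2 * \<i> * (y $ i) / R N * ((u x * ?c1 N i x) * cis (x \<bullet> y)))
      - (\<Sum>i\<in>UNIV. ((u x * ?c2 N i x) * cis (x \<bullet> y)) / (R N)\<^sup>2))"
    proof -
      have 1: "integrable lborel (\<lambda>x. (u x * ?c N x) * cis (x \<bullet> y))" by (rule integrable_ft_kernel[OF ci])
      have 2: "integrable lborel (\<lambda>x. (u x * ?c1 N i x) * cis (x \<bullet> y))" for i by (rule integrable_ft_kernel[OF c1i])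
      have 3: "integrable lborel (\<lambda>x. (u x * ?c2 N i x) * cis (x \<bullet> y))" for i by (rule integrable_ft_kernel[OF c2i])
      show ?thesis unfolding ft_def
        by (subst Bochner_Integration.integral_diff, intro Bochner_Integration.integrable_diff Bochner_Integration.integrable_sum integrable_mult_right 1 2,
            intro Bochner_Integration.integrable_sum integrable_divide 3,
            subst Bochner_Integration.integral_diff, intro integrable_mult_right 1, intro Bochner_Integration.integrable_sum integrable_mult_right 2,
            subst Bochner_Integration.integral_sum, intro integrable_mult_right 2,
            subst Bochner_Integration.integral_sum, intro integrable_divide 3) simp
    qed
    also have "\<dots> = (LINT x|lborel. u x * (?s y * ?c N x
       - (\<Sum>i\<in>UNIV. 2 * \<i> * (y $ i) / R N * ?c1 N i x) - (\<Sum>i\<in>UNIV. ?c2 N i x) / (R N)\<^sup>2) * cis (x \<bullet> y))"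
      by (intro Bochner_Integration.integral_cong refl)
         (simp add: algebra_simps sum_distrib_left sum_distrib_right sum_divide_distrib)
    also have "\<dots> = (LINT x|lborel. f x * (?c N x * cis (x \<bullet> y)))"
      by (rule weak_helm_exp[OF w R])
    finally show ?thesis by (simp add: ft_def mult.assoc)
  qed
  \<comment> \<open>The plane-wave identity times \<open>H y\<close>, integrated in
    \<open>y\<close>, with every transform moved onto \<open>H\<close> by the multiplication
    formula.\<close>
  have id: "(LINT x|lborel. (u x * ft ?sH x) * ?c N x) - (\<Sum>i\<in>UNIV. 2 * \<i> * (LINT x|lborel. (u x * ft (?K i) x) * (?c1 N i x / R N)))
      - (\<Sum>i\<in>UNIV. (LINT x|lborel. (u x * ft H x) * (?c2 N i x / (R N)\<^sup>2))) = (LINT x|lborel. (f x * ft H x) * ?c N x)" for N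
  proof -
    have A: "(LINT x|lborel. (u x * ft ?sH x) * ?c N x) = (LINT y|lborel. ?sH y * ft (\<lambda>x. u x * ?c N x) y)"
      by (subst ft_mult[OF Hi(2) ci, symmetric]) (simp add: mult_ac)
    have B: "2 * \<i> * (LINT x|lborel. (u x * ft (?K i) x) * (?c1 N i x / R N)) = (LINT y|lborel. 2 * \<i> / R N * (?K i y * ft (\<lambda>x. u x * ?c1 N i x) y))" for i
    proof -
      have "(LINT y|lborel. 2 * \<i> / R N * (?K i y * ft (\<lambda>x. u x * ?c1 N i x) y)) = 2 * \<i> / R N * (LINT x|lborel. (u x * ?c1 N i x) * ft (?K i) x)"
        by (subst ft_mult[OF Hi(3) c1i]) simp
      also have "\<dots> = (LINT x|lborel. 2 * \<i> * ((u x * ft (?K i) x) * (?c1 N i x / R N)))"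
        by (subst integral_mult_right_zero[symmetric]) (simp add: mult_ac)
      finally show ?thesis unfolding integral_mult_right_zero by (rule sym)
    qed
    have C: "(LINT x|lborel. (u x * ft H x) * (?c2 N i x / (R N)\<^sup>2)) = (LINT y|lborel. (H y * ft (\<lambda>x. u x * ?c2 N i x) y) / (R N)\<^sup>2)" for i
    proof -
      have "(LINT y|lborel. (H y * ft (\<lambda>x. u x * ?c2 N i x) y) / (R N)\<^sup>2) = (LINT x|lborel. (u x * ?c2 N i x) * ft H x) / (R N)\<^sup>2"
        by (subst ft_mult[OF Hi(1) c2i]) simp
      also have "\<dots> = (LINT x|lborel. (u x * ft H x) * (?c2 N i x / (R N)\<^sup>2))"
        by (subst integral_divide_zero[symmetric]) (simp add: mult_ac)
      finally show ?thesis unfolding integral_divide_zero by (rule sym)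
    qed
    have D: "(LINT x|lborel. (f x * ft H x) * ?c N x) = (LINT y|lborel. H y * ft (\<lambda>x. f x * ?c N x) y)"
      by (subst ft_mult[OF Hi(1) fi, symmetric]) (simp add: mult_ac)
    have 1: "integrable lborel (\<lambda>y. ?sH y * ft (\<lambda>x. u x * ?c N x) y)" by (rule integrable_mult_ft[OF Hi(2) ci])
    have 2: "integrable lborel (\<lambda>y. ?K i y * ft (\<lambda>x. u x * ?c1 N i x) y)" for i by (rule integrable_mult_ft[OF Hi(3) c1i])
    have 3: "integrable lborel (\<lambda>y. H y * ft (\<lambda>x. u x * ?c2 N i x) y)" for i by (rule integrable_mult_ft[OF Hi(1) c2i])
    have "(LINT y|lborel. ?sH y * ft (\<lambda>x. u x * ?c N x) y) - (\<Sum>i\<in>UNIV. (LINT y|lborel. 2 * \<i> / R N * (?K i y * ft (\<lambda>x. u x * ?c1 N i x) y)))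
       - (\<Sum>i\<in>UNIV. (LINT y|lborel. (H y * ft (\<lambda>x. u x * ?c2 N i x) y) / (R N)\<^sup>2))
      = (LINT y|lborel. ?sH y * ft (\<lambda>x. u x * ?c N x) y - (\<Sum>i\<in>UNIV. 2 * \<i> / R N * (?K i y * ft (\<lambda>x. u x * ?c1 N i x) y))
       - (\<Sum>i\<in>UNIV. (H y * ft (\<lambda>x. u x * ?c2 N i x) y) / (R N)\<^sup>2))"
      by (subst Bochner_Integration.integral_diff, intro Bochner_Integration.integrable_diff Bochner_Integration.integrable_sum integrable_mult_right 1 2,
            intro Bochner_Integration.integrable_sum integrable_divide 3,
            subst Bochner_Integration.integral_diff, intro 1, intro Bochner_Integration.integrable_sum integrable_mult_right 2,
            subst Bochner_Integration.integral_sum, intro integrable_mult_right 2,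
            subst Bochner_Integration.integral_sum, intro integrable_divide 3) simp
    also have "\<dots> = (LINT y|lborel. H y * ft (\<lambda>x. f x * ?c N x) y)"
      unfolding main[symmetric]
      by (intro Bochner_Integration.integral_cong refl)
         (simp add: algebra_simps sum_distrib_left)
    finally show ?thesis unfolding A B C D .
  qed
  \<comment> \<open>The bump is not normalised, so the truncation tends to this positive constant,
    which cancels at the end.\<close>
  let ?b = "complex_of_real (bump 0 ^ CARD('n))"
  have cl: "(\<lambda>N. ?c N x) \<longlonglongrightarrow> ?b" for x :: "real^'n"
  proof -
    have "isCont bump 0" using continuous_bump(1) by (simp add: continuous_on_eq_continuous_at)
    moreover have "(\<lambda>N. x $ j / R N) \<longlonglongrightarrow> 0" for j
      using tendsto_mult[OF tendsto_const[of "x $ j"] Rinv] by simp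
    ultimately have *: "(\<lambda>N. bump (x $ j / R N)) \<longlonglongrightarrow> bump 0" for j
      by (rule isCont_tendsto_compose)
    have "(\<lambda>N. cutoff (R N) x) \<longlonglongrightarrow> (\<Prod>j\<in>(UNIV::'n set). bump 0)"
      unfolding cutoff_def by (intro tendsto_prod *)
    then show ?thesis by (intro tendsto_of_real) simp
  qed
  have L1: "(\<lambda>N. LINT x|lborel. (u x * ft ?sH x) * ?c N x) \<longlonglongrightarrow> (LINT x|lborel. (u x * ft ?sH x) * ?b)"
    by (rule tendsto_lborel_bounded_mult[OF gauss_class_pairing_integrable[OF u sH], of _ ?M, OF _ _ cl])
       (auto simp: cutoff_bound[OF M(1,2)])
  have L2: "(\<lambda>N. LINT x|lborel. (f x * ft H x) * ?c N x) \<longlonglongrightarrow> (LINT x|lborel. (f x * ft H x) * ?b)"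
    by (rule tendsto_lborel_bounded_mult[OF integrable_mult_ft[OF f Hi(1)], of _ ?M, OF _ _ cl])
       (auto simp: cutoff_bound[OF M(1,2)])
  have small: "\<bar>c\<bar> / R N \<le> ?M" if "\<bar>c\<bar> \<le> ?M" for c N
    using that R1[of N] by (smt (verit) abs_ge_zero divide_le_eq_1 frac_le div_by_1)
  have Z: "(\<lambda>N. c N / complex_of_real (R N)) \<longlonglongrightarrow> 0" if c: "\<And>N. norm (c N) \<le> ?M" for c
  proof (rule Lim_null_comparison)
    show "(\<lambda>N. ?M * (1 / R N)) \<longlonglongrightarrow> 0" using tendsto_mult[OF tendsto_const[of ?M] Rinv] by simp
    show "\<forall>\<^sub>F N in sequentially. norm (c N / complex_of_real (R N)) \<le> ?M * (1 / R N)"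
      using c R by (intro always_eventually allI) (simp add: norm_divide divide_right_mono less_imp_le)
  qed
  have L3: "(\<lambda>N. LINT x|lborel. (u x * ft (?K i) x) * (?c1 N i x / R N)) \<longlonglongrightarrow> (LINT x|lborel. (u x * ft (?K i) x) * 0)" for i
  proof (rule tendsto_lborel_bounded_mult[OF gauss_class_pairing_integrable[OF u KH], of _ ?M])
    show "norm (?c1 N i x / R N) \<le> ?M" for N x
      using small[OF cutoff_bound(2)[OF M(1,2,3)]] R[of N] by (simp add: norm_divide)
    show "(\<lambda>N. ?c1 N i x / R N) \<longlonglongrightarrow> 0" for x
      by (rule Z) (simp add: cutoff_bound(2)[OF M(1,2,3)])
  qed measurable
  have L4: "(\<lambda>N. LINT x|lborel. (u x * ft H x) * (?c2 N i x / (R N)\<^sup>2)) \<longlonglongrightarrow> (LINT x|lborel. (u x * ft H x) * 0)" for i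
  proof (rule tendsto_lborel_bounded_mult[OF gauss_class_pairing_integrable[OF u H], of _ ?M])
    have s: "norm (?c2 N i x / R N) \<le> ?M" for N x
      using small[OF cutoff_bound(2)[OF M(1,2,4)]] R[of N] by (simp add: norm_divide)
    have e: "?c2 N i x / (R N)\<^sup>2 = (?c2 N i x / R N) / complex_of_real (R N)" for N x by (simp add: power2_eq_square)
    show "norm (?c2 N i x / (R N)\<^sup>2) \<le> ?M" for N x
    proof -
      have "norm (?c2 N i x / (R N)\<^sup>2) = \<bar>norm (?c2 N i x / R N)\<bar> / R N" unfolding e
        by (simp only: norm_divide norm_of_real abs_of_pos[OF R] abs_norm_cancel abs_divide abs_abs)
      also have "\<dots> \<le> ?M" by (rule small) (use s in simp)
      finally show ?thesis .
    qed
    show "(\<lambda>N. ?c2 N i x / (R N)\<^sup>2) \<longlonglongrightarrow> 0" for x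
      unfolding e by (rule Z) (rule s)
  qed measurable
  have L3': "(\<lambda>N. LINT x|lborel. (u x * ft (?K i) x) * (?c1 N i x / R N)) \<longlonglongrightarrow> 0" for i
    using L3[of i] by (simp only: mult_zero_right Bochner_Integration.integral_zero)
  have L4': "(\<lambda>N. LINT x|lborel. (u x * ft H x) * (?c2 N i x / (R N)\<^sup>2)) \<longlonglongrightarrow> 0" for i
    using L4[of i] by (simp only: mult_zero_right Bochner_Integration.integral_zero)
  have "(LINT x|lborel. (u x * ft ?sH x) * ?b) - (\<Sum>i\<in>(UNIV::'n set). 2 * \<i> * 0) - (\<Sum>i\<in>(UNIV::'n set). 0) = (LINT x|lborel. (f x * ft H x) * ?b)"
    by (rule LIMSEQ_unique[OF _ L2]) (unfold id[symmetric], intro tendsto_intros L1 L3' L4')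
  then show ?thesis using bump_pos by simp
qed

section \<open>The Fourier transform of the source vanishes on the sphere\<close>

definition clamp1 :: "real \<Rightarrow> real" where "clamp1 t = max (-1) (min 1 t)"

lemma clamp1_bound: "\<bar>clamp1 t\<bar> \<le> 1" and clamp1_lipschitz: "\<bar>clamp1 s - clamp1 t\<bar> \<le> \<bar>s - t\<bar>"
  by (auto simp: clamp1_def max_def min_def abs_if)

lemma clamp1_ge:
  assumes "\<bar>t\<bar> \<ge> 1" shows "(clamp1 t)\<^sup>2 = 1"
proof -
  have "t \<ge> 1 \<or> t \<le> -1" using assms by linarith
  then show ?thesis by (auto simp: clamp1_def)
qed

text \<open>The profile 1 - t^2 on [-1, 1], extended by 0. Writing it through \<open>clamp1\<close>
  reduces the Lipschitz bounds to factoring differences of powers.\<close>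

definition shell :: "real \<Rightarrow> real" where "shell t = 1 - (clamp1 t)\<^sup>2"
text \<open>This is t \<open>shell\<close> t: the symbol times a shell cutoff of width \<epsilon> is
  \<epsilon> times a cutoff of this second kind.\<close>

definition shell1 :: "real \<Rightarrow> real" where "shell1 t = clamp1 t - (clamp1 t) ^ 3"

lemma shell_props:
  "\<bar>shell t\<bar> \<le> 1" "\<bar>shell s - shell t\<bar> \<le> 4 * \<bar>s - t\<bar>" "\<bar>t\<bar> \<ge> 1 \<Longrightarrow> shell t = 0" "0 \<le> shell t"
  "\<bar>shell1 t\<bar> \<le> 1" "\<bar>shell1 s - shell1 t\<bar> \<le> 4 * \<bar>s - t\<bar>" "\<bar>t\<bar> \<ge> 1 \<Longrightarrow> shell1 t = 0" "shell1 t = t * shell t"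
proof -
  let ?c = clamp1
  have sq: "(?c t)\<^sup>2 \<le> 1" for t using clamp1_bound[of t] by (simp add: abs_square_le_1)
  show s0: "0 \<le> shell t" for t using sq by (simp add: shell_def)
  show s1: "\<bar>shell t\<bar> \<le> 1" for t using s0[of t] by (simp add: shell_def)
  have s1c: "shell1 t = ?c t * shell t" for t by (simp add: shell_def shell1_def power2_eq_square power3_eq_cube algebra_simps)
  have "\<bar>?c t\<bar> * \<bar>shell t\<bar> \<le> 1 * 1" by (intro mult_mono clamp1_bound s1) auto
  then show "\<bar>shell1 t\<bar> \<le> 1" by (simp add: s1c abs_mult)
  show "shell t = 0" "shell1 t = 0" if "\<bar>t\<bar> \<ge> 1" using clamp1_ge[OF that] by (auto simp: shell_def s1c)
  show "shell1 t = t * shell t"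
  proof (cases "\<bar>t\<bar> \<ge> 1")
    case True
    then show ?thesis using clamp1_ge[OF True] by (simp add: s1c shell_def)
  next
    case False
    then have "?c t = t" by (auto simp: clamp1_def)
    then show ?thesis by (simp add: s1c)
  qed
  have "\<bar>shell s - shell t\<bar> = \<bar>?c s - ?c t\<bar> * \<bar>?c s + ?c t\<bar>"
    unfolding abs_mult[symmetric] by (simp add: shell_def power2_eq_square algebra_simps abs_minus_commute)
  also have "\<dots> \<le> \<bar>s - t\<bar> * 2"
    using clamp1_bound[of s] clamp1_bound[of t] abs_triangle_ineq[of "?c s" "?c t"] by (intro mult_mono clamp1_lipschitz) auto
  finally show "\<bar>shell s - shell t\<bar> \<le> 4 * \<bar>s - t\<bar>" by simp
  have "\<bar>shell1 s - shell1 t\<bar> = \<bar>?c s - ?c t\<bar> * \<bar>1 - ((?c s)\<^sup>2 + ?c s * ?c t + (?c t)\<^sup>2)\<bar>"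
    unfolding abs_mult[symmetric] by (simp add: shell1_def power2_eq_square power3_eq_cube algebra_simps)
  also have "\<dots> \<le> \<bar>s - t\<bar> * 4"
  proof (intro mult_mono clamp1_lipschitz)
    have "\<bar>?c s * ?c t\<bar> \<le> 1 * 1" unfolding abs_mult by (intro mult_mono clamp1_bound) auto
    then have "?c s * ?c t \<le> 1" "- 1 \<le> ?c s * ?c t" by linarith+
    then show "\<bar>1 - ((?c s)\<^sup>2 + ?c s * ?c t + (?c t)\<^sup>2)\<bar> \<le> 4"
      using sq[of s] sq[of t] zero_le_power2[of "?c s"] zero_le_power2[of "?c t"] unfolding abs_le_iff by linarith
  qed auto
  finally show "\<bar>shell1 s - shell1 t\<bar> \<le> 4 * \<bar>s - t\<bar>" by simp
qed

text \<open>This is (1 - \<open>shell\<close> t) / t with the singularity at 0 removed, a Lipschitz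
  inverse of the symbol away from the shell.\<close>

definition reg_inverse :: "real \<Rightarrow> real" where "reg_inverse t = (if \<bar>t\<bar> \<le> 1 then t else 1 / t)"

lemma reg_inverse_shell: "t * reg_inverse t = 1 - shell t"
proof (cases "\<bar>t\<bar> \<le> 1")
  case True
  then have "clamp1 t = t" by (auto simp: clamp1_def)
  then show ?thesis using True by (simp add: reg_inverse_def shell_def power2_eq_square)
next
  case False
  then show ?thesis using shell_props(3)[of t] by (auto simp: reg_inverse_def)
qed

lemma reg_inverse_bound: "\<bar>reg_inverse t\<bar> \<le> 1"
  by (auto simp: reg_inverse_def abs_divide)

text \<open>The Lipschitz bound with the arguments on different sides of the threshold; it comes
  from t + 1/t \<ge> 2.\<close>

lemma reg_inverse_mixed:
  fixes s t :: real
  assumes "\<bar>s\<bar> \<le> 1" "t > 1" shows "\<bar>s - 1 / t\<bar> \<le> t - s"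
proof -
  have "0 \<le> (t - 1)\<^sup>2 / t" using assms by simp
  also have "(t - 1)\<^sup>2 / t = t + 1 / t - 2" using assms by (simp add: power2_eq_square field_simps)
  finally have "2 \<le> t + 1 / t" by simp
  moreover have "1 / t \<le> t" using assms by (simp add: divide_le_eq) (smt (verit) mult_le_cancel_left1)
  ultimately show ?thesis using assms by (auto simp: abs_le_iff)
qed

lemma reg_inverse_lipschitz: "\<bar>reg_inverse s - reg_inverse t\<bar> \<le> 1 * \<bar>s - t\<bar>"
proof -
  have m: "\<bar>reg_inverse s - reg_inverse t\<bar> \<le> \<bar>s - t\<bar>" if "\<bar>s\<bar> \<le> 1" "\<bar>t\<bar> > 1" for s t
  proof (cases "t > 0")
    case True
    then show ?thesis using reg_inverse_mixed[of s t] that by (auto simp: reg_inverse_def)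
  next
    case False
    then show ?thesis using reg_inverse_mixed[of "-s" "-t"] that by (auto simp: reg_inverse_def abs_minus_commute)
  qed
  show ?thesis
  proof (cases "\<bar>s\<bar> \<le> 1")
    case True
    then show ?thesis using m[of s t] by (cases "\<bar>t\<bar> \<le> 1") (auto simp: reg_inverse_def)
  next
    case s: False
    show ?thesis
    proof (cases "\<bar>t\<bar> \<le> 1")
      case True
      then show ?thesis using m[of t s] s by (auto simp: abs_minus_commute)
    next
      case False
      have "1 * 1 \<le> \<bar>s\<bar> * \<bar>t\<bar>" using s False by (intro mult_mono) auto
      then have p: "1 \<le> \<bar>s * t\<bar>" by (simp add: abs_mult)
      have "reg_inverse s - reg_inverse t = (t - s) / (s * t)" using s False by (auto simp: reg_inverse_def field_simps)
      then have "\<bar>reg_inverse s - reg_inverse t\<bar> = \<bar>s - t\<bar> / \<bar>s * t\<bar>" by (simp add: abs_divide abs_minus_commute)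
      also have "\<dots> \<le> \<bar>s - t\<bar> / 1" using p by (intro divide_left_mono) auto
      finally show ?thesis by simp
    qed
  qed
qed

lemma ft_lipschitz:
  fixes f :: "'a::euclidean_space \<Rightarrow> complex"
  assumes f: "integrable lborel f" and f1: "integrable lborel (\<lambda>x. norm x * norm (f x))"
  shows "norm (ft f a - ft f b) \<le> (LINT x|lborel. norm x * norm (f x)) * norm (a - b)"
proof -
  have "ft f a - ft f b = (LINT x|lborel. f x * cis (x \<bullet> a) - f x * cis (x \<bullet> b))"
    unfolding ft_def by (subst Bochner_Integration.integral_diff) (auto intro: integrable_ft_kernel f)
  then have "norm (ft f a - ft f b) \<le> (LINT x|lborel. norm (f x * cis (x \<bullet> a) - f x * cis (x \<bullet> b)))"
    by (simp only: integral_norm_bound)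
  also have "\<dots> \<le> (LINT x|lborel. norm x * norm (f x) * norm (a - b))"
  proof (rule Bochner_Integration.integral_mono)
    show "integrable lborel (\<lambda>x. norm (f x * cis (x \<bullet> a) - f x * cis (x \<bullet> b)))"
      by (intro integrable_norm Bochner_Integration.integrable_diff integrable_ft_kernel f)
    show "integrable lborel (\<lambda>x. norm x * norm (f x) * norm (a - b))" by (intro integrable_mult_left f1)
    fix x
    have "norm (f x * cis (x \<bullet> a) - f x * cis (x \<bullet> b)) = norm (f x) * norm (cis (x \<bullet> a) - cis (x \<bullet> b))"
      by (simp flip: norm_mult right_diff_distrib)
    also have "\<dots> \<le> norm (f x) * (norm x * norm (a - b))"
    proof (rule mult_left_mono)
      have "norm (cis (x \<bullet> a) - cis (x \<bullet> b)) \<le> \<bar>x \<bullet> (a - b)\<bar>"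
        using norm_cis_diff[of "x \<bullet> a" "x \<bullet> b"] by (simp add: inner_diff_right)
      also have "\<dots> \<le> norm x * norm (a - b)" by (rule Cauchy_Schwarz_ineq2)
      finally show "norm (cis (x \<bullet> a) - cis (x \<bullet> b)) \<le> norm x * norm (a - b)" .
    qed auto
    finally show "norm (f x * cis (x \<bullet> a) - f x * cis (x \<bullet> b)) \<le> norm x * norm (f x) * norm (a - b)" by (simp add: mult_ac)
  qed
  finally show ?thesis by simp
qed

text \<open>The outer half of the shell inside a narrow cone about \<omega> contains the difference
  of two dilates of one open set \<open>C\<close>. Volumes scale with the n-th power, and a^n - b^n
  is at least b^(n-1) (a - b), which is linear in t.\<close>

lemma shell_cone_measure:
  fixes \<omega> :: "'a::euclidean_space"
  assumes lam: "lam > 0" and w: "norm \<omega> = 1" and r: "\<rho> > 0"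
  obtains c0 t0 where "c0 > 0" "t0 > 0"
    "\<And>t. 0 < t \<Longrightarrow> t < t0 \<Longrightarrow> measure lborel {y. \<bar>(norm y)\<^sup>2 - lam\<bar> \<le> t \<and> norm (y - sqrt lam *\<^sub>R \<omega>) \<le> \<rho>} \<ge> c0 * t"
proof -
  define b where "b = sqrt lam"
  have b: "b > 0" using lam by (simp add: b_def)
  \<comment> \<open>With norms at most 2 b the angular deviation is at most \<rho>/2, which leaves
    \<rho>/2 for the radial one.\<close>
  define \<eta> where "\<eta> = \<rho> / (4 * b)"
  have eta: "\<eta> > 0" using r b by (simp add: \<eta>_def)
  \<comment> \<open>A truncated open cone about \<omega>; it contains \<omega>/2, hence a ball, and
    has positive measure.\<close>
  define C where "C = {y::'a. norm (y - norm y *\<^sub>R \<omega>) < \<eta> * norm y \<and> norm y < 1}"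
  have Co: "open C" unfolding C_def by (intro open_Collect_conj open_Collect_less continuous_intros)
  have CB: "C \<subseteq> ball 0 1" by (auto simp: C_def)
  have Cl: "C \<in> lmeasurable" by (rule lmeasurable_open[OF bounded_subset[OF bounded_ball CB] Co])
  have "(1/2) *\<^sub>R \<omega> \<in> C" using w eta by (simp add: C_def)
  then obtain e where e: "e > 0" "ball ((1/2) *\<^sub>R \<omega>) e \<subseteq> C" using Co openE by blast
  have mC: "measure lebesgue C > 0"
  proof -
    have "0 < measure lborel (ball ((1/2) *\<^sub>R \<omega>) e)" by (rule content_ball_pos[OF e(1)])
    also have "\<dots> = measure lebesgue (ball ((1/2) *\<^sub>R \<omega>) e)" by simp
    also have "\<dots> \<le> measure lebesgue C" by (intro measure_mono_fmeasurable e Cl) auto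
    finally show ?thesis .
  qed
  let ?n = "DIM('a)"
  define c0 where "c0 = measure lebesgue C * (b ^ (?n - 1) / (3 * b))"
  \<comment> \<open>The first bound gives a \<le> 2 b, the second a - b < \<rho>/2.\<close>
  define t0 where "t0 = min lam (\<rho> * b / 2)"
  show thesis
  proof (rule that[of c0 t0])
    show "c0 > 0" "t0 > 0" using mC b lam r by (auto simp: c0_def t0_def)
    fix t assume t: "0 < t" "t < t0"
    define a where "a = sqrt (lam + t)"
    have ab: "b < a" "a \<le> 2 * b"
    proof -
      show "b < a" using t by (simp add: a_def b_def)
      have "a \<le> sqrt (4 * lam)" unfolding a_def using t by (intro real_sqrt_le_mono) (auto simp: t0_def)
      then show "a \<le> 2 * b" by (simp add: b_def real_sqrt_mult)
    qed
    have dab: "(a - b) * (a + b) = t" using lam t by (simp add: a_def b_def algebra_simps flip: power2_eq_square)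
    have "(a - b) * b \<le> (a - b) * (a + b)" using ab b by (intro mult_left_mono) auto
    also have "\<dots> < \<rho> * b / 2" using dab t by (simp add: t0_def)
    finally have "(a - b) * b < \<rho> * b / 2" .
    have abr: "a - b < \<rho> / 2" proof -
      from \<open>(a - b) * b < \<rho> * b / 2\<close> have "(a - b) * b < (\<rho> / 2) * b" by simp
      then show ?thesis by (simp only: mult_less_cancel_right_pos[OF b])
    qed
    let ?S = "{y. \<bar>(norm y)\<^sup>2 - lam\<bar> \<le> t \<and> norm (y - sqrt lam *\<^sub>R \<omega>) \<le> \<rho>}"
    let ?aC = "(\<lambda>x. a *\<^sub>R x + 0) ` C" and ?bC = "(\<lambda>x. b *\<^sub>R x + 0) ` C"
    have meas: "measure lebesgue ((\<lambda>x. r *\<^sub>R x + 0) ` C) = r ^ ?n * measure lebesgue C" "(\<lambda>x. r *\<^sub>R x + 0) ` C \<in> lmeasurable" if "r > 0" for r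
    proof -
      have "open ((\<lambda>x. 0 + r *\<^sub>R x) ` C)" using that by (intro open_affinity Co) auto
      moreover have "bounded ((\<lambda>x. r *\<^sub>R x) ` C)" by (intro bounded_scaling bounded_subset[OF bounded_ball CB])
      ultimately show "(\<lambda>x. r *\<^sub>R x + 0) ` C \<in> lmeasurable" by (intro lmeasurable_open) auto
      show "measure lebesgue ((\<lambda>x. r *\<^sub>R x + 0) ` C) = r ^ ?n * measure lebesgue C"
        unfolding measure_def using emeasure_lebesgue_affine[of r 0 C] that by (simp add: enn2real_mult add.commute)
    qed
    have sub: "?aC - ?bC \<subseteq> ?S"
    proof
      fix y assume "y \<in> ?aC - ?bC"
      then obtain z where z: "z \<in> C" "y = a *\<^sub>R z" and nb: "y \<notin> ?bC" by auto
      have a0: "a > 0" using ab b by simp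
      have cone: "norm (y - norm y *\<^sub>R \<omega>) < \<eta> * norm y"
      proof -
        have "y - norm y *\<^sub>R \<omega> = a *\<^sub>R (z - norm z *\<^sub>R \<omega>)" using a0 by (simp add: z algebra_simps)
        then have "norm (y - norm y *\<^sub>R \<omega>) = a * norm (z - norm z *\<^sub>R \<omega>)" using a0 by simp
        also have "\<dots> < a * (\<eta> * norm z)" using z a0 by (intro mult_strict_left_mono) (auto simp: C_def)
        also have "\<dots> = \<eta> * norm y" using a0 by (simp add: z)
        finally show ?thesis .
      qed
      have ya: "norm y < a" using z a0 by (simp add: C_def)
      have yb: "b \<le> norm y"
      proof (rule ccontr)
        assume "\<not> b \<le> norm y"
        then have yb: "norm y < b" by simp
        have "y - norm y *\<^sub>R \<omega> = b *\<^sub>R ((1/b) *\<^sub>R y - norm ((1/b) *\<^sub>R y) *\<^sub>R \<omega>)" using b by (simp add: algebra_simps)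
        then have "norm (y - norm y *\<^sub>R \<omega>) = b * norm ((1/b) *\<^sub>R y - norm ((1/b) *\<^sub>R y) *\<^sub>R \<omega>)" using b by (metis abs_of_pos norm_scaleR)
        then have "b * norm ((1/b) *\<^sub>R y - norm ((1/b) *\<^sub>R y) *\<^sub>R \<omega>) < b * (\<eta> * norm ((1/b) *\<^sub>R y))" using cone b by simp
        from mult_less_cancel_left_pos[OF b, THEN iffD1, OF this]
        have "(1/b) *\<^sub>R y \<in> C" using b yb unfolding C_def by simp
        then have "b *\<^sub>R ((1/b) *\<^sub>R y) + 0 \<in> ?bC" by blast
        then show False using nb b by simp
      qed
      have "(norm y)\<^sup>2 \<le> a\<^sup>2" "b\<^sup>2 \<le> (norm y)\<^sup>2" using ya yb b by (auto intro!: power_mono)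
      then have 1: "\<bar>(norm y)\<^sup>2 - lam\<bar> \<le> t" using lam t by (simp add: a_def b_def)
      have "norm (y - b *\<^sub>R \<omega>) = norm ((y - norm y *\<^sub>R \<omega>) + (norm y - b) *\<^sub>R \<omega>)" by (simp add: algebra_simps)
      also have "\<dots> \<le> norm (y - norm y *\<^sub>R \<omega>) + norm ((norm y - b) *\<^sub>R \<omega>)" by (rule norm_triangle_ineq)
      also have "norm ((norm y - b) *\<^sub>R \<omega>) = norm y - b" using w yb by simp
      also have "norm (y - norm y *\<^sub>R \<omega>) + (norm y - b) \<le> \<eta> * (2 * b) + (a - b)"
      proof -
        have "\<eta> * norm y \<le> \<eta> * (2 * b)" using ya ab eta by (intro mult_left_mono) auto
        with cone ya show ?thesis by linarith
      qed
      also have "\<dots> \<le> \<rho>" using abr b by (simp add: \<eta>_def)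
      finally show "y \<in> ?S" using 1 by (simp add: b_def)
    qed
    have "c0 * t = measure lebesgue C * (b ^ (?n - 1) * (t / (3 * b)))" by (simp add: c0_def)
    also have "\<dots> \<le> measure lebesgue C * (a ^ ?n - b ^ ?n)"
    proof (rule mult_left_mono)
      have "(a - b) * (3 * b) \<ge> t" using ab b mult_left_mono[of "a + b" "3 * b" "a - b"] dab by simp
      then have d: "t / (3 * b) \<le> a - b" using b by (simp add: divide_le_eq)
      have "b ^ (?n - 1) * (t / (3 * b)) \<le> b ^ (?n - 1) * (a - b)" using b d by (intro mult_left_mono) auto
      also have "\<dots> \<le> a ^ (?n - 1) * a - b ^ (?n - 1) * b"
        using ab b power_mono[of b a "?n - 1"] mult_right_mono[of "b ^ (?n - 1)" "a ^ (?n - 1)" a] by (simp add: right_diff_distrib)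
      also have "\<dots> = a ^ ?n - b ^ ?n" by (simp flip: power_Suc2)
      finally show "b ^ (?n - 1) * (t / (3 * b)) \<le> a ^ ?n - b ^ ?n" .
    qed simp
    also have "\<dots> = measure lebesgue ?aC - measure lebesgue ?bC" using meas(1)[of a] meas(1)[of b] ab b by (simp add: algebra_simps)
    also have "\<dots> \<le> measure lebesgue (?aC - ?bC)"
    proof -
      have "?aC \<in> lmeasurable" "?bC \<in> lmeasurable" using meas(2)[of a] meas(2)[of b] ab b by auto
      then have "measure lebesgue ?aC \<le> measure lebesgue ((?aC - ?bC) \<union> ?bC)" by (intro measure_mono_fmeasurable) (auto intro: fmeasurable.Un fmeasurable.Diff)
      also have "\<dots> \<le> measure lebesgue (?aC - ?bC) + measure lebesgue ?bC"
        using \<open>?aC \<in> _\<close> \<open>?bC \<in> _\<close> by (intro measure_Un_le) auto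
      finally show ?thesis by simp
    qed
    also have "\<dots> \<le> measure lebesgue ?S"
    proof (rule measure_mono_fmeasurable[OF sub])
      show "?aC - ?bC \<in> sets lebesgue" using meas(2)[of a] meas(2)[of b] ab b by auto
      have "?S \<subseteq> cball (sqrt lam *\<^sub>R \<omega>) \<rho>" by (auto simp: dist_norm norm_minus_commute)
      moreover have "closed ?S" by (intro closed_Collect_conj closed_Collect_le continuous_intros)
      ultimately show "?S \<in> lmeasurable" by (intro lmeasurable_compact) (auto simp: compact_eq_bounded_closed intro: bounded_subset)
    qed
    also have "\<dots> = measure lborel ?S"
    proof (rule measure_completion)
      show "?S \<in> sets lborel" by measurable
    qed
    finally show "c0 * t \<le> measure lborel ?S" .
  qed
qed

lemma clamp1_id: "\<bar>t\<bar> \<le> 1 \<Longrightarrow> clamp1 t = t"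
  by (auto simp: clamp1_def)

lemma shell_poly_class:
  assumes e: "\<epsilon> > 0" and b: "\<And>t. \<bar>b t\<bar> \<le> 1" "\<And>s t. \<bar>b s - b t\<bar> \<le> L * \<bar>s - t\<bar>"
  shows "poly_class (\<lambda>y::'a::euclidean_space. complex_of_real (b (((norm y)\<^sup>2 - lam) / \<epsilon>)))"
  by (rule poly_class_lipschitz[of "\<lambda>s. b (s / \<epsilon>)" 1 "L / \<epsilon>", OF b(1)])
     (use b(2)[of "_ / \<epsilon>" "_ / \<epsilon>"] e in \<open>simp flip: diff_divide_distrib\<close>)

text \<open>Suppose \<open>ft f\<close> is nonzero at \<open>p\<close> on the sphere. Then its
  integral against a shell cutoff localised near \<open>p\<close> is at least a constant times
  \<epsilon>. By the equation this integral is \<epsilon> times the pairing of \<open>u\<close> with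
  a \<open>shell1\<close> cutoff, and that pairing tends to 0.\<close>

lemma ft_sphere_zero:
  fixes u f :: "real^'n::finite \<Rightarrow> complex"
  assumes w: "weak_helm lam u f" and u: "Bstar0_borel u" and f: "integrable lborel f"
    and f1: "integrable lborel (\<lambda>x. norm x * norm (f x))" and lam: "lam > 0"
    and \<omega>: "norm \<omega> = 1"
  shows "ft f (sqrt lam *\<^sub>R \<omega>) = 0"
proof (rule ccontr)
  assume nz: "ft f (sqrt lam *\<^sub>R \<omega>) \<noteq> 0"
  define p where "p = sqrt lam *\<^sub>R \<omega>"
  have [measurable]: "f \<in> borel_measurable borel" using f by auto
  define a where "a = norm (ft f p)"
  have a: "a > 0" using nz by (simp add: a_def p_def)
  \<comment> \<open>A phase that rotates the value of \<open>ft f\<close> at \<open>p\<close> to the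
    positive number \<open>a\<close>.\<close>
  define c where "c = cnj (ft f p) / a"
  have c: "norm c = 1" using a by (simp add: c_def norm_divide a_def)
  have cp: "c * ft f p = a" using a by (simp add: c_def mult.commute complex_norm_square[symmetric] power2_eq_square flip: of_real_mult) (simp add: a_def)
  define M where "M = (LINT x|lborel. norm x * norm (f x))"
  have M: "M \<ge> 0" unfolding M_def by (intro Bochner_Integration.integral_nonneg) auto
  \<comment> \<open>Within this radius the Lipschitz bound keeps the rotated real part above a /
    2.\<close>
  define r where "r = a / (2 * (M + 1))"
  have r: "r > 0" using a M by (simp add: r_def)
  have near: "Re (c * ft f y) \<ge> a / 2" if "norm (y - p) \<le> r" for y
  proof -
    have "norm (c * ft f y - c * ft f p) \<le> M * norm (y - p)"
      using ft_lipschitz[OF f f1, of y p] c by (simp add: M_def norm_mult flip: right_diff_distrib)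
    also have "\<dots> \<le> (M + 1) * r" using that M r by (intro mult_mono) auto
    also have "\<dots> = a / 2"
    proof -
      have "M + 1 \<noteq> 0" using M by simp
      then show ?thesis unfolding r_def by (simp add: divide_simps)
    qed
    finally have "Re (c * ft f p - c * ft f y) \<le> a / 2" by (metis complex_Re_le_cmod norm_minus_commute order_trans)
    then show ?thesis by (simp add: cp)
  qed
  \<comment> \<open>A Lipschitz tent function about \<open>p\<close>.\<close>
  define g where "g y = max 0 (1 - norm (y - p) / r)" for y
  have g: "0 \<le> g y" "g y \<le> 1" for y using r by (auto simp: g_def)
  have g0: "g y = 0" if "norm (y - p) \<ge> r" for y using that r by (simp add: g_def)
  have g1: "1 / 2 \<le> g y" if "norm (y - p) \<le> r / 2" for y using that r by (auto simp: g_def field_simps)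
  have gl: "\<bar>g (y + v) - g y\<bar> \<le> (1 / r) * norm v" for y v
  proof -
    have "\<bar>g (y + v) - g y\<bar> \<le> \<bar>norm (y - p) / r - norm (y + v - p) / r\<bar>" by (auto simp: g_def)
    also have "\<dots> = \<bar>norm (y - p) - norm (y + v - p)\<bar> / r" using r by (simp flip: diff_divide_distrib)
    also have "\<dots> \<le> norm ((y - p) - (y + v - p)) / r" using r by (intro divide_right_mono norm_triangle_ineq3) auto
    finally show ?thesis by (simp add: norm_minus_commute)
  qed
  have [measurable]: "g \<in> borel_measurable borel" unfolding g_def[abs_def] by measurable
  let ?G = "\<lambda>y. c * complex_of_real (g y)"
  have G: "gauss_class ?G"
  proof (rule gauss_class_compact[of _ 1 "1 / r" "norm p + r"])
    show "norm (?G y) \<le> 1" for y using g[of y] c by (simp add: norm_mult)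
    show "norm (?G (y + v) - ?G y) \<le> (1 / r) * norm v" for y v
      using gl[of y v] c by (simp add: norm_mult flip: right_diff_distrib of_real_diff)
    show "?G y = 0" if "norm p + r < norm y" for y
    proof -
      have "norm y \<le> norm (y - p) + norm p" by (metis diff_add_cancel norm_triangle_ineq)
      then show ?thesis using that g0[of y] by simp
    qed
  qed measurable
  obtain c0 t0 where ct: "c0 > 0" "t0 > 0"
    "\<And>t. 0 < t \<Longrightarrow> t < t0 \<Longrightarrow> measure lborel {y. \<bar>(norm y)\<^sup>2 - lam\<bar> \<le> t \<and> norm (y - sqrt lam *\<^sub>R \<omega>) \<le> r / 2} \<ge> c0 * t"
    by (rule shell_cone_measure[OF lam \<omega>, of "r / 2"], use r in simp, rule that)
  \<comment> \<open>Chosen below the lower bound: the localised integral is at least (3/32) a c0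
    \<epsilon>, while \<epsilon> d is (2/32) a c0 \<epsilon>.\<close>
  define d where "d = a * c0 / 16"
  have d: "d > 0" using a ct by (simp add: d_def)
  obtain e0 where e0: "e0 > 0" and small: "\<forall>\<epsilon>. 0 < \<epsilon> \<and> \<epsilon> < e0 \<longrightarrow>
     norm (LINT x|lborel. u x * ft (\<lambda>y. complex_of_real (shell1 (((norm y)\<^sup>2 - lam) / \<epsilon>)) * ?G y) x) \<le> d"
    using Bstar0_borel_shell_small[OF u G lam d, of shell1 4] shell_props by blast
  define \<epsilon> where "\<epsilon> = min e0 t0 / 2"
  have e: "0 < \<epsilon>" "\<epsilon> < e0" "\<epsilon> / 2 < t0" using e0 ct by (auto simp: \<epsilon>_def)
  let ?s = "\<lambda>y::real^'n. (norm y)\<^sup>2 - lam"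
  let ?H = "\<lambda>y. complex_of_real (shell (?s y / \<epsilon>)) * ?G y"
  have H: "gauss_class ?H" by (intro gauss_class_mult[OF shell_poly_class[OF e(1), where L=4]] G shell_props)
  have [measurable]: "?H \<in> borel_measurable borel" by (rule gauss_class_measurable[OF H])
  have "(\<lambda>y. complex_of_real (?s y) * ?H y) = (\<lambda>y. complex_of_real \<epsilon> * (complex_of_real (shell1 (?s y / \<epsilon>)) * ?G y))"
    using e(1) by (intro ext) (simp add: shell_props(8) mult_ac)
  then have "(LINT x|lborel. f x * ft ?H x) = (LINT x|lborel. u x * ft (\<lambda>y. complex_of_real \<epsilon> * (complex_of_real (shell1 (?s y / \<epsilon>)) * ?G y)) x)"
    using helmholtz_pairing[OF w u f H] by simp
  also have "\<dots> = (LINT x|lborel. \<epsilon> * (u x * ft (\<lambda>y. complex_of_real (shell1 (?s y / \<epsilon>)) * ?G y) x))"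
    unfolding ft_def by (simp add: mult_ac)
  finally have "norm (LINT x|lborel. f x * ft ?H x) = \<epsilon> * norm (LINT x|lborel. u x * ft (\<lambda>y. complex_of_real (shell1 (?s y / \<epsilon>)) * ?G y) x)"
    using e(1) by (simp add: norm_mult)
  also have "\<dots> \<le> \<epsilon> * d" using small e by (intro mult_left_mono) auto
  finally have up: "norm (LINT x|lborel. f x * ft ?H x) \<le> \<epsilon> * d" .
  have Hf: "integrable lborel (\<lambda>y. ?H y * ft f y)" by (rule integrable_mult_ft[OF gauss_class_integrable[OF H] f])
  define S where "S = {y. \<bar>?s y\<bar> \<le> \<epsilon> / 2 \<and> norm (y - p) \<le> r / 2}"
  have [measurable]: "S \<in> sets borel" unfolding S_def by measurable
  have Sfin: "emeasure lborel S < \<infinity>"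
  proof -
    have "S \<subseteq> cball p (r / 2)" by (auto simp: S_def dist_norm norm_minus_commute)
    then have "emeasure lborel S \<le> emeasure lborel (cball p (r / 2))" by (intro emeasure_mono) auto
    also have "\<dots> < \<infinity>" by (rule emeasure_lborel_cball_finite)
    finally show ?thesis .
  qed
  \<comment> \<open>The factor 3/16 is 3/4 for the shell profile on the half-width shell, 1/2 for
    the tent and 1/2 for the real part.\<close>
  have "3 / 16 * a * (c0 * (\<epsilon> / 2)) \<le> 3 / 16 * a * measure lborel S"
    using ct(3)[of "\<epsilon> / 2"] e a by (intro mult_left_mono) (auto simp: S_def p_def)
  also have "\<dots> = (LINT y|lborel. 3 / 16 * a * indicator S y)" using Sfin by simp
  also have "\<dots> \<le> (LINT y|lborel. Re (?H y * ft f y))"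
  proof (rule Bochner_Integration.integral_mono)
    show "integrable lborel (\<lambda>y. 3 / 16 * a * indicator S y)" using Sfin by simp
    show "integrable lborel (\<lambda>y. Re (?H y * ft f y))" using Hf by (rule integrable_Re)
    fix y
    have eq: "Re (?H y * ft f y) = shell (?s y / \<epsilon>) * (g y * Re (c * ft f y))"
    proof -
      have "?H y * ft f y = complex_of_real (shell (?s y / \<epsilon>) * g y) * (c * ft f y)" by (simp add: mult_ac)
      moreover have "Re (complex_of_real x * z) = x * Re z" for x z by simp
      ultimately show ?thesis by (simp only: mult.assoc)
    qed
    have nn: "0 \<le> g y * Re (c * ft f y)"
    proof (cases "norm (y - p) \<le> r")
      case True
      then show ?thesis using near[OF True] a g[of y] by (intro mult_nonneg_nonneg) auto
    next
      case False then show ?thesis using g0[of y] by simp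
    qed
    show "3 / 16 * a * indicator S y \<le> Re (?H y * ft f y)"
    proof (cases "y \<in> S")
      case False
      then show ?thesis unfolding eq using nn shell_props(4) by simp
    next
      case True
      then have y: "\<bar>?s y\<bar> \<le> \<epsilon> / 2" "norm (y - p) \<le> r / 2" by (auto simp: S_def)
      have t: "\<bar>?s y / \<epsilon>\<bar> \<le> 1 / 2" using y(1) e(1) by (simp add: abs_divide field_simps)
      have "clamp1 (?s y / \<epsilon>) = ?s y / \<epsilon>" by (rule clamp1_id[OF order_trans[OF t]]) simp
      moreover have "(?s y / \<epsilon>)\<^sup>2 \<le> (1 / 2)\<^sup>2" using power_mono[OF t, of 2] by (simp only: power2_abs abs_ge_zero)
      ultimately have sh: "shell (?s y / \<epsilon>) \<ge> 3 / 4" by (simp add: shell_def power2_eq_square)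
      have gg: "1 / 2 * (a / 2) \<le> g y * Re (c * ft f y)"
        by (rule mult_mono[OF g1[OF y(2)] near]) (use y r a g in auto)
      have "3 / 4 * (1 / 2 * (a / 2)) \<le> shell (?s y / \<epsilon>) * (g y * Re (c * ft f y))"
        by (rule mult_mono[OF sh gg]) (use a shell_props(4) in auto)
      then show ?thesis unfolding eq using True by simp
    qed
  qed
  also have "\<dots> = Re (LINT y|lborel. ?H y * ft f y)" using Hf by (rule integral_Re)
  also have "\<dots> \<le> norm (LINT y|lborel. ?H y * ft f y)" by (rule complex_Re_le_cmod)
  also have "(LINT y|lborel. ?H y * ft f y) = (LINT x|lborel. f x * ft ?H x)"
    by (rule ft_mult[OF f gauss_class_integrable[OF H]])
  finally have "3 / 16 * a * (c0 * (\<epsilon> / 2)) \<le> \<epsilon> * d" using up by simp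
  also have "\<epsilon> * d = 1 / 16 * a * (c0 * \<epsilon>)" by (simp add: d_def)
  finally have "a * (c0 * \<epsilon>) \<le> 0" by (simp add: mult_ac)
  then show False using a ct e by (simp add: mult_le_0_iff)
qed

section \<open>The quotient by the symbol\<close>

text \<open>On the sphere division by zero gives the value 0, which obeys the same bound as the
  other values.\<close>

definition ft_quotient :: "real \<Rightarrow> (real^'n::finite \<Rightarrow> complex) \<Rightarrow> real^'n \<Rightarrow> complex" where
  "ft_quotient lam f y = ft f y / complex_of_real ((norm y)\<^sup>2 - lam)"

text \<open>Compare \<open>y\<close> with its radial projection onto the sphere, where
  \<open>ft f\<close> vanishes. The Lipschitz bound cancels the factor |y| - sqrt lam of the symbol,
  and the other factor is at least sqrt lam.\<close>

lemma ft_quotient_bound: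
  fixes f :: "real^'n::finite \<Rightarrow> complex"
  assumes f: "integrable lborel f" and f1: "integrable lborel (\<lambda>x. norm x * norm (f x))" and lam: "lam > 0"
    and z: "\<And>\<omega>. norm \<omega> = 1 \<Longrightarrow> ft f (sqrt lam *\<^sub>R \<omega>) = 0"
  shows "norm (ft_quotient lam f y) \<le> (LINT x|lborel. norm x * norm (f x)) / sqrt lam"
proof (cases "(norm y)\<^sup>2 = lam")
  case True
  then show ?thesis using lam by (auto simp: ft_quotient_def intro!: divide_nonneg_pos Bochner_Integration.integral_nonneg)
next
  case False
  let ?M = "LINT x|lborel. norm x * norm (f x)"
  have M: "?M \<ge> 0" by (intro Bochner_Integration.integral_nonneg) auto
  obtain \<omega> where w: "norm \<omega> = 1" "y = norm y *\<^sub>R \<omega>"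
  proof (cases "y = 0")
    case True
    \<comment> \<open>At the origin every unit vector is a radial direction.\<close>
    then show ?thesis using that[of "SOME e. e \<in> Basis"] by simp
  next
    case False
    then show ?thesis using that[of "y /\<^sub>R norm y"] by simp
  qed
  have "norm (ft f y) = norm (ft f y - ft f (sqrt lam *\<^sub>R \<omega>))" by (simp add: z[OF w(1)])
  also have "\<dots> \<le> ?M * norm (y - sqrt lam *\<^sub>R \<omega>)" by (rule ft_lipschitz[OF f f1])
  also have "norm (y - sqrt lam *\<^sub>R \<omega>) = \<bar>norm y - sqrt lam\<bar>"
    by (subst w(2)) (simp add: w(1) flip: scaleR_diff_left)
  finally have n: "norm (ft f y) \<le> ?M * \<bar>norm y - sqrt lam\<bar>" .
  have "\<bar>norm y - sqrt lam\<bar> * sqrt lam \<le> \<bar>norm y - sqrt lam\<bar> * (norm y + sqrt lam)" by (intro mult_left_mono) auto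
  also have "\<dots> = \<bar>(norm y)\<^sup>2 - lam\<bar>"
  proof -
    have "(norm y)\<^sup>2 - lam = (norm y - sqrt lam) * (norm y + sqrt lam)" using lam by (simp add: algebra_simps flip: power2_eq_square)
    then show ?thesis using lam by (simp add: abs_mult)
  qed
  finally have "?M * (\<bar>norm y - sqrt lam\<bar> * sqrt lam) \<le> ?M * \<bar>(norm y)\<^sup>2 - lam\<bar>" by (intro mult_left_mono M)
  moreover have "norm (ft f y) * sqrt lam \<le> ?M * \<bar>norm y - sqrt lam\<bar> * sqrt lam" using n lam by (intro mult_right_mono) auto
  ultimately have "norm (ft f y) * sqrt lam \<le> ?M * \<bar>(norm y)\<^sup>2 - lam\<bar>" by (simp add: mult.assoc)
  then show ?thesis using False lam unfolding ft_quotient_def norm_divide norm_of_real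
    by (simp add: divide_simps)
qed

text \<open>Split \<open>G\<close> into its shell part and the symbol times a regularised inverse.
  The shell part pairs to o(1), the equation moves the other part to \<open>f\<close>, and the
  bounded quotient dominates the limit. So the transform of \<open>u\<close> carries no mass on the
  sphere.\<close>

lemma u_ft_eq_ft_quotient:
  fixes u f :: "real^'n::finite \<Rightarrow> complex"
  assumes w: "weak_helm lam u f" and u: "Bstar0_borel u" and f: "integrable lborel f"
    and f1: "integrable lborel (\<lambda>x. norm x * norm (f x))" and lam: "lam > 0" and G: "gauss_class G"
  shows "(LINT x|lborel. u x * ft G x) = (LINT y|lborel. ft_quotient lam f y * G y)"
proof -
  note z = ft_sphere_zero[OF w u f f1 lam]
  have [measurable]: "f \<in> borel_measurable borel" "G \<in> borel_measurable borel" "u \<in> borel_measurable borel" using f G u by (auto simp: gauss_class_def Bstar0_borel_def)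
  have [measurable]: "ft_quotient lam f \<in> borel_measurable borel" unfolding ft_quotient_def[abs_def] by measurable
  let ?K = "(LINT x|lborel. norm x * norm (f x)) / sqrt lam"
  have K: "norm (ft_quotient lam f y) \<le> ?K" for y by (rule ft_quotient_bound[OF f f1 lam z])
  let ?s = "\<lambda>y::real^'n. (norm y)\<^sup>2 - lam"
  define E where "E N = 1 / real (Suc N)" for N
  have E: "E N > 0" for N by (simp add: E_def)
  have E0: "E \<longlonglongrightarrow> 0" unfolding E_def[abs_def] using LIMSEQ_Suc[OF lim_1_over_n, where 'a1=real] by simp
  let ?b = "\<lambda>N y. complex_of_real (reg_inverse (?s y / E N) / E N)"
  let ?c = "\<lambda>N y. complex_of_real (shell (?s y / E N))"
  have bG: "gauss_class (\<lambda>y. ?b N y * G y)" for N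
  proof (rule gauss_class_mult[OF _ G])
    show "poly_class (\<lambda>y::real^'n. complex_of_real (reg_inverse (?s y / E N) / E N))"
    proof (rule poly_class_lipschitz[of "\<lambda>s. reg_inverse (s / E N) / E N" "1 / E N" "1 / (E N * E N)"])
      show "\<bar>reg_inverse (s / E N) / E N\<bar> \<le> 1 / E N" for s
        using reg_inverse_bound[of "s / E N"] E[of N] by (simp add: abs_divide divide_right_mono)
      show "\<bar>reg_inverse (s / E N) / E N - reg_inverse (t / E N) / E N\<bar> \<le> 1 / (E N * E N) * \<bar>s - t\<bar>" for s t
      proof -
        have "\<bar>reg_inverse (s / E N) / E N - reg_inverse (t / E N) / E N\<bar> = \<bar>reg_inverse (s / E N) - reg_inverse (t / E N)\<bar> / E N"
          using E[of N] by (simp flip: diff_divide_distrib)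
        also have "\<dots> \<le> (1 * \<bar>s / E N - t / E N\<bar>) / E N" using E[of N] by (intro divide_right_mono reg_inverse_lipschitz) auto
        also have "\<dots> = 1 / (E N * E N) * \<bar>s - t\<bar>" using E[of N] by (simp flip: diff_divide_distrib)
        finally show ?thesis .
      qed
    qed
  qed
  have cG: "gauss_class (\<lambda>y. ?c N y * G y)" for N by (intro gauss_class_mult[OF shell_poly_class[OF E, where L=4]] G shell_props)
  have sbG: "gauss_class (\<lambda>y. complex_of_real (?s y) * (?b N y * G y))" for N by (intro gauss_class_mult poly_class_norm_sq bG)
  have split: "G = (\<lambda>y. ?c N y * G y + complex_of_real (?s y) * (?b N y * G y))" for N
  proof
    fix y
    have "shell (?s y / E N) + ?s y * (reg_inverse (?s y / E N) / E N) = 1"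
      using reg_inverse_shell[of "?s y / E N"] by simp
    then have "complex_of_real (shell (?s y / E N)) + complex_of_real (?s y) * complex_of_real (reg_inverse (?s y / E N) / E N) = 1"
      by (metis of_real_1 of_real_add of_real_mult)
    then show "G y = ?c N y * G y + complex_of_real (?s y) * (?b N y * G y)"
      by (metis distrib_right mult.assoc mult_1)
  qed
  have eq: "(LINT x|lborel. u x * ft G x) = (LINT x|lborel. u x * ft (\<lambda>y. ?c N y * G y) x) + (LINT y|lborel. G y * (?b N y * ft f y))" for N
  proof -
    have "ft G x = ft (\<lambda>y. ?c N y * G y) x + ft (\<lambda>y. complex_of_real (?s y) * (?b N y * G y)) x" for x
      by (subst split[of N]) (rule ft_add[OF gauss_class_integrable[OF cG] gauss_class_integrable[OF sbG]])
    then have "(LINT x|lborel. u x * ft G x) = (LINT x|lborel. u x * ft (\<lambda>y. ?c N y * G y) x + u x * ft (\<lambda>y. complex_of_real (?s y) * (?b N y * G y)) x)"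
      by (simp only: distrib_left)
    also have "\<dots> = (LINT x|lborel. u x * ft (\<lambda>y. ?c N y * G y) x) + (LINT x|lborel. u x * ft (\<lambda>y. complex_of_real (?s y) * (?b N y * G y)) x)"
      by (intro Bochner_Integration.integral_add gauss_class_pairing_integrable[OF u] cG sbG)
    also have "(LINT x|lborel. u x * ft (\<lambda>y. complex_of_real (?s y) * (?b N y * G y)) x) = (LINT x|lborel. f x * ft (\<lambda>y. ?b N y * G y) x)"
      by (rule helmholtz_pairing[OF w u f bG])
    also have "\<dots> = (LINT y|lborel. (?b N y * G y) * ft f y)"
      by (rule ft_mult[OF gauss_class_integrable[OF bG] f])
    finally show ?thesis by (simp only: mult_ac)
  qed
  have lim1: "(\<lambda>N. LINT y|lborel. G y * (?b N y * ft f y)) \<longlonglongrightarrow> (LINT y|lborel. G y * ft_quotient lam f y)"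
  proof (rule tendsto_lborel_bounded_mult[OF gauss_class_integrable[OF G], of _ ?K])
    have [measurable]: "reg_inverse \<in> borel_measurable borel" unfolding reg_inverse_def[abs_def] by measurable
    show "(\<lambda>y. ?b N y * ft f y) \<in> borel_measurable borel" for N by measurable
    \<comment> \<open>On the sphere both sides are 0: \<open>reg_inverse\<close> vanishes at 0, and
      the quotient is a division by zero.\<close>
    have id: "?b N y * ft f y = complex_of_real (1 - shell (?s y / E N)) * ft_quotient lam f y" for N y
    proof (cases "?s y = 0")
      case True
      then show ?thesis by (simp add: reg_inverse_def ft_quotient_def)
    next
      case False
      have "reg_inverse (?s y / E N) / E N = (1 - shell (?s y / E N)) / ?s y"
        unfolding reg_inverse_shell[symmetric] using False E[of N] by simp
      then show ?thesis using False by (simp add: ft_quotient_def)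
    qed
    show "norm (?b N y * ft f y) \<le> ?K" for N y
    proof -
      have "0 \<le> 1 - shell (?s y / E N)" "1 - shell (?s y / E N) \<le> 1" using shell_props(1,4)[of "?s y / E N"] by auto
      then have "norm (?b N y * ft f y) \<le> 1 * norm (ft_quotient lam f y)"
        unfolding id norm_mult norm_of_real by (intro mult_right_mono) auto
      then show ?thesis using K[of y] by simp
    qed
    show "(\<lambda>N. ?b N y * ft f y) \<longlonglongrightarrow> ft_quotient lam f y" for y
    proof (cases "?s y = 0")
      case True
      then show ?thesis unfolding id by (simp add: ft_quotient_def)
    next
      case False
      have "\<forall>\<^sub>F N in sequentially. E N < \<bar>?s y\<bar>" using E0 False by (intro order_tendstoD) auto
      then have "\<forall>\<^sub>F N in sequentially. ?b N y * ft f y = ft_quotient lam f y"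
      proof eventually_elim
        case (elim N)
        have "1 \<le> \<bar>?s y / E N\<bar>" using elim E[of N] by (simp add: abs_divide)
        then show ?case unfolding id using shell_props(3) by simp
      qed
      then show ?thesis by (rule tendsto_eventually)
    qed
  qed
  have lim2: "(\<lambda>N. LINT x|lborel. u x * ft (\<lambda>y. ?c N y * G y) x) \<longlonglongrightarrow> 0"
  proof (rule LIMSEQ_I)
    fix r :: real assume "r > 0"
    then have r2: "r / 2 > 0" by simp
    obtain e0 where e0: "e0 > 0" and small: "\<forall>\<epsilon>. 0 < \<epsilon> \<and> \<epsilon> < e0 \<longrightarrow>
       norm (LINT x|lborel. u x * ft (\<lambda>y. complex_of_real (shell (((norm y)\<^sup>2 - lam) / \<epsilon>)) * G y) x) \<le> r / 2"
      using Bstar0_borel_shell_small[OF u G lam r2, of shell 4] shell_props by blast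
    have "\<forall>\<^sub>F N in sequentially. E N < e0" using E0 e0 by (rule order_tendstoD)
    then obtain N0 where "\<And>N. N \<ge> N0 \<Longrightarrow> E N < e0" by (auto simp: eventually_sequentially)
    then have "norm ((LINT x|lborel. u x * ft (\<lambda>y. ?c N y * G y) x) - 0) < r" if "N \<ge> N0" for N
      using small[rule_format, OF conjI[OF E[of N]]] that \<open>r > 0\<close> by fastforce
    then show "\<exists>no. \<forall>n\<ge>no. norm ((LINT x|lborel. u x * ft (\<lambda>y. ?c n y * G y) x) - 0) < r" by blast
  qed
  have "(\<lambda>N. LINT x|lborel. u x * ft G x) \<longlonglongrightarrow> 0 + (LINT y|lborel. G y * ft_quotient lam f y)"
    using tendsto_add[OF lim2 lim1] unfolding eq[symmetric] .
  then have "(LINT x|lborel. u x * ft G x) = 0 + (LINT y|lborel. G y * ft_quotient lam f y)"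
    using LIMSEQ_unique tendsto_const by blast
  then show ?thesis by (simp add: mult.commute)
qed

section \<open>Continuation to the upper half-plane\<close>

text \<open>Cauchy's inequality turns the bound on \<open>k\<close> into a bound on its derivative
  near \<open>z\<close>; hence the difference quotients are dominated, and one may differentiate
  under the integral.\<close>

lemma holomorphic_on_integral:
  fixes k :: "'a \<Rightarrow> complex \<Rightarrow> complex"
  assumes D: "open D" and h: "\<And>x. k x holomorphic_on D"
    and m: "\<And>z. z \<in> D \<Longrightarrow> (\<lambda>x. k x z) \<in> borel_measurable M"
    and b: "\<And>x z. z \<in> D \<Longrightarrow> norm (k x z) \<le> g x" and g: "integrable M g"
  shows "(\<lambda>z. LINT x|M. k x z) holomorphic_on D"
proof (rule holomorphic_onI)
  fix z assume z: "z \<in> D"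
  then obtain r where r: "r > 0" "cball z r \<subseteq> D" using D open_contains_cball by blast
  \<comment> \<open>Half the radius, so that a closed disc of radius r / 2 about any point of
    \<open>?B\<close> stays in \<open>D\<close>, as Cauchy's inequality requires.\<close>
  let ?B = "ball z (r / 2)"
  have BD: "?B \<subseteq> D" using r by (auto intro!: subsetD[OF r(2)] simp: dist_commute)
  have ki: "integrable M (\<lambda>x. k x w)" if "w \<in> D" for w
    by (rule Bochner_Integration.integrable_bound[OF g m[OF that]]) (use b[OF that] in \<open>auto intro: order_trans[OF _ abs_ge_self]\<close>)
  have kd: "(k x has_field_derivative deriv (k x) w) (at w)" if "w \<in> D" for x w
    by (rule holomorphic_derivI[OF h D that])
  have db: "norm (deriv (k x) w) \<le> g x / (r / 2)" if "w \<in> ?B" for x w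
  proof -
    have s: "cball w (r / 2) \<subseteq> D"
    proof
      fix v assume "v \<in> cball w (r / 2)"
      then have "dist z v \<le> r" using that dist_triangle[of z v w] by auto
      then show "v \<in> D" using r(2) by auto
    qed
    have "norm ((deriv ^^ 1) (k x) w) \<le> fact 1 * g x / (r / 2) ^ 1"
    proof (rule Cauchy_inequality)
      show "k x holomorphic_on ball w (r / 2)" by (rule holomorphic_on_subset[OF h]) (use s ball_subset_cball in blast)
      show "continuous_on (cball w (r / 2)) (k x)" by (rule holomorphic_on_imp_continuous_on[OF holomorphic_on_subset[OF h s]])
      show "norm (k x v) \<le> g x" if "norm (w - v) = r / 2" for v
        by (rule b) (use s that in \<open>auto simp: dist_norm\<close>)
    qed (use r in auto)
    then show ?thesis by simp
  qed
  have lip: "norm (k x w - k x z) \<le> g x / (r / 2) * norm (w - z)" if "w \<in> ?B" for x w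
  proof (rule field_differentiable_bound[OF convex_ball[of z "r/2"], where f'="deriv (k x)"])
    show "(k x has_field_derivative deriv (k x) v) (at v within ?B)" if "v \<in> ?B" for v
      by (rule has_field_derivative_at_within[OF kd[OF subsetD[OF BD that]]])
  qed (use db that r in auto)
  have "((\<lambda>w. ((LINT x|M. k x w) - (LINT x|M. k x z)) / (w - z)) \<longlongrightarrow> (LINT x|M. deriv (k x) z)) (at z within ?B)"
    unfolding tendsto_at_iff_sequentially comp_def
  proof (intro allI impI)
    fix X assume X: "\<forall>i. X i \<in> ?B - {z}" "X \<longlonglongrightarrow> z"
    have lim: "(\<lambda>i. (k x (X i) - k x z) / (X i - z)) \<longlonglongrightarrow> deriv (k x) z" for x
    proof -
      have "((\<lambda>w. (k x w - k x z) / (w - z)) \<longlongrightarrow> deriv (k x) z) (at z)"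
        using kd[OF z, of x] by (simp add: has_field_derivative_iff)
      moreover have "filterlim X (at z) sequentially" using X by (auto simp: filterlim_at)
      ultimately show ?thesis by (rule filterlim_compose)
    qed
    have mX: "(\<lambda>x. (k x (X i) - k x z) / (X i - z)) \<in> borel_measurable M" for i
      using X BD z by (intro borel_measurable_divide borel_measurable_diff m) auto
    have "(\<lambda>i. LINT x|M. (k x (X i) - k x z) / (X i - z)) \<longlonglongrightarrow> (LINT x|M. deriv (k x) z)"
    proof (rule integral_dominated_convergence[where w="\<lambda>x. g x / (r / 2)"])
      show "(\<lambda>x. deriv (k x) z) \<in> borel_measurable M" by (rule borel_measurable_LIMSEQ_metric[OF mX lim])
      show "(\<lambda>x. (k x (X i) - k x z) / (X i - z)) \<in> borel_measurable M" for i by (rule mX)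
      show "integrable M (\<lambda>x. g x / (r / 2))" using g by simp
      show "AE x in M. (\<lambda>i. (k x (X i) - k x z) / (X i - z)) \<longlonglongrightarrow> deriv (k x) z" using lim by simp
      show "AE x in M. norm ((k x (X i) - k x z) / (X i - z)) \<le> g x / (r / 2)" for i
      proof (rule AE_I2)
        fix x
        have "X i \<in> ?B" "X i \<noteq> z" using X by auto
        then show "norm ((k x (X i) - k x z) / (X i - z)) \<le> g x / (r / 2)"
          using lip[of "X i" x] by (simp add: norm_divide divide_le_eq)
      qed
    qed
    moreover have eqn: "(LINT x|M. (k x (X i) - k x z) / (X i - z)) = ((LINT x|M. k x (X i)) - (LINT x|M. k x z)) / (X i - z)" for i
    proof -
      have "X i \<in> D" using X BD by auto
      then show ?thesis using ki z by simp
    qed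
    ultimately show "(\<lambda>i. ((LINT x|M. k x (X i)) - (LINT x|M. k x z)) / (X i - z)) \<longlonglongrightarrow> (LINT x|M. deriv (k x) z)" by (simp only: eqn)
  qed
  then have "((\<lambda>z. LINT x|M. k x z) has_field_derivative (LINT x|M. deriv (k x) z)) (at z)"
    using r by (simp add: has_field_derivative_iff at_within_open[of z ?B])
  then show "(\<lambda>z. LINT x|M. k x z) field_differentiable at z within D"
    using field_differentiable_def field_differentiable_at_within by blast
qed

section \<open>The Fourier-Laplace transform of the source\<close>

text \<open>The weighted square integrability of the theorem becomes weighted integrability at half
  the rate, and the support condition holds pointwise after a change of \<open>f\<close> on a null
  set. A general unit vector \<open>e\<close> keeps coordinates out of the argument.\<close>

locale half_space_source =
  fixes f :: "real^'n::finite \<Rightarrow> complex" and e :: "real^'n" and \<gamma> :: real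
  assumes f_meas[measurable]: "f \<in> borel_measurable borel" and e1: "norm e = 1" and \<gamma>: "\<gamma> > 0"
    and f_exp: "integrable lborel (\<lambda>x. exp (\<gamma> * norm x) * norm (f x))"
    and f_supp: "\<And>x. x \<bullet> e < 0 \<Longrightarrow> f x = 0"
begin

definition laplace_kernel :: "real^'n \<Rightarrow> real^'n \<Rightarrow> complex \<Rightarrow> complex \<Rightarrow> complex" where
  "laplace_kernel \<omega> x z w = f x * exp (\<i> * (z * complex_of_real (x \<bullet> \<omega>) + w * complex_of_real (x \<bullet> e)))"

text \<open>The transform of \<open>f\<close> continued to the complexified plane of \<omega> and
  \<open>e\<close>: \<open>z\<close> is dual to \<omega> and \<open>w\<close> to
  \<open>e\<close>.\<close>

definition fourier_laplace :: "real^'n \<Rightarrow> complex \<Rightarrow> complex \<Rightarrow> complex" where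
  "fourier_laplace \<omega> z w = (LINT x|lborel. laplace_kernel \<omega> x z w)"

lemma laplace_kernel_measurable[measurable]: "(\<lambda>x. laplace_kernel \<omega> x z w) \<in> borel_measurable borel"
  unfolding laplace_kernel_def by measurable

lemma norm_laplace_kernel:
  "norm (laplace_kernel \<omega> x z w) = norm (f x) * exp (- (Im z * (x \<bullet> \<omega>) + Im w * (x \<bullet> e)))"
  by (simp add: laplace_kernel_def norm_mult)

text \<open>On the support \<open>x \<bullet> e\<close> is nonnegative, so a positive imaginary part
  of \<open>w\<close> only helps, however large. The exponential weight pays for its negative part
  and for the imaginary part of \<open>z\<close>.\<close>

lemma laplace_kernel_bound:
  assumes w: "norm \<omega> = 1" and c: "\<bar>Im z\<bar> + max 0 (- Im w) \<le> \<gamma>"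
  shows "norm (laplace_kernel \<omega> x z w) \<le> exp (\<gamma> * norm x) * norm (f x)"
proof (cases "x \<bullet> e < 0")
  case True
  then show ?thesis by (simp add: norm_laplace_kernel f_supp)
next
  case False
  have "- (Im z * (x \<bullet> \<omega>)) \<le> \<bar>Im z * (x \<bullet> \<omega>)\<bar>" by (rule abs_ge_minus_self)
  also have "\<dots> \<le> \<bar>Im z\<bar> * norm x"
    unfolding abs_mult using Cauchy_Schwarz_ineq2[of x \<omega>] w by (intro mult_left_mono) auto
  finally have "- (Im z * (x \<bullet> \<omega>)) \<le> \<bar>Im z\<bar> * norm x" .
  moreover have "- Im w * (x \<bullet> e) \<le> max 0 (- Im w) * norm x"
    using False Cauchy_Schwarz_ineq2[of x e] e1 by (intro mult_mono) auto
  ultimately have "- (Im z * (x \<bullet> \<omega>) + Im w * (x \<bullet> e)) \<le> (\<bar>Im z\<bar> + max 0 (- Im w)) * norm x" by (simp add: algebra_simps)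
  also have "\<dots> \<le> \<gamma> * norm x" using c by (intro mult_right_mono) auto
  finally show ?thesis unfolding norm_laplace_kernel by (simp add: mult.commute[of "norm (f x)"] mult_right_mono)
qed

lemma f_integrable: "integrable lborel f"
proof (rule Bochner_Integration.integrable_bound[OF f_exp])
  have "1 * norm (f x) \<le> exp (\<gamma> * norm x) * norm (f x)" for x
    using \<gamma> by (intro mult_right_mono) auto
  then show "AE x in lborel. norm (f x) \<le> norm (exp (\<gamma> * norm x) * norm (f x))" by (simp add: abs_mult)
qed measurable

lemma f_moment_integrable: "integrable lborel (\<lambda>x. norm x * norm (f x))"
proof (rule Bochner_Integration.integrable_bound[OF integrable_mult_right[OF f_exp, of "1 / \<gamma>"]])
  show "AE x in lborel. norm (norm x * norm (f x)) \<le> norm (1 / \<gamma> * (exp (\<gamma> * norm x) * norm (f x)))"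
  proof (rule AE_I2)
    fix x :: "real^'n"
    have "\<gamma> * norm x \<le> exp (\<gamma> * norm x)" using exp_ge_add_one_self[of "\<gamma> * norm x"] by linarith
    then have "norm x \<le> 1 / \<gamma> * exp (\<gamma> * norm x)" using \<gamma> by (simp add: field_simps)
    then have "norm x * norm (f x) \<le> 1 / \<gamma> * exp (\<gamma> * norm x) * norm (f x)" by (rule mult_right_mono) simp
    then show "norm (norm x * norm (f x)) \<le> norm (1 / \<gamma> * (exp (\<gamma> * norm x) * norm (f x)))" using \<gamma> by (simp add: abs_mult)
  qed
qed measurable

lemma fourier_laplace_real: "fourier_laplace \<omega> (complex_of_real a) (complex_of_real b) = ft f (a *\<^sub>R \<omega> + b *\<^sub>R e)"
  unfolding fourier_laplace_def ft_def laplace_kernel_def by (simp add: cis_conv_exp inner_add_right mult_ac)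

text \<open>With L = sqrt lam, the map \<theta> -> L (sin \<theta>, cos \<theta>) parametrises the
  complex conic z^2 + w^2 = lam. Real angles give points of the sphere, and (\<rho>, i s) is reached
  at \<theta> = pi/2 - i b. A narrow strip about the vertical segment between pi/2 and this angle
  stays in the region where \<open>fourier_laplace\<close> converges.\<close>

lemma fourier_laplace_zero_extension:
  assumes lam: "lam > 0" and w: "norm \<omega> = 1" and orth: "\<omega> \<bullet> e = 0"
    and z: "\<And>v. norm v = 1 \<Longrightarrow> ft f (sqrt lam *\<^sub>R v) = 0"
    and s: "s \<ge> 0" "\<rho> > 0" "\<rho>\<^sup>2 = lam + s\<^sup>2"
  shows "fourier_laplace \<omega> (complex_of_real \<rho>) (\<i> * s) = 0"
proof -
  define L where "L = sqrt lam"
  have L: "L > 0" "L\<^sup>2 = lam" using lam by (auto simp: L_def)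
  have rs: "(\<rho> - s) * (\<rho> + s) = L\<^sup>2" using s L by (simp add: algebra_simps power2_eq_square)
  \<comment> \<open>The hyperbolic angle: L cosh b = \<rho> and L sinh b = s.\<close>
  define b where "b = ln ((\<rho> + s) / L)"
  have eb: "exp b = (\<rho> + s) / L" using s L by (simp add: b_def)
  have eb': "exp (- b) = (\<rho> - s) / L" using s L rs by (simp add: exp_minus eb divide_simps) (simp add: power2_eq_square mult_ac)
  have b0: "b \<ge> 0"
  proof -
    have "L \<le> \<rho>" by (rule power2_le_imp_le) (use s L in auto)
    then show ?thesis using s L by (simp add: b_def)
  qed
  \<comment> \<open>The half-width of the strip. Near pi/2 the cosine is at most d, and the
    hyperbolic factor is at most exp (b + 1), so the imaginary part of L sin \<theta> costs at most
    \<gamma>/2.\<close>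
  define d where "d = min 1 (\<gamma> / (2 * L * exp (b + 1)))"
  \<comment> \<open>The height of the strip above the real axis. There the imaginary part of L cos
    \<theta> may be negative, but by at most L (exp d2 - 1), which is kept below \<gamma>/2.\<close>
  define d2 where "d2 = min 1 (ln (1 + \<gamma> / (2 * L)))"
  have d: "d > 0" "d \<le> 1" "L * d * exp (b + 1) \<le> \<gamma> / 2"
  proof -
    show "d > 0" "d \<le> 1" using \<gamma> L by (auto simp: d_def)
    have "L * exp (b + 1) * d \<le> L * exp (b + 1) * (\<gamma> / (2 * L * exp (b + 1)))" using L by (intro mult_left_mono) (auto simp: d_def)
    also have "\<dots> = \<gamma> / 2" using L by simp
    finally show "L * d * exp (b + 1) \<le> \<gamma> / 2" by (simp add: mult_ac)
  qed
  have d2: "d2 > 0" "d2 \<le> 1" "L * (exp d2 - 1) \<le> \<gamma> / 2"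
  proof -
    show "d2 > 0" "d2 \<le> 1" using \<gamma> L by (auto simp: d2_def intro!: ln_gt_zero)
    have "exp d2 \<le> exp (ln (1 + \<gamma> / (2 * L)))" by (simp add: d2_def)
    also have "\<dots> = 1 + \<gamma> / (2 * L)" using \<gamma> L by (intro exp_ln) (auto intro: add_pos_pos)
    finally have "L * (exp d2 - 1) \<le> L * (\<gamma> / (2 * L))" using L by (intro mult_left_mono) auto
    then show "L * (exp d2 - 1) \<le> \<gamma> / 2" using L by simp
  qed
  \<comment> \<open>An open rectangle that surrounds pi/2 and reaches one unit beyond the target, so
    that both are interior points.\<close>
  define D where "D = {\<theta>. Re \<theta> > pi / 2 - d} \<inter> {\<theta>. Re \<theta> < pi / 2 + d} \<inter> {\<theta>. Im \<theta> > - b - 1} \<inter> {\<theta>. Im \<theta> < d2}"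
  have Do: "open D" unfolding D_def by (intro open_Int open_halfspace_Re_gt open_halfspace_Re_lt open_halfspace_Im_gt open_halfspace_Im_lt)
  have Dc: "connected D" unfolding D_def
    by (intro convex_connected convex_Int convex_halfspace_Re_gt convex_halfspace_Re_lt convex_halfspace_Im_gt convex_halfspace_Im_lt)
  have cond: "\<bar>Im (L * sin \<theta>)\<bar> + max 0 (- Im (L * cos \<theta>)) \<le> \<gamma>" if "\<theta> \<in> D" for \<theta> :: complex
  proof -
    let ?a = "Re \<theta>" and ?b = "Im \<theta>"
    have ab: "\<bar>?a - pi / 2\<bar> < d" "- b - 1 < ?b" "?b < d2" using that by (auto simp: D_def)
    have c: "\<bar>cos ?a\<bar> \<le> d"
      using abs_sin_x_le_abs_x[of "pi / 2 - ?a"] ab(1) by (simp add: sin_diff)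
    have sa: "0 \<le> sin ?a" "sin ?a \<le> 1"
    proof -
      have "0 \<le> cos (?a - pi / 2)" using ab(1) d pi_gt3 by (intro cos_ge_zero) auto
      then show "0 \<le> sin ?a" by (simp add: cos_diff)
    qed simp
    have e1: "\<bar>(exp ?b - exp (- ?b)) / 2\<bar> \<le> exp (b + 1)"
    proof -
      have "exp ?b \<le> exp (b + 1)" "exp (- ?b) \<le> exp (b + 1)" using ab b0 d2 by auto
      then show ?thesis using exp_gt_zero[of ?b] exp_gt_zero[of "-?b"] unfolding abs_le_iff by argo
    qed
    have "\<bar>Im (L * sin \<theta>)\<bar> = L * (\<bar>cos ?a\<bar> * \<bar>(exp ?b - exp (- ?b)) / 2\<bar>)"
      using L by (simp add: Im_sin abs_mult)
    also have "\<dots> \<le> L * (d * exp (b + 1))" using L d by (intro mult_left_mono mult_mono c e1) auto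
    also have "\<dots> \<le> \<gamma> / 2" using d by (simp add: mult_ac)
    finally have 1: "\<bar>Im (L * sin \<theta>)\<bar> \<le> \<gamma> / 2" .
    have "- Im (L * cos \<theta>) \<le> \<gamma> / 2"
    proof (cases "?b \<le> 0")
      case True
      then have "exp ?b \<le> exp (- ?b)" by simp
      then have "0 \<le> L * (sin ?a * ((exp (- ?b) - exp ?b) / 2))" using L sa by simp
      then have "- Im (L * cos \<theta>) \<le> 0" by (simp add: Im_cos)
      then show ?thesis using \<gamma> by simp
    next
      case False
      have "1 + ?b \<le> exp ?b" "1 - ?b \<le> exp (- ?b)" using exp_ge_add_one_self[of ?b] exp_ge_add_one_self[of "- ?b"] by auto
      then have "(exp ?b - exp (- ?b)) / 2 \<le> exp ?b - 1" by argo
      also have "\<dots> \<le> exp d2 - 1" using ab by simp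
      finally have h: "(exp ?b - exp (- ?b)) / 2 \<le> exp d2 - 1" .
      have h0: "0 \<le> (exp ?b - exp (- ?b)) / 2" using False by simp
      have "- Im (L * cos \<theta>) = L * (sin ?a * ((exp ?b - exp (- ?b)) / 2))" by (simp add: Im_cos field_simps)
      also have "\<dots> \<le> L * (1 * (exp d2 - 1))" using L sa h h0 by (intro mult_left_mono mult_mono) auto
      also have "\<dots> \<le> \<gamma> / 2" using d2 by simp
      finally show ?thesis .
    qed
    then show ?thesis using 1 \<gamma> by simp
  qed
  define hh where "hh \<theta> = fourier_laplace \<omega> (L * sin \<theta>) (L * cos \<theta>)" for \<theta> :: complex
  have hol: "hh holomorphic_on D"
    unfolding hh_def[abs_def] fourier_laplace_def
  proof (rule holomorphic_on_integral[OF Do _ _ _ f_exp])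
    show "(\<lambda>\<theta>. laplace_kernel \<omega> x (L * sin \<theta>) (L * cos \<theta>)) holomorphic_on D" for x
      unfolding laplace_kernel_def by (intro holomorphic_intros)
    show "norm (laplace_kernel \<omega> x (L * sin \<theta>) (L * cos \<theta>)) \<le> exp (\<gamma> * norm x) * norm (f x)" if "\<theta> \<in> D" for x and \<theta> :: complex
      by (rule laplace_kernel_bound[OF w cond[OF that]])
  qed simp
  define U where "U = complex_of_real ` {pi / 2 - d <..< pi / 2 + d}"
  have U0: "hh \<theta> = 0" if "\<theta> \<in> U" for \<theta>
  proof -
    obtain a where a: "\<theta> = complex_of_real a" using \<open>\<theta> \<in> U\<close> by (auto simp: U_def)
    define v where "v = sin a *\<^sub>R \<omega> + cos a *\<^sub>R e"
    have "v \<bullet> v = (sin a)\<^sup>2 * (\<omega> \<bullet> \<omega>) + (cos a)\<^sup>2 * (e \<bullet> e)"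
      by (simp add: v_def inner_add_left inner_add_right orth inner_commute[of e \<omega>] power2_eq_square)
    also have "\<dots> = 1" using w e1 by (simp add: norm_eq_1)
    finally have "norm v = 1" by (simp add: norm_eq_1)
    have "hh \<theta> = fourier_laplace \<omega> (complex_of_real (L * sin a)) (complex_of_real (L * cos a))" by (simp add: hh_def a sin_of_real cos_of_real)
    also have "\<dots> = ft f (L *\<^sub>R v)" unfolding fourier_laplace_real by (simp add: v_def scaleR_add_right)
    also have "\<dots> = 0" unfolding L_def by (rule z) fact
    finally show ?thesis .
  qed
  have UD: "U \<subseteq> D" using b0 d2 by (auto simp: U_def D_def)
  have p2: "complex_of_real (pi / 2) \<in> D" using d d2 b0 by (simp add: D_def)
  have isl: "complex_of_real (pi / 2) islimpt U"
  proof (rule islimpt_approachable[THEN iffD2], intro allI impI)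
    fix r :: real assume r: "r > 0"
    let ?x = "pi / 2 + min (d / 2) (r / 2)"
    have "complex_of_real ?x \<in> U" unfolding U_def by (rule imageI) (use d r in auto)
    moreover have "complex_of_real ?x \<noteq> complex_of_real (pi / 2)" unfolding of_real_eq_iff using d r by simp
    moreover have "dist (complex_of_real ?x) (complex_of_real (pi / 2)) < r" using d r unfolding dist_of_real by (simp add: dist_real_def min_def)
    ultimately show "\<exists>x'\<in>U. x' \<noteq> complex_of_real (pi / 2) \<and> dist x' (complex_of_real (pi / 2)) < r" by blast
  qed
  \<comment> \<open>At this angle the sine is cosh b and the cosine is i sinh b.\<close>
  let ?t = "Complex (pi / 2) (- b)"
  have tD: "?t \<in> D" using d d2 b0 by (simp add: D_def)
  have "hh ?t = 0"
    by (rule analytic_continuation[OF hol Do Dc UD p2 isl _ tD]) (rule U0)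
  moreover have "L * sin ?t = complex_of_real \<rho>"
    using L by (simp add: complex_eq_iff Re_sin Im_sin eb eb' field_simps)
  moreover have "L * cos ?t = \<i> * s"
    using L by (simp add: complex_eq_iff Re_cos Im_cos eb eb' field_simps)
  ultimately show ?thesis by (simp add: hh_def)
qed

end

section \<open>Contour shift\<close>

text \<open>A primitive on the half-plane expresses each truncated horizontal integral by its
  endpoint values, so the two integrals differ by increments of the primitive along vertical sides.
  These have length \<tau>, and the integrand on them decays like a Gaussian.\<close>

lemma contour_shift:
  fixes p :: "complex \<Rightarrow> complex"
  assumes d: "\<delta> > 0" and hol: "p holomorphic_on {z. Im z > - \<delta>}" and tau: "\<tau> \<ge> 0" and c: "c > 0"
    and b: "\<And>z. 0 \<le> Im z \<Longrightarrow> Im z \<le> \<tau> \<Longrightarrow> \<bar>Re z\<bar> \<ge> T0 \<Longrightarrow> norm (p z) \<le> C * exp (- c * (Re z)\<^sup>2)"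
  shows "(LINT t|lborel. p (complex_of_real t)) = (LINT t|lborel. p (Complex t \<tau>))"
proof -
  let ?S = "{z. Im z > - \<delta>}"
  have So: "open ?S" by (rule open_halfspace_Im_gt)
  have Sc: "convex ?S" by (rule convex_halfspace_Im_gt)
  obtain P where P': "\<And>x. x \<in> ?S \<Longrightarrow> (P has_field_derivative p x) (at x within ?S)"
    by (rule holomorphic_convex_primitive'[OF Sc So hol], rule that)
  then have P: "(P has_field_derivative p x) (at x)" if "x \<in> ?S" for x
    using P'[OF that] at_within_open[OF that So] by simp
  have cont: "continuous_on ?S p" by (rule holomorphic_on_imp_continuous_on[OF hol])
  have cl: "continuous_on A (\<lambda>t. p (Complex t s))" if "0 \<le> s" for s A
    by (rule continuous_on_compose2[OF cont]) (use that d in \<open>auto simp: Complex_eq intro!: continuous_intros\<close>)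
  have ml[measurable]: "(\<lambda>t. p (Complex t s)) \<in> borel_measurable borel" if "0 \<le> s" for s
    by (rule borel_measurable_continuous_onI[OF cl[OF that]])
  have int: "integrable lborel (\<lambda>t. p (Complex t s))" if s: "0 \<le> s" "s \<le> \<tau>" for s
  proof -
    have "compact ((\<lambda>t. p (Complex t s)) ` {-T0..T0})" by (intro compact_continuous_image cl s) simp
    then have "bounded ((\<lambda>t. p (Complex t s)) ` {-T0..T0})" by (rule compact_imp_bounded)
    then obtain K where K: "K > 0" "\<forall>y\<in>(\<lambda>t. p (Complex t s)) ` {-T0..T0}. norm y \<le> K" unfolding bounded_pos by blast
    have ib: "integrable lborel (\<lambda>t. K * indicator {-T0..T0} t + \<bar>C\<bar> * exp (- c * t\<^sup>2))"
    proof (intro Bochner_Integration.integrable_add integrable_mult_right)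
      show "integrable lborel (indicator {-T0..T0} :: real \<Rightarrow> real)"
        by (rule integrable_real_indicator) (auto simp: emeasure_lborel_Icc_eq)
      show "integrable lborel (\<lambda>t::real. exp (- c * t\<^sup>2))"
        using gauss_integral(1)[OF c, where 'a=real] by simp
    qed
    show ?thesis
    proof (rule Bochner_Integration.integrable_bound[OF ib])
      show "AE t in lborel. norm (p (Complex t s)) \<le> norm (K * indicator {-T0..T0} t + \<bar>C\<bar> * exp (- c * t\<^sup>2))"
      proof (rule AE_I2)
        fix t
        show "norm (p (Complex t s)) \<le> norm (K * indicator {-T0..T0} t + \<bar>C\<bar> * exp (- c * t\<^sup>2))"
        proof (cases "t \<in> {-T0..T0}")
          case True
          then have "norm (p (Complex t s)) \<le> K" using K by auto
          also have "\<dots> \<le> K * indicator {-T0..T0} t + \<bar>C\<bar> * exp (- c * t\<^sup>2)" using True by simp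
          finally show ?thesis by simp
        next
          case False
          then have "norm (p (Complex t s)) \<le> C * exp (- c * t\<^sup>2)" using b[of "Complex t s"] s by (auto simp: abs_le_iff not_le)
          also have "\<dots> \<le> \<bar>C\<bar> * exp (- c * t\<^sup>2)" by (intro mult_right_mono) auto
          finally show ?thesis using False by simp
        qed
      qed
    qed (use ml s in auto)
  qed
  have ftc: "(LINT t|lborel. indicator {- real N..real N} t *\<^sub>R p (Complex t s)) = P (Complex (real N) s) - P (Complex (- real N) s)" if s: "0 \<le> s" for s N
  proof (rule integral_FTC_Icc)
    show "((\<lambda>t. P (Complex t s)) has_vector_derivative p (Complex t s)) (at t within {- real N..real N})" for t
    proof -
      have "((\<lambda>t. Complex t s) has_vector_derivative 1) (at t within {- real N..real N})"
        unfolding Complex_eq by (auto intro!: derivative_eq_intros)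
      then have "(P \<circ> (\<lambda>t. Complex t s) has_vector_derivative (1 * p (Complex t s))) (at t within {- real N..real N})"
        by (rule field_vector_diff_chain_within) (rule has_field_derivative_at_within[OF P], use d s in simp)
      then show ?thesis by (simp add: o_def)
    qed
  qed (use cl s in auto)
  have lim: "(\<lambda>N. P (Complex (real N) s) - P (Complex (- real N) s)) \<longlonglongrightarrow> (LINT t|lborel. p (Complex t s))" if s: "0 \<le> s" "s \<le> \<tau>" for s
    unfolding ftc[OF s(1), symmetric]
  proof (rule integral_dominated_convergence[where w="\<lambda>t. norm (p (Complex t s))"])
    show "AE t in lborel. (\<lambda>N. indicator {- real N..real N} t *\<^sub>R p (Complex t s)) \<longlonglongrightarrow> p (Complex t s)"
    proof (rule AE_I2)
      fix t :: real
      obtain N0 :: nat where "\<bar>t\<bar> \<le> real N0" using real_arch_simple by blast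
      then have "\<forall>N\<ge>N0. indicator {- real N..real N} t *\<^sub>R p (Complex t s) = p (Complex t s)"
        by (auto simp: indicator_def)
      then show "(\<lambda>N. indicator {- real N..real N} t *\<^sub>R p (Complex t s)) \<longlonglongrightarrow> p (Complex t s)"
        by (intro tendsto_eventually) (auto simp: eventually_sequentially)
    qed
    show "integrable lborel (\<lambda>t. norm (p (Complex t s)))" by (intro integrable_norm int s)
  qed (use ml s in \<open>auto simp: indicator_def\<close>)
  \<comment> \<open>The sign \<open>sg\<close> treats the left and the right side together; each is
    a convex segment, on which the mean value inequality applies to the primitive.\<close>
  have side: "(\<lambda>N. P (Complex (sg * real N) \<tau>) - P (Complex (sg * real N) 0)) \<longlonglongrightarrow> 0" if sg: "\<bar>sg\<bar> = 1" for sg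
  proof (rule Lim_null_comparison)
    show "(\<lambda>N. \<tau> * \<bar>C\<bar> * exp (- c * (real N)\<^sup>2)) \<longlonglongrightarrow> 0"
    proof -
      have "filterlim (\<lambda>N. c * (real N)\<^sup>2) at_top sequentially"
        by (intro filterlim_tendsto_pos_mult_at_top[OF tendsto_const c] filterlim_pow_at_top filterlim_real_sequentially) simp
      then have "(\<lambda>N. exp (- (c * (real N)\<^sup>2))) \<longlonglongrightarrow> 0"
        by (intro filterlim_compose[OF exp_at_bot] filterlim_compose[OF filterlim_uminus_at_bot_at_top])
      from tendsto_mult[OF tendsto_const[of "\<tau> * \<bar>C\<bar>"] this] show ?thesis by simp
    qed
    obtain N0 :: nat where N0: "T0 \<le> real N0" using real_arch_simple by blast
    have "norm (P (Complex (sg * real N) \<tau>) - P (Complex (sg * real N) 0)) \<le> \<tau> * \<bar>C\<bar> * exp (- c * (real N)\<^sup>2)" if N: "N \<ge> N0" for N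
    proof -
      let ?V = "{z. Re z = sg * real N} \<inter> {z. Im z \<ge> 0} \<inter> {z. Im z \<le> \<tau>}"
      have rr: "\<bar>sg * real N\<bar> = real N" "(sg * real N)\<^sup>2 = (real N)\<^sup>2" using sg by (auto simp: abs_mult power_mult_distrib abs_square_eq_1)
      have "norm (P (Complex (sg * real N) \<tau>) - P (Complex (sg * real N) 0)) \<le> (\<bar>C\<bar> * exp (- c * (real N)\<^sup>2)) * norm (Complex (sg * real N) \<tau> - Complex (sg * real N) 0)"
      proof (rule field_differentiable_bound[of ?V P p])
        show "convex ?V" by (intro convex_Int convex_halfspace_Im_ge convex_halfspace_Im_le) (auto simp: convex_def algebra_simps distrib_right[symmetric])
        show "(P has_field_derivative p z) (at z within ?V)" if "z \<in> ?V" for z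
          by (rule has_field_derivative_at_within[OF P]) (use that d in auto)
        show "norm (p z) \<le> \<bar>C\<bar> * exp (- c * (real N)\<^sup>2)" if z: "z \<in> ?V" for z
        proof -
          have "norm (p z) \<le> C * exp (- c * (Re z)\<^sup>2)" using z N N0 rr by (intro b) auto
          also have "\<dots> \<le> \<bar>C\<bar> * exp (- c * (real N)\<^sup>2)" using z rr by (auto intro!: mult_right_mono)
          finally show ?thesis .
        qed
      qed (use tau in auto)
      also have "norm (Complex (sg * real N) \<tau> - Complex (sg * real N) 0) = \<tau>" using tau by (simp add: cmod_def)
      finally show ?thesis by (simp add: mult_ac)
    qed
    then show "\<forall>\<^sub>F N in sequentially. norm (P (Complex (sg * real N) \<tau>) - P (Complex (sg * real N) 0)) \<le> \<tau> * \<bar>C\<bar> * exp (- c * (real N)\<^sup>2)"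
      by (auto simp: eventually_sequentially)
  qed
  have "(\<lambda>N. (P (Complex (real N) \<tau>) - P (Complex (- real N) \<tau>)) - (P (Complex (real N) 0) - P (Complex (- real N) 0))) \<longlonglongrightarrow> 0 - 0"
  proof -
    have "(\<lambda>N. (P (Complex (1 * real N) \<tau>) - P (Complex (1 * real N) 0)) - (P (Complex ((-1) * real N) \<tau>) - P (Complex ((-1) * real N) 0))) \<longlonglongrightarrow> 0 - 0"
      by (intro tendsto_diff side) auto
    then show ?thesis by (simp add: algebra_simps)
  qed
  moreover have "(\<lambda>N. (P (Complex (real N) \<tau>) - P (Complex (- real N) \<tau>)) - (P (Complex (real N) 0) - P (Complex (- real N) 0)))
     \<longlonglongrightarrow> (LINT t|lborel. p (Complex t \<tau>)) - (LINT t|lborel. p (Complex t 0))"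
    by (intro tendsto_diff lim) (use tau in auto)
  ultimately have "(LINT t|lborel. p (Complex t \<tau>)) - (LINT t|lborel. p (Complex t 0)) = 0 - 0"
    using LIMSEQ_unique by blast
  then show ?thesis by (simp add: complex_of_real_def)
qed

section \<open>Division by the symbol on lines parallel to e\<close>

context half_space_source
begin

lemma fourier_laplace_holomorphic:
  assumes w: "norm \<omega> = 1"
  shows "fourier_laplace \<omega> (complex_of_real \<rho>) holomorphic_on {w. Im w > - \<gamma>}"
  unfolding fourier_laplace_def[abs_def]
proof (rule holomorphic_on_integral[OF open_halfspace_Im_gt _ _ _ f_exp])
  show "laplace_kernel \<omega> x (complex_of_real \<rho>) holomorphic_on {w. Im w > - \<gamma>}" for x
    unfolding laplace_kernel_def by (intro holomorphic_intros)
  show "norm (laplace_kernel \<omega> x (complex_of_real \<rho>) w) \<le> exp (\<gamma> * norm x) * norm (f x)" if "w \<in> {w. Im w > - \<gamma>}" for x w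
    by (rule laplace_kernel_bound[OF w]) (use that \<gamma> in auto)
qed simp

text \<open>A common Lipschitz constant for \<open>ft f\<close> and, in the variable
  \<open>w\<close> on the closed upper half-plane, for \<open>fourier_laplace\<close>.\<close>

definition first_moment :: real where "first_moment = (LINT x|lborel. norm x * norm (f x))"

lemma first_moment_nonneg: "first_moment \<ge> 0"
  unfolding first_moment_def by (intro Bochner_Integration.integral_nonneg) auto

text \<open>The derivative of the kernel in \<open>w\<close> brings down
  \<open>x \<bullet> e\<close>; on the support the exponential has modulus at most 1 throughout the
  convex upper half-plane.\<close>

lemma fourier_laplace_lipschitz:
  assumes om: "norm \<omega> = 1" and w: "Im w \<ge> 0" "Im w' \<ge> 0"
  shows "norm (fourier_laplace \<omega> (complex_of_real \<rho>) w - fourier_laplace \<omega> (complex_of_real \<rho>) w') \<le> first_moment * norm (w - w')"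
proof -
  have ki: "integrable lborel (\<lambda>x. laplace_kernel \<omega> x (complex_of_real \<rho>) w)" if "Im w \<ge> 0" for w
    by (rule Bochner_Integration.integrable_bound[OF f_exp])
       (use laplace_kernel_bound[OF om, of "complex_of_real \<rho>" w] that \<gamma> in \<open>auto simp: abs_mult\<close>)
  have kl: "norm (laplace_kernel \<omega> x (complex_of_real \<rho>) w - laplace_kernel \<omega> x (complex_of_real \<rho>) w') \<le> norm x * norm (f x) * norm (w - w')" for x
  proof (cases "x \<bullet> e < 0")
    case True
    then show ?thesis by (simp add: laplace_kernel_def f_supp)
  next
    case False
    let ?t = "x \<bullet> e"
    have t: "0 \<le> ?t" "?t \<le> norm x" using False Cauchy_Schwarz_ineq2[of x e] e1 by auto
    have k: "laplace_kernel \<omega> x (complex_of_real \<rho>) v = f x * cis (\<rho> * (x \<bullet> \<omega>)) * exp (\<i> * v * ?t)" for v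
      by (simp add: laplace_kernel_def cis_conv_exp exp_add distrib_left mult_ac)
    have "norm (exp (\<i> * w * ?t) - exp (\<i> * w' * ?t)) \<le> norm x * norm (w - w')"
    proof (rule field_differentiable_bound[of "{v. Im v \<ge> 0}" _ "\<lambda>v. \<i> * ?t * exp (\<i> * v * ?t)"])
      show "convex {v. Im v \<ge> 0}" by (rule convex_halfspace_Im_ge)
      show "((\<lambda>v. exp (\<i> * v * ?t)) has_field_derivative \<i> * ?t * exp (\<i> * v * ?t)) (at v within {v. Im v \<ge> 0})" for v
        by (auto intro!: derivative_eq_intros)
      show "norm (\<i> * ?t * exp (\<i> * v * ?t)) \<le> norm x" if "v \<in> {v. Im v \<ge> 0}" for v
      proof -
        have "norm (\<i> * ?t * exp (\<i> * v * ?t)) = ?t * exp (- (Im v * ?t))" using t by (simp add: norm_mult)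
        also have "\<dots> \<le> ?t * 1" using t that by (intro mult_left_mono) auto
        finally show ?thesis using t by simp
      qed
    qed (use w in auto)
    then have "norm (f x) * norm (exp (\<i> * w * ?t) - exp (\<i> * w' * ?t)) \<le> norm (f x) * (norm x * norm (w - w'))"
      by (intro mult_left_mono) auto
    then show ?thesis unfolding k right_diff_distrib[symmetric] norm_mult by (simp add: mult_ac)
  qed
  have "fourier_laplace \<omega> (complex_of_real \<rho>) w - fourier_laplace \<omega> (complex_of_real \<rho>) w' = (LINT x|lborel. laplace_kernel \<omega> x (complex_of_real \<rho>) w - laplace_kernel \<omega> x (complex_of_real \<rho>) w')"
    unfolding fourier_laplace_def using ki w by simp
  then have "norm (fourier_laplace \<omega> (complex_of_real \<rho>) w - fourier_laplace \<omega> (complex_of_real \<rho>) w') \<le> (LINT x|lborel. norm (laplace_kernel \<omega> x (complex_of_real \<rho>) w - laplace_kernel \<omega> x (complex_of_real \<rho>) w'))"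
    by (simp only: integral_norm_bound)
  also have "\<dots> \<le> (LINT x|lborel. norm x * norm (f x) * norm (w - w'))"
    by (intro Bochner_Integration.integral_mono integrable_norm Bochner_Integration.integrable_diff ki w integrable_mult_left f_moment_integrable kl)
  finally show ?thesis by (simp add: first_moment_def)
qed

text \<open>On this line the symbol is w^2 - r^2. The zero r is always removable. If r is not real,
  then - r lies below the axis and limits \<delta>; if r is real, then - r is removable too. The
  final bound keeps the factor w + r on the left, so that one Lipschitz estimate, for the division
  by w - r, suffices in all cases.\<close>

lemma slice_quotient:
  assumes lam: "lam > 0" and om: "norm \<omega> = 1" and orth: "\<omega> \<bullet> e = 0" and rho: "\<rho> \<ge> 0"
    and z: "\<And>v. norm v = 1 \<Longrightarrow> ft f (sqrt lam *\<^sub>R v) = 0"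
  obtains Q \<delta> r where "\<delta> > 0" "Q holomorphic_on {w. Im w > - \<delta>}" "Im r \<ge> 0" "r\<^sup>2 = complex_of_real (lam - \<rho>\<^sup>2)"
    "\<And>w. Im w > - \<delta> \<Longrightarrow> w\<^sup>2 \<noteq> r\<^sup>2 \<Longrightarrow> Q w = fourier_laplace \<omega> (complex_of_real \<rho>) w / (w\<^sup>2 - r\<^sup>2)"
    "\<And>w. Im w \<ge> 0 \<Longrightarrow> w \<noteq> r \<Longrightarrow> w \<noteq> - r \<Longrightarrow> norm (Q w) * norm (w + r) \<le> first_moment"
proof -
  define F where "F = fourier_laplace \<omega> (complex_of_real \<rho>)"
  define r where "r = csqrt (complex_of_real (lam - \<rho>\<^sup>2))"
  let ?S = "{w. Im w > - \<gamma>}"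
  have So: "open ?S" by (rule open_halfspace_Im_gt)
  have hF: "F holomorphic_on ?S" unfolding F_def by (rule fourier_laplace_holomorphic[OF om])
  have r2: "r\<^sup>2 = complex_of_real (lam - \<rho>\<^sup>2)" by (simp add: r_def)
  have ri: "Im r \<ge> 0" unfolding r_def by (cases "lam - \<rho>\<^sup>2 \<ge> 0") (simp_all add: csqrt_of_real_nonneg csqrt_of_real_nonpos)
  \<comment> \<open>Real zeros of the symbol on this line are points of the sphere.\<close>
  have sph: "F (complex_of_real t) = 0" if "t\<^sup>2 = lam - \<rho>\<^sup>2" for t
  proof -
    define v where "v = (1 / sqrt lam) *\<^sub>R (\<rho> *\<^sub>R \<omega> + t *\<^sub>R e)"
    have "(\<rho> *\<^sub>R \<omega> + t *\<^sub>R e) \<bullet> (\<rho> *\<^sub>R \<omega> + t *\<^sub>R e) = \<rho>\<^sup>2 * (\<omega> \<bullet> \<omega>) + t\<^sup>2 * (e \<bullet> e)"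
      by (simp add: inner_add_left inner_add_right orth inner_commute[of e \<omega>] power2_eq_square)
    also have "\<dots> = lam" using om e1 that by (simp add: norm_eq_1)
    finally have "norm (\<rho> *\<^sub>R \<omega> + t *\<^sub>R e) = sqrt lam" by (simp add: norm_eq_sqrt_inner)
    then have "norm v = 1" using lam by (simp add: v_def)
    then have "ft f (sqrt lam *\<^sub>R v) = 0" by (rule z)
    then show ?thesis using lam by (simp add: F_def fourier_laplace_real v_def)
  qed
  have Fr: "F r = 0"
  proof (cases "lam - \<rho>\<^sup>2 \<ge> 0")
    case True
    then have "r = complex_of_real (sqrt (lam - \<rho>\<^sup>2))" by (simp add: r_def csqrt_of_real_nonneg)
    then show ?thesis using sph[of "sqrt (lam - \<rho>\<^sup>2)"] True by simp
  next
    case False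
    then have "r = \<i> * complex_of_real (sqrt (\<rho>\<^sup>2 - lam))" by (simp add: r_def csqrt_of_real_nonpos)
    moreover have "\<rho> > 0" using rho False lam by (cases "\<rho> = 0") auto
    ultimately show ?thesis
      using fourier_laplace_zero_extension[OF lam om orth z, of "sqrt (\<rho>\<^sup>2 - lam)" \<rho>] False by (simp add: F_def)
  qed
  define P where "P w = (if w = r then deriv F r else (F w - F r) / (w - r))" for w
  have hP: "P holomorphic_on ?S" unfolding P_def[abs_def] by (rule pole_lemma_open[OF hF So])
  have Pb: "norm (P w) \<le> first_moment" if "Im w \<ge> 0" "w \<noteq> r" for w
    using fourier_laplace_lipschitz[OF om that(1) ri, of \<rho>] that by (simp add: P_def F_def norm_divide divide_le_eq)
  have PF: "P w = F w / (w - r)" if "w \<noteq> r" for w using that Fr by (simp add: P_def)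
  show thesis
  proof (cases "Im r > 0")
    case True
    \<comment> \<open>The remaining zero - r has depth \<open>Im r\<close> below the axis.\<close>
    let ?d = "min \<gamma> (Im r)"
    define Q where "Q w = P w / (w + r)" for w
    have nz: "w + r \<noteq> 0" if "Im w > - ?d" for w using that by (auto simp: complex_eq_iff)
    show thesis
    proof (rule that[of ?d Q r])
      show "?d > 0" using True \<gamma> by simp
      show "Q holomorphic_on {w. Im w > - ?d}" unfolding Q_def[abs_def]
        by (intro holomorphic_intros holomorphic_on_subset[OF hP]) (use nz in auto)
      show "Im r \<ge> 0" "r\<^sup>2 = complex_of_real (lam - \<rho>\<^sup>2)" by (fact ri, fact r2)
      show "Q w = fourier_laplace \<omega> (complex_of_real \<rho>) w / (w\<^sup>2 - r\<^sup>2)" if "Im w > - ?d" "w\<^sup>2 \<noteq> r\<^sup>2" for w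
      proof -
        have "w \<noteq> r" using that by auto
        then show ?thesis by (simp add: Q_def PF F_def power2_eq_square algebra_simps)
      qed
      show "norm (Q w) * norm (w + r) \<le> first_moment" if "Im w \<ge> 0" "w \<noteq> r" "w \<noteq> - r" for w
      proof -
        have "w + r \<noteq> 0" using that(3) by (simp add: add_eq_0_iff2)
        then show ?thesis using Pb[OF that(1,2)] by (simp add: Q_def norm_divide)
      qed
    qed
  next
    case False
    then have ri0: "Im r = 0" using ri by simp
    then have rr: "r = complex_of_real (Re r)" by (simp add: complex_eq_iff)
    have rsq: "(Re r)\<^sup>2 = lam - \<rho>\<^sup>2" using r2 rr by (metis of_real_eq_iff of_real_power)
    have Fmr: "F (- r) = 0" using sph[of "- Re r"] rsq rr by (metis of_real_minus power2_minus)
    have Pmr: "P (- r) = 0"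
    proof (cases "r = 0")
      case False
      then have "- r \<noteq> r" by (auto simp: complex_eq_iff)
      from PF[OF this] show ?thesis by (simp add: Fmr)
    next
      case True
      \<comment> \<open>The line is tangent to the sphere and r is a double zero. The bound on
        \<open>ft_quotient\<close> makes F(t) of order t^2 for real t, so the derivative at 0
        vanishes and a second division is possible.\<close>
      have lr: "lam = \<rho>\<^sup>2" using rsq True by simp
      have "0 \<in> ?S" using \<gamma> by simp
      from holomorphic_derivI[OF hF So this] have "((\<lambda>w. (F w - F 0) / (w - 0)) \<longlongrightarrow> deriv F 0) (at 0)"
        by (simp add: has_field_derivative_iff)
      moreover have "filterlim (\<lambda>N. complex_of_real (1 / real (Suc N))) (at 0) sequentially"
        unfolding filterlim_at
      proof
        show "((\<lambda>N. complex_of_real (1 / real (Suc N))) \<longlongrightarrow> 0) sequentially"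
          using tendsto_of_real[OF LIMSEQ_Suc[OF lim_1_over_n, where 'a1=real], where 'a=complex] by simp
        show "\<forall>\<^sub>F N in sequentially. complex_of_real (1 / real (Suc N)) \<in> UNIV \<and> complex_of_real (1 / real (Suc N)) \<noteq> 0"
          unfolding of_real_eq_0_iff by simp
      qed
      ultimately have l1: "(\<lambda>N. (F (complex_of_real (1 / real (Suc N))) - F 0) / (complex_of_real (1 / real (Suc N)) - 0)) \<longlonglongrightarrow> deriv F 0"
        by (rule filterlim_compose)
      have l2: "(\<lambda>N. (F (complex_of_real (1 / real (Suc N))) - F 0) / (complex_of_real (1 / real (Suc N)) - 0)) \<longlonglongrightarrow> 0"
      proof (rule Lim_null_comparison)
        show "(\<lambda>N. first_moment / sqrt lam * (1 / real (Suc N))) \<longlonglongrightarrow> 0"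
          using tendsto_mult[OF tendsto_const[of "first_moment / sqrt lam"] LIMSEQ_Suc[OF lim_1_over_n, where 'a1=real]] by simp
        have tb: "norm ((F (complex_of_real t) - F 0) / (complex_of_real t - 0)) \<le> first_moment / sqrt lam * t" if t: "t > 0" for t
        proof -
          have F0: "F 0 = 0" using Fr True by simp
          let ?y = "\<rho> *\<^sub>R \<omega> + t *\<^sub>R e"
          have "?y \<bullet> ?y = \<rho>\<^sup>2 * (\<omega> \<bullet> \<omega>) + t\<^sup>2 * (e \<bullet> e)"
            by (simp add: inner_add_left inner_add_right orth inner_commute[of e \<omega>] power2_eq_square)
          then have ny: "(norm ?y)\<^sup>2 - lam = t\<^sup>2" using om e1 lr by (simp add: norm_eq_1 power2_norm_eq_inner)
          have "norm (ft_quotient lam f ?y) \<le> first_moment / sqrt lam" unfolding first_moment_def by (rule ft_quotient_bound[OF f_integrable f_moment_integrable lam z])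
          then have "norm (F (complex_of_real t)) \<le> first_moment / sqrt lam * t\<^sup>2"
            unfolding ft_quotient_def ny norm_divide norm_of_real abs_power2 using t
            by (subst (asm) pos_divide_le_eq) (simp_all add: F_def fourier_laplace_real)
          then show ?thesis using t by (simp add: F0 norm_divide divide_le_eq power2_eq_square mult.assoc)
        qed
        show "\<forall>\<^sub>F N in sequentially. norm ((F (complex_of_real (1 / real (Suc N))) - F 0) / (complex_of_real (1 / real (Suc N)) - 0)) \<le> first_moment / sqrt lam * (1 / real (Suc N))"
          by (intro always_eventually allI tb) simp
      qed
      have "deriv F 0 = 0" by (rule LIMSEQ_unique[OF l1 l2])
      then show ?thesis using True by (simp add: P_def)
    qed
    \<comment> \<open>The difference quotient of \<open>P\<close> at its zero - r, with the
      derivative as its value there; this removes the second factor.\<close>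
    define Q where "Q w = (if w = - r then deriv P (- r) else (P w - P (- r)) / (w - (- r)))" for w
    have QP: "Q w = P w / (w + r)" if "w \<noteq> - r" for w using that Pmr by (simp add: Q_def)
    show thesis
    proof (rule that[of \<gamma> Q r])
      show "\<gamma> > 0" by (rule \<gamma>)
      show "Q holomorphic_on {w. Im w > - \<gamma>}" unfolding Q_def[abs_def] by (rule pole_lemma_open[OF hP So])
      show "Im r \<ge> 0" "r\<^sup>2 = complex_of_real (lam - \<rho>\<^sup>2)" by (fact ri, fact r2)
      show "Q w = fourier_laplace \<omega> (complex_of_real \<rho>) w / (w\<^sup>2 - r\<^sup>2)" if "Im w > - \<gamma>" "w\<^sup>2 \<noteq> r\<^sup>2" for w
      proof -
        have "w \<noteq> r" "w \<noteq> - r" using that by auto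
        then show ?thesis by (simp add: QP PF F_def power2_eq_square algebra_simps)
      qed
      show "norm (Q w) * norm (w + r) \<le> first_moment" if "Im w \<ge> 0" "w \<noteq> r" "w \<noteq> - r" for w
      proof -
        have "w + r \<noteq> 0" using that(3) by (simp add: add_eq_0_iff2)
        then show ?thesis using Pb[OF that(1,2)] that by (simp add: QP norm_divide)
      qed
    qed
  qed
qed

end

section \<open>Integration along lines parallel to e\<close>

lemma gauss_shift_real:
  fixes c :: real
  assumes "c > 0"
  shows "integrable lborel (\<lambda>t. exp (- c * (a - t)\<^sup>2))" "(LINT t|lborel. exp (- c * (a - t)\<^sup>2)) = sqrt (pi / c)"
proof -
  have e: "exp (- c * (a - t)\<^sup>2) = exp (- c * (norm (- a + t))\<^sup>2)" for t
    by (simp add: power2_commute[of a t])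
  show "integrable lborel (\<lambda>t. exp (- c * (a - t)\<^sup>2))" unfolding e
    by (rule integrable_lborel_translate[of "\<lambda>t. exp (- c * (norm t)\<^sup>2)"]) (rule gauss_integral[OF assms])
  show "(LINT t|lborel. exp (- c * (a - t)\<^sup>2)) = sqrt (pi / c)" unfolding e
    by (subst integral_lborel_translate[of "\<lambda>t. exp (- c * (norm t)\<^sup>2)"]) (simp, subst gauss_integral(2)[OF assms], simp)
qed

text \<open>A disguised Fubini: averaging with a Gaussian weight of mass one along \<open>e\<close> avoids
  splitting the space into the line spanned by \<open>e\<close> and its orthogonal complement.\<close>

lemma integral_slices:
  fixes \<Phi> :: "'a::euclidean_space \<Rightarrow> complex"
  assumes P: "integrable lborel \<Phi>" and e: "norm e = 1" and c: "c > 0"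
  shows "(LINT y|lborel. \<Phi> y) = (LINT y|lborel. complex_of_real (sqrt (c / pi) * exp (- c * (y \<bullet> e)\<^sup>2)) * (LINT t|lborel. \<Phi> (t *\<^sub>R e + y)))"
    and "integrable lborel (\<lambda>y. complex_of_real (sqrt (c / pi) * exp (- c * (y \<bullet> e)\<^sup>2)) * (LINT t|lborel. \<Phi> (t *\<^sub>R e + y)))"
proof -
  have [measurable]: "\<Phi> \<in> borel_measurable borel" using P by auto
  define w where "w v = sqrt (c / pi) * exp (- c * v\<^sup>2)" for v :: real
  have w0: "w v \<ge> 0" for v using c by (simp add: w_def)
  have [measurable]: "w \<in> borel_measurable borel" unfolding w_def[abs_def] by measurable
  have wi: "integrable lborel (\<lambda>t. w (a - t))" "(LINT t|lborel. w (a - t)) = 1" for a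
  proof -
    show "integrable lborel (\<lambda>t. w (a - t))" unfolding w_def by (intro integrable_mult_right gauss_shift_real c)
    show "(LINT t|lborel. w (a - t)) = 1"
      unfolding w_def using gauss_shift_real(2)[OF c, of a] c by (simp add: real_sqrt_divide)
  qed
  have ee: "e \<bullet> e = 1" using e by (simp add: norm_eq_1)
  \<comment> \<open>Integrating \<open>?k\<close> in t returns \<Phi>, since the weight has mass
    one; the translation of \<open>y\<close> by t e turns \<open>?k\<close> into \<open>?l\<close>,
    the integrand along lines.\<close>
  let ?k = "\<lambda>y t. complex_of_real (w (y \<bullet> e - t)) * \<Phi> y"
  let ?l = "\<lambda>y t. complex_of_real (w (y \<bullet> e)) * \<Phi> (t *\<^sub>R e + y)"
  have ki: "integrable (lborel \<Otimes>\<^sub>M lborel) (case_prod ?k)"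
  proof (rule lborel_pair.Fubini_integrable)
    show "case_prod ?k \<in> borel_measurable (lborel \<Otimes>\<^sub>M lborel)" by measurable
    have "(\<lambda>y. LINT t|lborel. norm (case_prod ?k (y, t))) = (\<lambda>y. norm (\<Phi> y))"
      using w0 wi(2) by (simp add: norm_mult)
    then show "integrable lborel (\<lambda>y. LINT t|lborel. norm (case_prod ?k (y, t)))" using P by simp
    show "AE y in lborel. integrable lborel (\<lambda>t. case_prod ?k (y, t))"
      unfolding split_conv by (intro AE_I2 integrable_mult_left integrable_of_real wi)
  qed
  have tr: "(LINT y|lborel. h (?l y t)) = (LINT y|lborel. h (?k y t))" if "h \<in> borel_measurable borel" for t and h :: "complex \<Rightarrow> 'b::{banach, second_countable_topology}"
  proof -
    note [measurable] = that
    have "(LINT y|lborel. h (?k (t *\<^sub>R e + y) t)) = (LINT y|lborel. h (?k y t))"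
      by (rule integral_lborel_translate) measurable
    then show ?thesis by (simp add: inner_add_left ee)
  qed
  have tri: "integrable lborel (\<lambda>y. ?l y t) \<longleftrightarrow> integrable lborel (\<lambda>y. ?k y t)" for t
  proof
    assume "integrable lborel (\<lambda>y. ?k y t)"
    from integrable_lborel_translate[OF this, of "t *\<^sub>R e"] show "integrable lborel (\<lambda>y. ?l y t)" by (simp add: inner_add_left ee)
  next
    assume "integrable lborel (\<lambda>y. ?l y t)"
    from integrable_lborel_translate[OF this, of "- t *\<^sub>R e"] show "integrable lborel (\<lambda>y. ?k y t)" by (simp add: inner_diff_left ee)
  qed
  have ki': "integrable (lborel \<Otimes>\<^sub>M lborel) (\<lambda>(t, y). ?k y t)" using lborel_pair.integrable_product_swap[OF ki] by (simp add: split_def)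
  have li': "integrable (lborel \<Otimes>\<^sub>M lborel) (\<lambda>(t, y). ?l y t)"
  proof (rule lborel_pair.Fubini_integrable)
    show "(\<lambda>(t, y). ?l y t) \<in> borel_measurable (lborel \<Otimes>\<^sub>M lborel)" by measurable
    have "integrable lborel (\<lambda>t. LINT y|lborel. norm (?k y t))"
    proof -
      have "integrable (lborel \<Otimes>\<^sub>M lborel) (\<lambda>(t, y). norm (?k y t))" using integrable_norm[OF ki'] by (simp only: split_def)
      then show ?thesis by (rule lborel_pair.integrable_fst)
    qed
    then show "integrable lborel (\<lambda>t. LINT y|lborel. norm (case (t, y) of (t, y) \<Rightarrow> ?l y t))"
      using tr[of norm] by simp
    show "AE t in lborel. integrable lborel (\<lambda>y. case (t, y) of (t, y) \<Rightarrow> ?l y t)"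
      using lborel_pair.AE_integrable_fst[OF ki'] by (simp add: tri)
  qed
  have li: "integrable (lborel \<Otimes>\<^sub>M lborel) (case_prod ?l)" using lborel_pair.integrable_product_swap_iff[of "case_prod ?l"] li' by (simp add: split_def)
  have "(LINT y|lborel. \<Phi> y) = (LINT y|lborel. LINT t|lborel. ?k y t)"
    using wi by (simp add: integral_complex_of_real)
  also have "\<dots> = (LINT t|lborel. LINT y|lborel. ?k y t)" by (rule lborel_pair.Fubini_integral[OF ki, symmetric])
  also have "\<dots> = (LINT t|lborel. LINT y|lborel. ?l y t)" using tr[of "\<lambda>x. x"] by simp
  also have "\<dots> = (LINT y|lborel. LINT t|lborel. ?l y t)" by (rule lborel_pair.Fubini_integral[OF li])
  finally show "(LINT y|lborel. \<Phi> y) = (LINT y|lborel. complex_of_real (sqrt (c / pi) * exp (- c * (y \<bullet> e)\<^sup>2)) * (LINT t|lborel. \<Phi> (t *\<^sub>R e + y)))"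
    by (simp add: w_def)
  show "integrable lborel (\<lambda>y. complex_of_real (sqrt (c / pi) * exp (- c * (y \<bullet> e)\<^sup>2)) * (LINT t|lborel. \<Phi> (t *\<^sub>R e + y)))"
    using lborel_pair.integrable_fst[OF li] by (simp add: w_def)
qed

context half_space_source
begin

text \<open>For almost every s the integrand is a constant times Q E. On the line at height \<tau>
  the modulus of E is exp (\<tau> \<alpha> + t \<tau>^2) times a Gaussian, and Q is at most
  \<open>first_moment\<close> / \<tau>.\<close>

lemma slice_integral_bound:
  assumes lam: "lam > 0" and om: "norm \<omega> = 1" and orth: "\<omega> \<bullet> e = 0" and rho: "\<rho> \<ge> 0"
    and z: "\<And>v. norm v = 1 \<Longrightarrow> ft f (sqrt lam *\<^sub>R v) = 0" and a: "a \<bullet> e < 0" and t: "t > 0"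
  shows "norm (LINT s|lborel. ft_quotient lam f (s *\<^sub>R e + \<rho> *\<^sub>R \<omega>) * (cis ((s *\<^sub>R e + \<rho> *\<^sub>R \<omega>) \<bullet> (- a)) * complex_of_real (exp (- t * (norm (s *\<^sub>R e + \<rho> *\<^sub>R \<omega>))\<^sup>2))))
     \<le> exp (- t * \<rho>\<^sup>2) * (sqrt (pi / t) * (2 * t * first_moment / (- (a \<bullet> e)) * exp (- (a \<bullet> e)\<^sup>2 / (4 * t))))"
proof -
  define \<alpha> where "\<alpha> = a \<bullet> e"
  have al: "\<alpha> < 0" using a by (simp add: \<alpha>_def)
  \<comment> \<open>The minimiser of \<tau> \<alpha> + t \<tau>^2, with minimum - \<alpha>^2 / (4t);
    it is positive because \<alpha> < 0.\<close>
  define \<tau> where "\<tau> = - \<alpha> / (2 * t)"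
  have tau: "\<tau> > 0" using al t by (simp add: \<tau>_def divide_neg_pos)
  obtain Q \<delta> r where d: "\<delta> > 0" and hQ: "Q holomorphic_on {w. Im w > - \<delta>}" and r: "Im r \<ge> 0" "r\<^sup>2 = complex_of_real (lam - \<rho>\<^sup>2)"
    and QF: "\<And>w. Im w > - \<delta> \<Longrightarrow> w\<^sup>2 \<noteq> r\<^sup>2 \<Longrightarrow> Q w = fourier_laplace \<omega> (complex_of_real \<rho>) w / (w\<^sup>2 - r\<^sup>2)"
    and Qb: "\<And>w. Im w \<ge> 0 \<Longrightarrow> w \<noteq> r \<Longrightarrow> w \<noteq> - r \<Longrightarrow> norm (Q w) * norm (w + r) \<le> first_moment"
    by (rule slice_quotient[OF lam om orth rho z], assumption, rule that)
  define E where "E w = exp (- \<i> * w * \<alpha> - t * w\<^sup>2)" for w :: complex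
  have nE: "norm (E w) = exp (Im w * \<alpha> - t * ((Re w)\<^sup>2 - (Im w)\<^sup>2))" for w
    by (simp add: E_def power2_eq_square)
  let ?p = "\<lambda>w. Q w * E w"
  have hp: "?p holomorphic_on {w. Im w > - \<delta>}" unfolding E_def by (intro holomorphic_intros hQ)
  have shift: "(LINT s|lborel. ?p (complex_of_real s)) = (LINT s|lborel. ?p (Complex s \<tau>))"
  proof (rule contour_shift[OF d hp less_imp_le[OF tau] t, of "norm r + 1" "first_moment * exp (t * \<tau>\<^sup>2)"])
    fix w assume w: "0 \<le> Im w" "Im w \<le> \<tau>" "norm r + 1 \<le> \<bar>Re w\<bar>"
    have nw: "norm r + 1 \<le> norm w" using w(3) abs_Re_le_cmod[of w] by linarith
    then have "w \<noteq> r" "w \<noteq> - r" by auto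
    then have q: "norm (Q w) * norm (w + r) \<le> first_moment" by (rule Qb[OF w(1)])
    have "1 \<le> norm (w + r)" using nw norm_diff_ineq[of w r] by linarith
    then have "norm (Q w) * 1 \<le> norm (Q w) * norm (w + r)" by (intro mult_left_mono) auto
    with q have q: "norm (Q w) \<le> first_moment" by simp
    have "(Im w)\<^sup>2 \<le> \<tau>\<^sup>2" using w by (intro power_mono) auto
    then have "t * (Im w)\<^sup>2 \<le> t * \<tau>\<^sup>2" using t by (intro mult_left_mono) auto
    moreover have "Im w * \<alpha> \<le> 0" using w al by (simp add: mult_nonneg_nonpos)
    ultimately have "Im w * \<alpha> - t * ((Re w)\<^sup>2 - (Im w)\<^sup>2) \<le> t * \<tau>\<^sup>2 + (- t * (Re w)\<^sup>2)" by (simp add: right_diff_distrib)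
    then have "norm (E w) \<le> exp (t * \<tau>\<^sup>2) * exp (- t * (Re w)\<^sup>2)" unfolding nE by (simp flip: exp_add)
    then have "norm (Q w) * norm (E w) \<le> first_moment * (exp (t * \<tau>\<^sup>2) * exp (- t * (Re w)\<^sup>2))"
      by (intro mult_mono q) (auto simp: first_moment_nonneg)
    then show "norm (Q w * E w) \<le> first_moment * exp (t * \<tau>\<^sup>2) * exp (- t * (Re w)\<^sup>2)" by (simp add: norm_mult mult.assoc)
  qed
  have fin: "AE s in lborel. (complex_of_real s)\<^sup>2 \<noteq> r\<^sup>2 \<and> Complex s \<tau> \<noteq> r \<and> Complex s \<tau> \<noteq> - r"
  proof -
    have "AE s in lborel. s \<noteq> Re r" "AE s in lborel. s \<noteq> - Re r" by (rule AE_lborel_singleton)+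
    then show ?thesis
    proof eventually_elim
      case (elim s)
      have "w \<noteq> r \<and> w \<noteq> - r" if "Re w = s" for w using elim that by auto
      from this[of "complex_of_real s"] this[of "Complex s \<tau>"] show ?case by (simp add: power2_eq_iff)
    qed
  qed
  have ns: "(norm (s *\<^sub>R e + \<rho> *\<^sub>R \<omega>))\<^sup>2 = s\<^sup>2 + \<rho>\<^sup>2" for s
  proof -
    have "(s *\<^sub>R e + \<rho> *\<^sub>R \<omega>) \<bullet> (s *\<^sub>R e + \<rho> *\<^sub>R \<omega>) = s\<^sup>2 * (e \<bullet> e) + \<rho>\<^sup>2 * (\<omega> \<bullet> \<omega>)"
      by (simp add: inner_add_left inner_add_right orth inner_commute[of e \<omega>] power2_eq_square)
    then show ?thesis using om e1 by (simp add: norm_eq_1 power2_norm_eq_inner)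
  qed
  define k where "k = cis (- (\<rho> * (\<omega> \<bullet> a))) * complex_of_real (exp (- t * \<rho>\<^sup>2))"
  have nk: "norm k = exp (- t * \<rho>\<^sup>2)" by (simp add: k_def norm_mult)
  let ?\<Phi> = "\<lambda>s. ft_quotient lam f (s *\<^sub>R e + \<rho> *\<^sub>R \<omega>) * (cis ((s *\<^sub>R e + \<rho> *\<^sub>R \<omega>) \<bullet> (- a)) * complex_of_real (exp (- t * (norm (s *\<^sub>R e + \<rho> *\<^sub>R \<omega>))\<^sup>2)))"
  have eq: "?\<Phi> s = k * ?p (complex_of_real s)" if "(complex_of_real s)\<^sup>2 \<noteq> r\<^sup>2" for s
  proof -
    have "ft_quotient lam f (s *\<^sub>R e + \<rho> *\<^sub>R \<omega>) = Q (complex_of_real s)"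
      unfolding ft_quotient_def ns using QF[of "complex_of_real s"] that d r(2)
      by (simp add: fourier_laplace_real add.commute algebra_simps)
    moreover have "cis ((s *\<^sub>R e + \<rho> *\<^sub>R \<omega>) \<bullet> (- a)) * complex_of_real (exp (- t * (norm (s *\<^sub>R e + \<rho> *\<^sub>R \<omega>))\<^sup>2)) = k * E (complex_of_real s)"
    proof -
      have c: "(s *\<^sub>R e + \<rho> *\<^sub>R \<omega>) \<bullet> (- a) = - (\<rho> * (\<omega> \<bullet> a)) + - (s * \<alpha>)" by (simp add: inner_add_left \<alpha>_def inner_commute[of a e])
      have x: "exp (- t * (s\<^sup>2 + \<rho>\<^sup>2)) = exp (- t * \<rho>\<^sup>2) * exp (- t * s\<^sup>2)" by (simp flip: exp_add add: algebra_simps)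
      have "E (complex_of_real s) = cis (- (s * \<alpha>)) * complex_of_real (exp (- t * s\<^sup>2))"
        unfolding E_def cis_conv_exp exp_of_real[symmetric] exp_add[symmetric] by (simp add: mult_ac)
      then show ?thesis unfolding ns c x k_def cis_mult[symmetric] by (simp add: mult_ac)
    qed
    ultimately show ?thesis by (simp add: mult_ac)
  qed
  have m1: "(\<lambda>s. ?p (complex_of_real s)) \<in> borel_measurable borel"
    by (intro borel_measurable_continuous_onI continuous_on_compose2[OF holomorphic_on_imp_continuous_on[OF hp]] continuous_intros) (use d in auto)
  have [measurable]: "ft_quotient lam f \<in> borel_measurable borel" unfolding ft_quotient_def[abs_def] by measurable
  have "(LINT s|lborel. ?\<Phi> s) = (LINT s|lborel. k * ?p (complex_of_real s))"
    by (rule integral_cong_AE) (use m1 fin eq in auto)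
  also have "\<dots> = k * (LINT s|lborel. ?p (Complex s \<tau>))" using shift by simp
  finally have "norm (LINT s|lborel. ?\<Phi> s) = exp (- t * \<rho>\<^sup>2) * norm (LINT s|lborel. ?p (Complex s \<tau>))"
    by (simp only: norm_mult nk)
  also have "norm (LINT s|lborel. ?p (Complex s \<tau>)) \<le> (LINT s|lborel. norm (?p (Complex s \<tau>)))" by (rule integral_norm_bound)
  also have "\<dots> \<le> (LINT s|lborel. first_moment / \<tau> * exp (\<tau> * \<alpha> + t * \<tau>\<^sup>2) * exp (- t * s\<^sup>2))"
  proof (rule integral_mono_AE')
    show "integrable lborel (\<lambda>s. first_moment / \<tau> * exp (\<tau> * \<alpha> + t * \<tau>\<^sup>2) * exp (- t * s\<^sup>2))"
      using gauss_integral(1)[OF t, where 'a=real] by (intro integrable_mult_right) simp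
    show "AE s in lborel. norm (?p (Complex s \<tau>)) \<le> first_moment / \<tau> * exp (\<tau> * \<alpha> + t * \<tau>\<^sup>2) * exp (- t * s\<^sup>2)"
      using fin
    proof eventually_elim
      case (elim s)
      let ?w = "Complex s \<tau>"
      have "norm (Q ?w) * norm (?w + r) \<le> first_moment" using elim tau by (intro Qb) auto
      \<comment> \<open>Since r has nonnegative imaginary part, adding it does not lower the height
        \<tau>.\<close>
      moreover have "\<tau> \<le> norm (?w + r)" using abs_Im_le_cmod[of "?w + r"] r(1) tau by simp
      ultimately have "norm (Q ?w) * \<tau> \<le> first_moment" by (meson mult_left_mono norm_ge_zero order_trans)
      then have q: "norm (Q ?w) \<le> first_moment / \<tau>" using tau by (simp add: le_divide_eq)
      have "norm (E ?w) = exp (\<tau> * \<alpha> + t * \<tau>\<^sup>2) * exp (- t * s\<^sup>2)" unfolding nE by (simp add: algebra_simps flip: exp_add)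
      then show ?case using mult_right_mono[OF q, of "norm (E ?w)"] by (simp add: norm_mult mult.assoc)
    qed
    show "AE s in lborel. 0 \<le> first_moment / \<tau> * exp (\<tau> * \<alpha> + t * \<tau>\<^sup>2) * exp (- t * s\<^sup>2)" using tau by (simp add: first_moment_nonneg)
  qed
  also have "\<dots> = sqrt (pi / t) * (2 * t * first_moment / (- \<alpha>) * exp (- \<alpha>\<^sup>2 / (4 * t)))"
  proof -
    have "\<tau> * \<alpha> + t * \<tau>\<^sup>2 = - \<alpha>\<^sup>2 / (4 * t)" using t by (simp add: \<tau>_def power2_eq_square field_simps)
    moreover have "first_moment / \<tau> = 2 * t * first_moment / (- \<alpha>)" using t al by (simp add: \<tau>_def)
    moreover have "(LINT s|lborel. exp (- t * s\<^sup>2)) = sqrt (pi / t)" using gauss_integral(2)[OF t, where 'a=real] by simp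
    ultimately show ?thesis by (simp add: mult_ac)
  qed
  finally show ?thesis by (simp add: \<alpha>_def mult_left_mono)
qed

text \<open>Here the dimension enters: if \<open>y\<close> is parallel to \<open>e\<close>, a unit
  vector orthogonal to \<open>e\<close> must still be available.\<close>

lemma orthogonal_direction:
  assumes n: "CARD('n) \<ge> 2"
  obtains \<omega> \<rho> where "norm \<omega> = 1" "\<omega> \<bullet> e = 0" "\<rho> \<ge> 0" "y - (y \<bullet> e) *\<^sub>R e = \<rho> *\<^sub>R \<omega>"
proof (cases "y - (y \<bullet> e) *\<^sub>R e = 0")
  case False
  let ?y = "y - (y \<bullet> e) *\<^sub>R e"
  have "?y \<bullet> e = 0" using e1 by (simp add: inner_diff_left norm_eq_1)
  then show thesis using False that[of "?y /\<^sub>R norm ?y" "norm ?y"] by simp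
next
  case True
  have "2 \<le> DIM(real^'n)" using n by simp
  then obtain v where v: "v \<noteq> 0" "orthogonal e v" by (rule orthogonal_to_vector_exists)
  then show thesis using True that[of "v /\<^sub>R norm v" 0] by (simp add: orthogonal_def inner_commute)
qed

text \<open>Slicing with the same parameter t makes the weight exp (- t (y . e)^2) and the
  transversal factor of the slice bound combine to the full Gaussian, whose integral is
  known.\<close>

lemma ft_quotient_gauss_bound:
  assumes n: "CARD('n) \<ge> 2" and lam: "lam > 0"
    and z: "\<And>v. norm v = 1 \<Longrightarrow> ft f (sqrt lam *\<^sub>R v) = 0" and a: "a \<bullet> e < 0" and t: "t > 0"
  shows "norm (LINT y|lborel. ft_quotient lam f y * (cis (y \<bullet> (- a)) * complex_of_real (exp (- t * (norm y)\<^sup>2))))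
     \<le> sqrt (pi / t) ^ CARD('n) * (2 * t * first_moment / (- (a \<bullet> e)) * exp (- (a \<bullet> e)\<^sup>2 / (4 * t)))"
proof -
  let ?G = "\<lambda>y. cis (y \<bullet> (- a)) * complex_of_real (exp (- t * (norm y)\<^sup>2))"
  let ?\<Phi> = "\<lambda>y. ft_quotient lam f y * ?G y"
  let ?B = "2 * t * first_moment / (- (a \<bullet> e)) * exp (- (a \<bullet> e)\<^sup>2 / (4 * t))"
  have G: "gauss_class ?G" by (intro gauss_class_mult poly_class_cis gauss_class_gauss t)
  have [measurable]: "ft_quotient lam f \<in> borel_measurable borel" unfolding ft_quotient_def[abs_def] by measurable
  have Gm[measurable]: "?G \<in> borel_measurable borel" by (rule gauss_class_measurable[OF G])
  have P: "integrable lborel ?\<Phi>"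
  proof (rule Bochner_Integration.integrable_bound[OF integrable_mult_right[OF integrable_norm[OF gauss_class_integrable[OF G]], of "first_moment / sqrt lam"]])
    have "norm (ft_quotient lam f y) \<le> first_moment / sqrt lam" for y
      unfolding first_moment_def by (rule ft_quotient_bound[OF f_integrable f_moment_integrable lam z])
    then have "norm (?\<Phi> y) \<le> first_moment / sqrt lam * norm (?G y)" for y
      unfolding norm_mult[of "ft_quotient lam f y"] by (rule mult_right_mono) simp
    then show "AE y in lborel. norm (?\<Phi> y) \<le> norm (first_moment / sqrt lam * norm (?G y))"
      unfolding real_norm_def by (intro AE_I2 order_trans[OF _ abs_ge_self])
  qed measurable
  have sl: "norm (LINT s|lborel. ?\<Phi> (s *\<^sub>R e + y)) \<le> exp (- t * ((norm y)\<^sup>2 - (y \<bullet> e)\<^sup>2)) * (sqrt (pi / t) * ?B)" for y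
  proof -
    obtain \<omega> \<rho> where w: "norm \<omega> = 1" "\<omega> \<bullet> e = 0" "\<rho> \<ge> 0" "y - (y \<bullet> e) *\<^sub>R e = \<rho> *\<^sub>R \<omega>"
      by (rule orthogonal_direction[OF n, of y], rule that)
    have y: "y = (y \<bullet> e) *\<^sub>R e + \<rho> *\<^sub>R \<omega>" using w(4) by (simp add: algebra_simps)
    \<comment> \<open>The integral over a whole line does not depend on the base point, so the
      component of \<open>y\<close> along \<open>e\<close> is translated away.\<close>
    have "(LINT s|lborel. ?\<Phi> (s *\<^sub>R e + y)) = (LINT s|lborel. ?\<Phi> ((y \<bullet> e + s) *\<^sub>R e + \<rho> *\<^sub>R \<omega>))"
    proof (rule Bochner_Integration.integral_cong[OF refl])
      fix s
      have "s *\<^sub>R e + y = (y \<bullet> e + s) *\<^sub>R e + \<rho> *\<^sub>R \<omega>" by (subst (1) y) (simp add: algebra_simps)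
      then show "?\<Phi> (s *\<^sub>R e + y) = ?\<Phi> ((y \<bullet> e + s) *\<^sub>R e + \<rho> *\<^sub>R \<omega>)" by simp
    qed
    also have "\<dots> = (LINT s|lborel. ?\<Phi> (s *\<^sub>R e + \<rho> *\<^sub>R \<omega>))"
      by (rule integral_lborel_translate[of "\<lambda>s. ?\<Phi> (s *\<^sub>R e + \<rho> *\<^sub>R \<omega>)"]) measurable
    finally have "norm (LINT s|lborel. ?\<Phi> (s *\<^sub>R e + y)) \<le> exp (- t * \<rho>\<^sup>2) * (sqrt (pi / t) * ?B)"
      using slice_integral_bound[OF lam w(1-3) z a t] by simp
    also have "\<rho>\<^sup>2 = (norm y)\<^sup>2 - (y \<bullet> e)\<^sup>2"
    proof -
      have "(norm (\<rho> *\<^sub>R \<omega>))\<^sup>2 = (norm y)\<^sup>2 - (y \<bullet> e)\<^sup>2"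
        unfolding w(4)[symmetric] power2_norm_eq_inner using e1
        by (simp add: inner_diff_left inner_diff_right inner_commute norm_eq_1 power2_eq_square)
      then show ?thesis using w(1) by simp
    qed
    finally show ?thesis .
  qed
  have "norm (LINT y|lborel. ?\<Phi> y) \<le> (LINT y|lborel. norm (complex_of_real (sqrt (t / pi) * exp (- t * (y \<bullet> e)\<^sup>2)) * (LINT s|lborel. ?\<Phi> (s *\<^sub>R e + y))))"
    by (subst integral_slices(1)[OF P e1 t]) (rule integral_norm_bound)
  also have "\<dots> \<le> (LINT y::real^'n|lborel. exp (- t * (norm y)\<^sup>2) * ?B)"
  proof (rule Bochner_Integration.integral_mono)
    show "integrable lborel (\<lambda>y. norm (complex_of_real (sqrt (t / pi) * exp (- t * (y \<bullet> e)\<^sup>2)) * (LINT s|lborel. ?\<Phi> (s *\<^sub>R e + y))))"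
      by (rule integrable_norm[OF integral_slices(2)[OF P e1 t]])
    show "integrable lborel (\<lambda>y::real^'n. exp (- t * (norm y)\<^sup>2) * ?B)"
      by (intro integrable_mult_left gauss_integral t)
    fix y
    have "norm (complex_of_real (sqrt (t / pi) * exp (- t * (y \<bullet> e)\<^sup>2)) * (LINT s|lborel. ?\<Phi> (s *\<^sub>R e + y)))
       = (sqrt (t / pi) * exp (- t * (y \<bullet> e)\<^sup>2)) * norm (LINT s|lborel. ?\<Phi> (s *\<^sub>R e + y))"
      using t by (simp only: norm_mult norm_of_real) simp
    also have "\<dots> \<le> (sqrt (t / pi) * exp (- t * (y \<bullet> e)\<^sup>2)) * (exp (- t * ((norm y)\<^sup>2 - (y \<bullet> e)\<^sup>2)) * (sqrt (pi / t) * ?B))"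
      using t by (intro mult_left_mono sl) auto
    also have "\<dots> = (sqrt (t / pi) * sqrt (pi / t)) * ((exp (- t * (y \<bullet> e)\<^sup>2) * exp (- t * ((norm y)\<^sup>2 - (y \<bullet> e)\<^sup>2))) * ?B)"
      by (simp only: mult_ac)
    also have "sqrt (t / pi) * sqrt (pi / t) = 1" using t by (simp flip: real_sqrt_mult)
    also have "exp (- t * (y \<bullet> e)\<^sup>2) * exp (- t * ((norm y)\<^sup>2 - (y \<bullet> e)\<^sup>2)) = exp (- t * (norm y)\<^sup>2)"
      by (simp add: algebra_simps flip: exp_add)
    finally show "norm (complex_of_real (sqrt (t / pi) * exp (- t * (y \<bullet> e)\<^sup>2)) * (LINT s|lborel. ?\<Phi> (s *\<^sub>R e + y))) \<le> exp (- t * (norm y)\<^sup>2) * ?B"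
      by simp
  qed
  also have "\<dots> = sqrt (pi / t) ^ CARD('n) * ?B"
    using gauss_integral(2)[OF t, where 'a="real^'n"] by simp
  finally show ?thesis .
qed

text \<open>A Gaussian modulated by the frequency - a has as its transform a Gaussian centred at a.
  The normalising power of sqrt (pi / t) occurs on both sides and cancels.\<close>

lemma u_gauss_bound:
  assumes n: "CARD('n) \<ge> 2" and lam: "lam > 0" and w: "weak_helm lam u f" and u: "Bstar0_borel u" and a: "a \<bullet> e < 0" and t: "t > 0"
  shows "norm (LINT x|lborel. u x * complex_of_real (exp (- (norm (x - a))\<^sup>2 / (4 * t)))) \<le> 2 * t * first_moment / (- (a \<bullet> e)) * exp (- (a \<bullet> e)\<^sup>2 / (4 * t))"
proof -
  note z = ft_sphere_zero[OF w u f_integrable f_moment_integrable lam]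
  let ?G = "\<lambda>y. cis (y \<bullet> (- a)) * complex_of_real (exp (- t * (norm y)\<^sup>2))"
  have G: "gauss_class ?G" by (intro gauss_class_mult poly_class_cis gauss_class_gauss t)
  have fG: "ft ?G x = complex_of_real (sqrt (pi / t) ^ CARD('n)) * complex_of_real (exp (- (norm (x - a))\<^sup>2 / (4 * t)))" for x
  proof -
    have "ft ?G x = (LINT y|lborel. complex_of_real (exp (- t * (norm y)\<^sup>2)) * cis (y \<bullet> (x - a)))"
      unfolding ft_def by (intro Bochner_Integration.integral_cong refl) (simp add: inner_diff_right mult_ac cis_mult)
    then show ?thesis using gauss_char(2)[OF t, of "x - a"] by simp
  qed
  have p: "sqrt (pi / t) ^ CARD('n) > 0" using t by simp
  have "sqrt (pi / t) ^ CARD('n) * norm (LINT x|lborel. u x * complex_of_real (exp (- (norm (x - a))\<^sup>2 / (4 * t)))) = norm (LINT x|lborel. u x * ft ?G x)"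
  proof -
    have "(LINT x|lborel. u x * ft ?G x) = (LINT x|lborel. complex_of_real (sqrt (pi / t) ^ CARD('n)) * (u x * complex_of_real (exp (- (norm (x - a))\<^sup>2 / (4 * t)))))"
      unfolding fG by (simp add: mult_ac)
    also have "\<dots> = complex_of_real (sqrt (pi / t) ^ CARD('n)) * (LINT x|lborel. u x * complex_of_real (exp (- (norm (x - a))\<^sup>2 / (4 * t))))"
      by (rule integral_mult_right_zero)
    finally show ?thesis using p by (simp only: norm_mult norm_of_real abs_of_pos[OF p])
  qed
  also have "\<dots> = norm (LINT y|lborel. ft_quotient lam f y * ?G y)"
    by (subst u_ft_eq_ft_quotient[OF w u f_integrable f_moment_integrable lam G]) simp
  also have "\<dots> \<le> sqrt (pi / t) ^ CARD('n) * (2 * t * first_moment / (- (a \<bullet> e)) * exp (- (a \<bullet> e)\<^sup>2 / (4 * t)))"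
    by (rule ft_quotient_gauss_bound[OF n lam z a t])
  finally show ?thesis using mult_le_cancel_left_pos[OF p] by blast
qed

end

section \<open>Vanishing in the half-space\<close>

lemma integral_lborel_affine:
  fixes H :: "'a::euclidean_space \<Rightarrow> 'b::{banach, second_countable_topology}"
  assumes [measurable]: "H \<in> borel_measurable borel" and s: "s > 0"
  shows "(LINT a|lborel. H a) = s ^ DIM('a) *\<^sub>R (LINT v|lborel. H (x + s *\<^sub>R v))"
proof -
  have "(LINT a|lborel. H a) = integral\<^sup>L (density (distr lborel borel (\<lambda>v. x + s *\<^sub>R v)) (\<lambda>_. ennreal (\<bar>s\<bar> ^ DIM('a)))) H"
    using lborel_affine[of s x] s by simp
  also have "\<dots> = (LINT v|lborel. s ^ DIM('a) *\<^sub>R H (x + s *\<^sub>R v))"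
    using s by (subst integral_density) (auto simp: integral_distr)
  finally show ?thesis by simp
qed

text \<open>The Gaussian is a multiple of the transform of another Gaussian, with t = 1/(4c), so the
  general pairing lemma applies.\<close>

lemma Bstar0_borel_gauss_integrable:
  fixes u :: "'a::euclidean_space \<Rightarrow> complex"
  assumes u: "Bstar0_borel u" and c: "c > 0"
  shows "integrable lborel (\<lambda>x. norm (u x) * exp (- c * (norm x)\<^sup>2))"
proof -
  define t where "t = 1 / (4 * c)"
  have t: "t > 0" using c by (simp add: t_def)
  define K where "K = sqrt (pi / t) ^ DIM('a)"
  have K: "K > 0" using t by (simp add: K_def)
  have "ft (\<lambda>y::'a. complex_of_real (exp (- t * (norm y)\<^sup>2))) x = complex_of_real (K * exp (- c * (norm x)\<^sup>2))" for x
    unfolding ft_def gauss_char(2)[OF t] using c by (simp add: K_def) (simp add: t_def)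
  then have "integrable lborel (\<lambda>x. u x * complex_of_real (K * exp (- c * (norm x)\<^sup>2)))"
    using gauss_class_pairing_integrable[OF u gauss_class_gauss[OF t]] by simp
  from integrable_mult_right[OF integrable_norm[OF this], of "1 / K"]
  show ?thesis using K by (simp add: norm_mult abs_mult)
qed

lemma power_exp_tendsto_0:
  fixes c :: real
  assumes c: "c > 0"
  shows "(\<lambda>k. real (Suc k) ^ n * exp (- c * real (Suc k))) \<longlonglongrightarrow> 0"
proof -
  have "filterlim (\<lambda>k. c * real (Suc k)) at_top sequentially"
    by (intro filterlim_tendsto_pos_mult_at_top[OF tendsto_const c] filterlim_compose[OF filterlim_real_sequentially filterlim_Suc])
  from filterlim_compose[OF tendsto_power_div_exp_0 this, of n]
  have "(\<lambda>k. (1 / c ^ n) * ((c * real (Suc k)) ^ n / exp (c * real (Suc k)))) \<longlonglongrightarrow> (1 / c ^ n) * 0"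
    by (intro tendsto_intros)
  moreover have "(1 / c ^ n) * ((c * real (Suc k)) ^ n / exp (c * real (Suc k))) = real (Suc k) ^ n * exp (- c * real (Suc k))" for k
  proof -
    have "exp (- c * real (Suc k)) = inverse (exp (c * real (Suc k)))" unfolding exp_minus[symmetric] by simp
    moreover have "(1 / c ^ n) * ((c ^ n * X) / E) = X * inverse E" for X E :: real using c by (simp add: divide_inverse)
    ultimately show ?thesis unfolding power_mult_distrib by (simp only:)
  qed
  ultimately show ?thesis by simp
qed

context half_space_source
begin

text \<open>Integrate the Gaussian bounds over centres in the cube. By Fubini this pairs
  \<open>u\<close> with a mollified indicator. The bound exp (- d^2 / (4t)) beats the power of the
  width lost in the normalisation, and the mollified indicators converge off the frontier of the
  cube.\<close>

lemma integral_cube_zero: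
  assumes n: "CARD('n) \<ge> 2" and lam: "lam > 0" and w: "weak_helm lam u f" and u: "Bstar0_borel u"
    and B: "cbox p q \<subseteq> {x. x \<bullet> e < 0}"
  shows "(LINT x|lborel. u x * indicator (cbox p q) x) = 0"
proof -
  let ?B = "cbox p q"
  have [measurable]: "u \<in> borel_measurable borel" using u by (simp add: Bstar0_borel_def)
  \<comment> \<open>By compactness the cube keeps a positive distance from the hyperplane; for an
    empty cube any positive number serves.\<close>
  obtain d where d: "d > 0" "\<And>a. a \<in> ?B \<Longrightarrow> a \<bullet> e \<le> - d"
  proof (cases "?B = {}")
    case True
    then show ?thesis using that[of 1] by simp
  next
    case False
    have "\<exists>x\<in>?B. \<forall>y\<in>?B. y \<bullet> e \<le> x \<bullet> e"
      by (rule continuous_attains_sup[OF compact_cbox False]) (intro continuous_intros)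
    then obtain x where x: "x \<in> ?B" "\<forall>y\<in>?B. y \<bullet> e \<le> x \<bullet> e" by blast
    then show ?thesis using that[of "- (x \<bullet> e)"] B by auto
  qed
  obtain R where R: "R > 0" "\<And>a. a \<in> ?B \<Longrightarrow> norm a \<le> R" using bounded_cbox[of p q] unfolding bounded_pos by blast
  define I where "I = (LINT v::real^'n|lborel. exp (- (norm v)\<^sup>2 / 4))"
  have I: "I > 0"
    unfolding I_def using gauss_integral(2)[of "1/4", where 'a="real^'n"] by simp
  define s where "s k = 1 / real (Suc k)" for k
  have s: "s k > 0" "s k \<le> 1" for k by (auto simp: s_def)
  have s0: "s \<longlonglongrightarrow> 0" unfolding s_def[abs_def] using LIMSEQ_Suc[OF lim_1_over_n, where 'a1=real] by simp
  \<comment> \<open>The mollified indicator after the substitution a = x + s v, with Gaussian time t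
    = s^2; its limit carries the unnormalised mass \<open>I\<close>.\<close>
  define \<psi> where "\<psi> k x = (LINT v|lborel. indicator ?B (x + s k *\<^sub>R v) * exp (- (norm v)\<^sup>2 / 4))" for k x
  have [measurable]: "\<psi> k \<in> borel_measurable borel" for k unfolding \<psi>_def[abs_def] by measurable
  have g4: "integrable lborel (\<lambda>v::real^'n. exp (- (norm v)\<^sup>2 / 4))" using gauss_integral(1)[of "1/4", where 'a="real^'n"] by simp
  have g8: "integrable lborel (\<lambda>v::real^'n. exp (- (norm v)\<^sup>2 / 8))" using gauss_integral(1)[of "1/8", where 'a="real^'n"] by simp
  define K where "K = exp (R\<^sup>2 / 16) * (LINT v::real^'n|lborel. exp (- (norm v)\<^sup>2 / 8))"
  have \<psi>0: "\<psi> k x \<ge> 0" for k x unfolding \<psi>_def by (intro Bochner_Integration.integral_nonneg) auto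
  \<comment> \<open>On the cube |x|^2 \<le> 2 R^2 + 2 |v|^2. A quarter of the exponent |v|^2 / 4
    pays for the decay 1/32 in x, half of it remains for the integral in v, and the factor with R^2
    / 16 absorbs the rest.\<close>
  have \<psi>b: "\<psi> k x \<le> K * exp (- (1/32) * (norm x)\<^sup>2)" for k x
  proof -
    have "\<psi> k x \<le> (LINT v::real^'n|lborel. exp (R\<^sup>2 / 16) * exp (- (1/32) * (norm x)\<^sup>2) * exp (- (norm v)\<^sup>2 / 8))"
      unfolding \<psi>_def
    proof (rule Bochner_Integration.integral_mono)
      show "integrable lborel (\<lambda>v. indicator ?B (x + s k *\<^sub>R v) * exp (- (norm v)\<^sup>2 / 4))"
        by (rule Bochner_Integration.integrable_bound[OF g4]) (auto simp: indicator_def)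
      show "integrable lborel (\<lambda>v::real^'n. exp (R\<^sup>2 / 16) * exp (- (1/32) * (norm x)\<^sup>2) * exp (- (norm v)\<^sup>2 / 8))" by (intro integrable_mult_right g8)
      fix v
      show "indicator ?B (x + s k *\<^sub>R v) * exp (- (norm v)\<^sup>2 / 4) \<le> exp (R\<^sup>2 / 16) * exp (- (1/32) * (norm x)\<^sup>2) * exp (- (norm v)\<^sup>2 / 8)"
      proof (cases "x + s k *\<^sub>R v \<in> ?B")
        case True
        have "norm x \<le> norm (x + s k *\<^sub>R v) + norm (s k *\<^sub>R v)" by (metis add_diff_cancel norm_triangle_ineq4)
        also have "\<dots> \<le> R + 1 * norm v" unfolding norm_scaleR using R(2)[OF True] s[of k] by (intro add_mono mult_right_mono) auto
        finally have "(norm x)\<^sup>2 \<le> (R + norm v)\<^sup>2" by (intro power_mono) auto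
        also have "\<dots> \<le> 2 * R\<^sup>2 + 2 * (norm v)\<^sup>2" using sum_squares_bound[of R "norm v"] by (simp add: power2_eq_square algebra_simps)
        finally have "- (norm v)\<^sup>2 / 4 \<le> R\<^sup>2 / 16 + (- (1/32) * (norm x)\<^sup>2) + (- (norm v)\<^sup>2 / 8)"
          using zero_le_power2[of "norm v"] by argo
        then show ?thesis using True by (simp flip: exp_add)
      qed simp
    qed
    then show ?thesis by (simp add: K_def mult_ac)
  qed
  have K0: "K \<ge> 0" unfolding K_def by (intro mult_nonneg_nonneg Bochner_Integration.integral_nonneg) auto
  have subst: "(LINT a|lborel. indicator ?B a * exp (- (norm (x - a))\<^sup>2 / (4 * (s k)\<^sup>2))) = s k ^ CARD('n) * \<psi> k x" for k x
  proof -
    have A: "(LINT a|lborel. indicator ?B a * exp (- (norm (x - a))\<^sup>2 / (4 * (s k)\<^sup>2)))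
       = s k ^ DIM(real^'n) *\<^sub>R (LINT v|lborel. indicator ?B (x + s k *\<^sub>R v) * exp (- (norm (x - (x + s k *\<^sub>R v)))\<^sup>2 / (4 * (s k)\<^sup>2)))"
      by (rule integral_lborel_affine[OF _ s(1)]) measurable
    have e: "- (norm (x - (x + s k *\<^sub>R v)))\<^sup>2 / (4 * (s k)\<^sup>2) = - (norm v)\<^sup>2 / 4" for v
      using s(1)[of k] by (simp add: power_mult_distrib)
    show ?thesis unfolding A e \<psi>_def by simp
  qed
  have small: "norm (LINT x|lborel. u x * complex_of_real (\<psi> k x)) \<le> measure lborel ?B * (2 * first_moment / d) * (real (Suc k) ^ CARD('n) * exp (- (d\<^sup>2 / 4) * real (Suc k)))" for k
  proof -
    let ?t = "(s k)\<^sup>2"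
    have t: "?t > 0" using s(1)[of k] by simp
    let ?k = "\<lambda>x a. u x * complex_of_real (indicator ?B a * exp (- (norm (x - a))\<^sup>2 / (4 * ?t)))"
    have ai: "integrable lborel (\<lambda>a. indicator ?B a * exp (- (norm (x - a))\<^sup>2 / (4 * ?t)))" for x
    proof -
      have "integrable lborel (indicator ?B :: _ \<Rightarrow> real)" by (rule integrable_real_indicator) (use emeasure_bounded_finite[OF bounded_cbox] in auto)
      then show ?thesis using t by (rule_tac Bochner_Integration.integrable_bound) (auto simp: indicator_def)
    qed
    have ki: "integrable (lborel \<Otimes>\<^sub>M lborel) (\<lambda>(x, a). ?k x a)"
    proof (rule lborel_pair.Fubini_integrable)
      show "(\<lambda>(x, a). ?k x a) \<in> borel_measurable (lborel \<Otimes>\<^sub>M lborel)" by measurable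
      have "(LINT a|lborel. norm (?k x a)) = norm (u x) * (s k ^ CARD('n) * \<psi> k x)" for x
        unfolding subst[symmetric] by (simp add: norm_mult abs_mult)
      moreover have "integrable lborel (\<lambda>x. norm (u x) * (s k ^ CARD('n) * \<psi> k x))"
      proof (rule Bochner_Integration.integrable_bound[OF integrable_mult_right[OF Bstar0_borel_gauss_integrable[OF u, of "1/32"], of "s k ^ CARD('n) * K"]])
        have "norm (u x) * (s k ^ CARD('n) * \<psi> k x) \<le> norm (u x) * (s k ^ CARD('n) * (K * exp (- (1/32) * (norm x)\<^sup>2)))" for x
          using s(1)[of k] by (intro mult_left_mono \<psi>b) auto
        then show "AE x in lborel. norm (norm (u x) * (s k ^ CARD('n) * \<psi> k x)) \<le> norm (s k ^ CARD('n) * K * (norm (u x) * exp (- (1/32) * (norm x)\<^sup>2)))"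
          using s(1)[of k] \<psi>0 K0 by (intro AE_I2) (simp add: abs_mult mult_ac)
      qed auto
      ultimately show "integrable lborel (\<lambda>x. LINT a|lborel. norm (case (x, a) of (x, a) \<Rightarrow> ?k x a))" by simp
      show "AE x in lborel. integrable lborel (\<lambda>a. case (x, a) of (x, a) \<Rightarrow> ?k x a)"
        unfolding split_conv by (intro AE_I2 integrable_mult_right integrable_of_real ai)
    qed
    have "s k ^ CARD('n) * norm (LINT x|lborel. u x * complex_of_real (\<psi> k x)) = norm (LINT x|lborel. LINT a|lborel. ?k x a)"
    proof -
      have sx: "(LINT a|lborel. ?k x a) = complex_of_real (s k ^ CARD('n)) * (u x * complex_of_real (\<psi> k x))" for x
        by (subst integral_mult_right_zero, subst integral_complex_of_real, subst subst) (simp add: mult_ac)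
      have "(LINT x|lborel. LINT a|lborel. ?k x a) = complex_of_real (s k ^ CARD('n)) * (LINT x|lborel. u x * complex_of_real (\<psi> k x))"
        unfolding sx by (rule integral_mult_right_zero)
      then show ?thesis using s(1)[of k] by (simp add: norm_mult norm_power)
    qed
    also have "(LINT x|lborel. LINT a|lborel. ?k x a) = (LINT a|lborel. LINT x|lborel. ?k x a)"
      by (rule lborel_pair.Fubini_integral[OF ki, symmetric])
    also have "norm \<dots> \<le> (LINT a|lborel. norm (LINT x|lborel. ?k x a))" by (rule integral_norm_bound)
    also have "\<dots> \<le> (LINT a|lborel. indicator ?B a * (2 * ?t * first_moment / d * exp (- d\<^sup>2 / (4 * ?t))))"
    proof (rule integral_mono_AE')
      show "integrable lborel (\<lambda>a. indicator ?B a * (2 * ?t * first_moment / d * exp (- d\<^sup>2 / (4 * ?t))))"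
        by (intro integrable_mult_left integrable_real_indicator) (use emeasure_bounded_finite[OF bounded_cbox] in auto)
      show "AE a in lborel. 0 \<le> indicator ?B a * (2 * ?t * first_moment / d * exp (- d\<^sup>2 / (4 * ?t)))" using d(1) first_moment_nonneg by simp
      show "AE a in lborel. norm (LINT x|lborel. ?k x a) \<le> indicator ?B a * (2 * ?t * first_moment / d * exp (- d\<^sup>2 / (4 * ?t)))"
      proof (rule AE_I2)
        fix a
        show "norm (LINT x|lborel. ?k x a) \<le> indicator ?B a * (2 * ?t * first_moment / d * exp (- d\<^sup>2 / (4 * ?t)))"
        proof (cases "a \<in> ?B")
          case True
          have ae: "a \<bullet> e \<le> - d" by (rule d(2)[OF True])
          have "norm (LINT x|lborel. ?k x a) = norm (LINT x|lborel. u x * complex_of_real (exp (- (norm (x - a))\<^sup>2 / (4 * ?t))))"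
            using True by simp
          also have "\<dots> \<le> 2 * ?t * first_moment / (- (a \<bullet> e)) * exp (- (a \<bullet> e)\<^sup>2 / (4 * ?t))"
            by (rule u_gauss_bound[OF n lam w u _ t]) (use ae d in auto)
          also have "\<dots> \<le> 2 * ?t * first_moment / d * exp (- d\<^sup>2 / (4 * ?t))"
          proof (rule mult_mono)
            show "2 * ?t * first_moment / (- (a \<bullet> e)) \<le> 2 * ?t * first_moment / d"
              using ae d(1) first_moment_nonneg t by (intro divide_left_mono mult_pos_pos) auto
            have "d\<^sup>2 \<le> (- (a \<bullet> e))\<^sup>2" using ae d(1) by (intro power_mono) auto
            then show "exp (- (a \<bullet> e)\<^sup>2 / (4 * ?t)) \<le> exp (- d\<^sup>2 / (4 * ?t))"
              using t by (simp add: divide_right_mono)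
          qed (use d(1) first_moment_nonneg in auto)
          finally show ?thesis using True by simp
        qed simp
      qed
    qed
    also have "\<dots> = measure lborel ?B * (2 * ?t * first_moment / d * exp (- d\<^sup>2 / (4 * ?t)))"
      using emeasure_bounded_finite[OF bounded_cbox[of p q]] by simp
    finally have "s k ^ CARD('n) * norm (LINT x|lborel. u x * complex_of_real (\<psi> k x)) \<le> measure lborel ?B * (2 * ?t * first_moment / d * exp (- d\<^sup>2 / (4 * ?t)))" .
    \<comment> \<open>Multiplication by the inverse of s^n isolates the pairing with the mollified
      indicator.\<close>
    then have "real (Suc k) ^ CARD('n) * (s k ^ CARD('n) * norm (LINT x|lborel. u x * complex_of_real (\<psi> k x))) \<le> real (Suc k) ^ CARD('n) * (measure lborel ?B * (2 * ?t * first_moment / d * exp (- d\<^sup>2 / (4 * ?t))))"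
      by (rule mult_left_mono) simp
    also have "real (Suc k) ^ CARD('n) * (s k ^ CARD('n) * norm (LINT x|lborel. u x * complex_of_real (\<psi> k x))) = norm (LINT x|lborel. u x * complex_of_real (\<psi> k x))"
    proof -
      have "real (Suc k) ^ CARD('n) * s k ^ CARD('n) = 1" unfolding power_mult_distrib[symmetric] by (simp add: s_def)
      then show ?thesis by (simp only: mult.assoc[symmetric] mult_1)
    qed
    also have "real (Suc k) ^ CARD('n) * (measure lborel ?B * (2 * ?t * first_moment / d * exp (- d\<^sup>2 / (4 * ?t))))
       \<le> real (Suc k) ^ CARD('n) * (measure lborel ?B * (2 * 1 * first_moment / d * exp (- (d\<^sup>2 / 4) * real (Suc k))))"
    proof (intro mult_left_mono mult_mono divide_right_mono mult_right_mono)
      show "?t \<le> 1" using s[of k] by (simp add: power_le_one)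
      \<comment> \<open>The square of k + 1 is replaced by k + 1, which still beats every
        power.\<close>
      have "d\<^sup>2 / (4 * ?t) = d\<^sup>2 / 4 * (real (Suc k))\<^sup>2" by (simp add: s_def power_divide)
      also have "\<dots> \<ge> d\<^sup>2 / 4 * real (Suc k)" by (intro mult_left_mono) (auto simp: power2_eq_square)
      finally show "exp (- d\<^sup>2 / (4 * ?t)) \<le> exp (- (d\<^sup>2 / 4) * real (Suc k))" by simp
    qed (use d(1) first_moment_nonneg in auto)
    finally show ?thesis by (simp add: mult_ac)
  qed
  have lim0: "(\<lambda>k. LINT x|lborel. u x * complex_of_real (\<psi> k x)) \<longlonglongrightarrow> 0"
  proof (rule Lim_null_comparison)
    have "d\<^sup>2 / 4 > 0" using d(1) by simp
    from tendsto_mult[OF tendsto_const[of "measure lborel ?B * (2 * first_moment / d)"] power_exp_tendsto_0[OF this, of "CARD('n)"]]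
    show "(\<lambda>k. measure lborel ?B * (2 * first_moment / d) * (real (Suc k) ^ CARD('n) * exp (- (d\<^sup>2 / 4) * real (Suc k)))) \<longlonglongrightarrow> 0" by simp
    show "\<forall>\<^sub>F k in sequentially. norm (LINT x|lborel. u x * complex_of_real (\<psi> k x)) \<le> measure lborel ?B * (2 * first_moment / d) * (real (Suc k) ^ CARD('n) * exp (- (d\<^sup>2 / 4) * real (Suc k)))"
      by (intro always_eventually allI small)
  qed
  have \<psi>lim: "(\<lambda>k. \<psi> k x) \<longlonglongrightarrow> indicator ?B x * I" if x: "x \<notin> frontier ?B" for x
  proof -
    have "(\<lambda>k. \<psi> k x) \<longlonglongrightarrow> (LINT v::real^'n|lborel. indicator ?B x * exp (- (norm v)\<^sup>2 / 4))"
      unfolding \<psi>_def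
    proof (rule integral_dominated_convergence[where w="\<lambda>v. exp (- (norm v)\<^sup>2 / 4)"])
      show "AE v in lborel. (\<lambda>k. indicator ?B (x + s k *\<^sub>R v) * exp (- (norm v)\<^sup>2 / 4)) \<longlonglongrightarrow> indicator ?B x * exp (- (norm v)\<^sup>2 / 4)"
      proof (rule AE_I2)
        fix v
        have "(\<lambda>k. x + s k *\<^sub>R v) \<longlonglongrightarrow> x + 0 *\<^sub>R v" by (intro tendsto_intros s0)
        then have l: "(\<lambda>k. x + s k *\<^sub>R v) \<longlonglongrightarrow> x" by simp
        have "x \<in> interior ?B \<or> x \<in> - ?B" using x by (auto simp: frontier_def)
        then have "\<forall>\<^sub>F k in sequentially. indicator ?B (x + s k *\<^sub>R v) = (indicator ?B x :: real)"
        proof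
          assume xi: "x \<in> interior ?B"
          then have "\<forall>\<^sub>F k in sequentially. x + s k *\<^sub>R v \<in> interior ?B" by (intro topological_tendstoD[OF l]) auto
          then show ?thesis by eventually_elim (use xi box_subset_cbox[of p q] in \<open>auto simp: indicator_def\<close>)
        next
          assume xi: "x \<in> - ?B"
          then have "\<forall>\<^sub>F k in sequentially. x + s k *\<^sub>R v \<in> - ?B" by (intro topological_tendstoD[OF l]) auto
          then show ?thesis by eventually_elim (use xi in \<open>auto simp: indicator_def\<close>)
        qed
        then have "\<forall>\<^sub>F k in sequentially. indicator ?B (x + s k *\<^sub>R v) * exp (- (norm v)\<^sup>2 / 4) = indicator ?B x * exp (- (norm v)\<^sup>2 / 4)"
          by eventually_elim simp
        then show "(\<lambda>k. indicator ?B (x + s k *\<^sub>R v) * exp (- (norm v)\<^sup>2 / 4)) \<longlonglongrightarrow> indicator ?B x * exp (- (norm v)\<^sup>2 / 4)"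
          by (rule tendsto_eventually)
      qed
    qed (use g4 in \<open>auto simp: indicator_def\<close>)
    then show ?thesis by (simp add: I_def)
  qed
  have fr: "AE x in lborel. x \<notin> frontier ?B"
  proof -
    have "negligible (frontier ?B)" by (rule negligible_convex_frontier) (rule convex_box)
    then have "emeasure lebesgue (frontier ?B) = 0" by (simp add: negligible_iff_emeasure0 negligible_imp_sets)
    then have "emeasure lborel (frontier ?B) = 0" by simp
    then show ?thesis by (intro AE_not_in) (auto simp: null_sets_def)
  qed
  have lim1: "(\<lambda>k. LINT x|lborel. u x * complex_of_real (\<psi> k x)) \<longlonglongrightarrow> (LINT x|lborel. u x * complex_of_real (indicator ?B x * I))"
  proof (rule integral_dominated_convergence[where w="\<lambda>x. K * (norm (u x) * exp (- (1/32) * (norm x)\<^sup>2))"])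
    show "integrable lborel (\<lambda>x. K * (norm (u x) * exp (- (1/32) * (norm x)\<^sup>2)))" by (intro integrable_mult_right Bstar0_borel_gauss_integrable u) simp
    show "AE x in lborel. (\<lambda>k. u x * complex_of_real (\<psi> k x)) \<longlonglongrightarrow> u x * complex_of_real (indicator ?B x * I)"
      using fr by eventually_elim (intro tendsto_intros \<psi>lim)
    show "AE x in lborel. norm (u x * complex_of_real (\<psi> k x)) \<le> K * (norm (u x) * exp (- (1/32) * (norm x)\<^sup>2))" for k
    proof (rule AE_I2)
      fix x
      have "norm (u x) * \<psi> k x \<le> norm (u x) * (K * exp (- (1/32) * (norm x)\<^sup>2))" by (intro mult_left_mono \<psi>b) auto
      then show "norm (u x * complex_of_real (\<psi> k x)) \<le> K * (norm (u x) * exp (- (1/32) * (norm x)\<^sup>2))"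
        using \<psi>0[of k x] by (simp add: norm_mult mult_ac)
    qed
  qed measurable
  have "(LINT x|lborel. u x * complex_of_real (indicator ?B x * I)) = 0" by (rule LIMSEQ_unique[OF lim1 lim0])
  moreover have "(LINT x|lborel. u x * complex_of_real (indicator ?B x * I)) = complex_of_real I * (LINT x|lborel. u x * indicator ?B x)"
    by (subst integral_mult_right_zero[symmetric]) (intro Bochner_Integration.integral_cong refl, simp add: indicator_def)
  ultimately show ?thesis using I by simp
qed

text \<open>Lebesgue differentiation over the cubes with lower corner x: all their averages are 0
  once they are small enough to stay in the half-space.\<close>

lemma vanishes_AE:
  assumes n: "CARD('n) \<ge> 2" and lam: "lam > 0" and w: "weak_helm lam u f" and u: "Bstar0_borel u"
  shows "AE x in lebesgue. x \<bullet> e < 0 \<longrightarrow> u x = 0"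
proof -
  have [measurable]: "u \<in> borel_measurable borel" using u by (simp add: Bstar0_borel_def)
  have si: "set_integrable lborel (cbox p q) u" for p q
  proof -
    obtain R where R: "\<And>a. a \<in> cbox p q \<Longrightarrow> norm a \<le> R" using bounded_cbox[of p q] unfolding bounded_pos by blast
    have "integrable lborel (\<lambda>x. u x * indicator (cbox p q) x)"
    proof (rule Bstar0_borel_mult_integrable[OF u, of _ 1 "R + 1"])
      show "indicator (cbox p q) x = (0::complex)" if "R + 1 \<le> norm x" for x
        using R[of x] that by (auto simp: indicator_def)
    qed (auto simp: indicator_def)
    moreover have "(\<lambda>x. u x * indicator (cbox p q) x) = (\<lambda>x. indicator (cbox p q) x *\<^sub>R u x)" by (auto simp: indicator_def)
    ultimately show ?thesis unfolding set_integrable_def by simp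
  qed
  have z: "integral (cbox p q) u = 0" if "cbox p q \<subseteq> {x. x \<bullet> e < 0}" for p q
  proof -
    have "(LINT x|lborel. u x * indicator (cbox p q) x) = (LINT x:cbox p q|lborel. u x)"
      unfolding set_lebesgue_integral_def by (intro Bochner_Integration.integral_cong refl) (simp add: indicator_def)
    then show ?thesis using integral_cube_zero[OF n lam w u that] set_borel_integral_eq_integral(2)[OF si[of p q]] by simp
  qed
  have uib: "\<And>p q. u integrable_on cbox p q" by (rule set_borel_integral_eq_integral(1)[OF si])
  obtain N where N: "negligible N"
    "\<And>x r. x \<notin> N \<Longrightarrow> 0 < r \<Longrightarrow> \<exists>d>0. \<forall>h. 0 < h \<and> h < d \<longrightarrow> norm (integral (cbox x (x + h *\<^sub>R One)) u /\<^sub>R h ^ DIM(real^'n) - u x) < r"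
    by (rule integrable_ccontinuous_explicit[OF uib], rule that)
  have "u x = 0" if x: "x \<notin> N" "x \<bullet> e < 0" for x
  proof (rule ccontr)
    assume "u x \<noteq> 0"
    then have "0 < norm (u x)" by simp
    from N(2)[OF x(1) this] obtain d where d: "d > 0" "\<And>h. 0 < h \<Longrightarrow> h < d \<Longrightarrow> norm (integral (cbox x (x + h *\<^sub>R One)) u /\<^sub>R h ^ DIM(real^'n) - u x) < norm (u x)" by blast
    define c where "c = norm (One :: real^'n)"
    have c: "c > 0" unfolding c_def using One_non_0 by simp
    \<comment> \<open>The diagonal of the cube has length h c, at most half the distance from x to
      the hyperplane.\<close>
    define h where "h = min (d / 2) (- (x \<bullet> e) / (2 * c))"
    have h: "0 < h" "h < d" "h * c < - (x \<bullet> e)"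
    proof -
      show "0 < h" using d x c by (simp add: h_def divide_neg_pos)
      show "h < d" using d by (auto simp: h_def)
      have "h * c \<le> - (x \<bullet> e) / (2 * c) * c" using c by (intro mult_right_mono) (auto simp: h_def)
      then show "h * c < - (x \<bullet> e)" using c x by simp
    qed
    have "cbox x (x + h *\<^sub>R One) \<subseteq> {x. x \<bullet> e < 0}"
    proof
      fix y assume y: "y \<in> cbox x (x + h *\<^sub>R One)"
      have "norm (y - x) \<le> norm (h *\<^sub>R (One :: real^'n))"
      proof (rule norm_le_componentwise)
        fix b :: "real^'n" assume b: "b \<in> Basis"
        then have "x \<bullet> b \<le> y \<bullet> b" "y \<bullet> b \<le> (x + h *\<^sub>R One) \<bullet> b" using y unfolding mem_box by blast+
        then show "\<bar>(y - x) \<bullet> b\<bar> \<le> \<bar>(h *\<^sub>R One) \<bullet> b\<bar>" by (simp add: inner_diff_left inner_add_left)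
      qed
      then have "norm (y - x) \<le> h * c" using h by (simp add: c_def)
      moreover have "(y - x) \<bullet> e \<le> norm (y - x)" using Cauchy_Schwarz_ineq2[of "y - x" e] e1 by simp
      ultimately show "y \<in> {x. x \<bullet> e < 0}" using h by (simp add: inner_diff_left)
    qed
    from z[OF this] d(2)[OF h(1,2)] show False by simp
  qed
  moreover have "AE x in lebesgue. x \<notin> N" using N(1) by (simp add: negligible_iff_null_sets AE_not_in)
  ultimately show ?thesis by (auto elim: eventually_mono)
qed

end

section \<open>Passage to Borel representatives and integrable sources\<close>

text \<open>Each coordinate is at most the norm in modulus, so the exponential is bounded by a
  product of one-dimensional exponentials with rate c / n; each of those is dominated by a multiple
  of 1 / (1 + t^2).\<close>

lemma integrable_exp_norm:
  assumes c: "c > 0"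
  shows "integrable lborel (\<lambda>x::'a::euclidean_space. exp (- c * norm x))"
proof -
  define m where "m = c / real DIM('a)"
  have m: "m > 0" using c by (simp add: m_def)
  \<comment> \<open>Chosen so that A (1 + m^2 t^2 / 2) \<ge> 1 + t^2, where the bracket is a lower
    bound for exp (m |t|).\<close>
  define A where "A = 1 + 2 / m\<^sup>2"
  have A: "exp (- m * \<bar>t\<bar>) \<le> A * inverse (1 + t\<^sup>2)" for t :: real
  proof -
    have "1 + m * \<bar>t\<bar> + (m * \<bar>t\<bar>)\<^sup>2 / 2 \<le> exp (m * \<bar>t\<bar>)" using m by (intro exp_lower_Taylor_quadratic) auto
    moreover have "0 \<le> m * \<bar>t\<bar>" using m by (intro mult_nonneg_nonneg) auto
    ultimately have e: "1 + m\<^sup>2 * t\<^sup>2 / 2 \<le> exp (m * \<bar>t\<bar>)" by (simp add: power_mult_distrib)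
    have "1 + t\<^sup>2 \<le> A * (1 + m\<^sup>2 * t\<^sup>2 / 2)"
    proof -
      have "A * (1 + m\<^sup>2 * t\<^sup>2 / 2) = 1 + t\<^sup>2 + (2 / m\<^sup>2 + m\<^sup>2 * t\<^sup>2 / 2)" using m unfolding A_def by (simp add: field_simps)
      moreover have "0 \<le> 2 / m\<^sup>2 + m\<^sup>2 * t\<^sup>2 / 2" by simp
      ultimately show ?thesis by linarith
    qed
    also have "\<dots> \<le> A * exp (m * \<bar>t\<bar>)" using e m by (intro mult_left_mono) (auto simp: A_def intro: add_nonneg_nonneg)
    finally have "exp (- (m * \<bar>t\<bar>)) * (1 + t\<^sup>2) \<le> exp (- (m * \<bar>t\<bar>)) * (A * exp (m * \<bar>t\<bar>))" by (intro mult_left_mono) auto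
    also have "\<dots> = A" by (simp add: exp_minus)
    finally show ?thesis using pos_le_divide_eq[of "1 + t\<^sup>2" "exp (- (m * \<bar>t\<bar>))" A] by (simp add: divide_inverse add_pos_nonneg)
  qed
  have "set_integrable lborel (einterval (-\<infinity>) \<infinity>) (\<lambda>t. inverse (1 + t\<^sup>2))" by (rule integrable_inverse_1_plus_square)
  then have i: "integrable lborel (\<lambda>t. inverse (1 + t\<^sup>2) :: real)" by (simp add: set_integrable_def)
  have i1: "integrable lborel (\<lambda>t. complex_of_real (exp (- m * \<bar>t\<bar>)))"
  proof (rule Bochner_Integration.integrable_bound[OF integrable_mult_right[OF i, of A]])
    show "AE t in lborel. norm (complex_of_real (exp (- m * \<bar>t\<bar>))) \<le> norm (A * inverse (1 + t\<^sup>2))"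
      using A by (intro AE_I2) (auto intro: order_trans[OF _ abs_ge_self])
  qed measurable
  have p: "integrable lborel (\<lambda>x::'a. \<Prod>b\<in>Basis. complex_of_real (exp (- m * \<bar>x \<bullet> b\<bar>)))"
    by (rule lborel_integral_prod(1)[of "\<lambda>_ t. complex_of_real (exp (- m * \<bar>t\<bar>))"]) (rule i1)
  show ?thesis
  proof (rule Bochner_Integration.integrable_bound[OF p])
    show "AE x::'a in lborel. norm (exp (- c * norm x)) \<le> norm (\<Prod>b\<in>Basis. complex_of_real (exp (- m * \<bar>x \<bullet> b\<bar>)))"
    proof (rule AE_I2)
      fix x :: 'a
      have "(\<Sum>b\<in>Basis. m * \<bar>x \<bullet> b\<bar>) \<le> (\<Sum>b\<in>(Basis::'a set). m * norm x)"
        using m by (intro sum_mono mult_left_mono Basis_le_norm) auto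
      also have "\<dots> = c * norm x" by (simp add: m_def)
      finally have "exp (- (c * norm x)) \<le> exp (- (\<Sum>b\<in>Basis. m * \<bar>x \<bullet> b\<bar>))" by simp
      also have "\<dots> = norm (\<Prod>b\<in>Basis. complex_of_real (exp (- m * \<bar>x \<bullet> b\<bar>)))"
        by (simp add: sum_negf[symmetric] exp_sum prod_norm[symmetric] abs_prod)
      finally show "norm (exp (- c * norm x)) \<le> norm (\<Prod>b\<in>Basis. complex_of_real (exp (- m * \<bar>x \<bullet> b\<bar>)))" by simp
    qed
  qed measurable
qed

lemma borel_version_complex:
  fixes u :: "real^'n::finite \<Rightarrow> complex"
  assumes "u \<in> borel_measurable lebesgue"
  obtains u0 where "u0 \<in> borel_measurable borel" "AE x in lebesgue. u x = u0 x"
proof -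
  have "(\<lambda>x. Re (u x)) \<in> borel_measurable lebesgue" "(\<lambda>x. Im (u x)) \<in> borel_measurable lebesgue" using assms by auto
  from this[THEN completion_ex_borel_measurable_real]
  obtain a b where a: "a \<in> borel_measurable lborel" "AE x in lborel. Re (u x) = a x"
    and b: "b \<in> borel_measurable lborel" "AE x in lborel. Im (u x) = b x"
    by blast
  have "AE x in lborel. u x = Complex (a x) (b x)" using a(2) b(2) by eventually_elim (simp add: complex_eq_iff)
  then have "AE x in lebesgue. u x = Complex (a x) (b x)" by (rule AE_completion)
  moreover have "(\<lambda>x. Complex (a x) (b x)) \<in> borel_measurable borel"
    using a(1) b(1) unfolding Complex_eq by (intro borel_measurable_add borel_measurable_times) auto
  ultimately show thesis by (rule that[rotated])
qed

lemma Bstar0_imp_borel: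
  fixes u u0 :: "real^'n::finite \<Rightarrow> complex"
  assumes B: "Bstar0 u" and u0[measurable]: "u0 \<in> borel_measurable borel" and ae: "AE x in lebesgue. u x = u0 x"
  shows "Bstar0_borel u0"
  unfolding Bstar0_borel_def
proof (intro conjI allI impI u0)
  fix \<eta> :: real assume eta: "\<eta> > 0"
  have [measurable]: "u \<in> borel_measurable lebesgue" using B by (simp add: Bstar0_def L2_loc_def)
  let ?N = "\<lambda>R. LINT x:ball 0 R|lebesgue. (norm (u x))\<^sup>2"
  have N: "(\<integral>\<^sup>+x. ennreal ((norm (u0 x))\<^sup>2) * indicator (ball 0 R) x \<partial>lborel) = ennreal (?N R)" for R
  proof -
    have si: "set_integrable lebesgue (ball 0 R) (\<lambda>x. (norm (u x))\<^sup>2)" using B by (simp add: Bstar0_def L2_loc_def)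
    have "(\<integral>\<^sup>+x. ennreal ((norm (u0 x))\<^sup>2) * indicator (ball 0 R) x \<partial>lborel) = (\<integral>\<^sup>+x. ennreal ((norm (u0 x))\<^sup>2) * indicator (ball 0 R) x \<partial>lebesgue)"
      by (rule nn_integral_completion[symmetric]) 
    also have "\<dots> = (\<integral>\<^sup>+x. ennreal (indicator (ball 0 R) x *\<^sub>R (norm (u x))\<^sup>2) \<partial>lebesgue)"
      by (rule nn_integral_cong_AE) (use ae in \<open>eventually_elim, auto simp: indicator_def\<close>)
    also have "\<dots> = ennreal (?N R)"
      unfolding set_lebesgue_integral_def by (rule nn_integral_eq_integral) (use si in \<open>auto simp: set_integrable_def\<close>)
    finally show ?thesis .
  qed
  have "((\<lambda>R. (1 / R) * ?N R) \<longlongrightarrow> 0) at_top" using B by (simp add: Bstar0_def)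
  then have "\<forall>\<^sub>F R in at_top. (1 / R) * ?N R < \<eta>" using eta by (rule order_tendstoD)
  then obtain R0 where R0: "\<And>R. R \<ge> R0 \<Longrightarrow> (1 / R) * ?N R < \<eta>" by (auto simp: eventually_at_top_linorder)
  \<comment> \<open>Beyond R0 the limit gives the slope \<eta>; smaller balls lie in the ball of
    radius R1, whose integral serves as the constant C.\<close>
  define R1 where "R1 = max 1 R0"
  have N0: "?N R1 \<ge> 0" unfolding set_lebesgue_integral_def by (intro Bochner_Integration.integral_nonneg) auto
  show "\<exists>C\<ge>0. \<forall>R>0. (\<integral>\<^sup>+x. ennreal ((norm (u0 x))\<^sup>2) * indicator (ball 0 R) x \<partial>lborel) \<le> ennreal (\<eta> * R + C)"
  proof (intro exI[of _ "?N R1"] conjI allI impI N0)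
    fix R :: real assume R: "R > 0"
    show "(\<integral>\<^sup>+x. ennreal ((norm (u0 x))\<^sup>2) * indicator (ball 0 R) x \<partial>lborel) \<le> ennreal (\<eta> * R + ?N R1)"
    proof (cases "R \<ge> R0")
      case True
      have "?N R \<le> \<eta> * R" using R0[OF True] R by (simp add: field_simps)
      then show ?thesis unfolding N using N0 by (intro ennreal_leI) auto
    next
      case False
      have "(\<integral>\<^sup>+x. ennreal ((norm (u0 x))\<^sup>2) * indicator (ball 0 R) x \<partial>lborel) \<le> (\<integral>\<^sup>+x. ennreal ((norm (u0 x))\<^sup>2) * indicator (ball 0 R1) x \<partial>lborel)"
        using False by (intro nn_integral_mono mult_left_mono) (auto simp: indicator_def R1_def)
      also have "\<dots> = ennreal (?N R1)" by (rule N)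
      also have "\<dots> \<le> ennreal (\<eta> * R + ?N R1)" using eta R by (intro ennreal_leI) auto
      finally show ?thesis .
    qed
  qed
qed

theorem theorem4:
  fixes u f :: "real^'n \<Rightarrow> complex" and lam \<gamma>0 :: real and k :: 'n
    and Du :: "'n \<Rightarrow> real^'n \<Rightarrow> complex" and D2u :: "'n \<Rightarrow> 'n \<Rightarrow> real^'n \<Rightarrow> complex"
  assumes "CARD('n) \<ge> 2"
    and "lam > 0"
    and "Bstar0_2_with u Du D2u"
    and "AE x in lebesgue. - (\<Sum>i\<in>UNIV. D2u i i x) - complex_of_real lam * u x = f x"
    and "\<gamma>0 > 0"
    and "L2 (\<lambda>x. complex_of_real (exp (\<gamma>0 * jbracket x)) * f x)"
    and "AE x in lebesgue. x $ k < 0 \<longrightarrow> f x = 0"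
  shows "AE x in lebesgue. x $ k < 0 \<longrightarrow> u x = 0"
proof -
  have jc: "continuous_on UNIV (jbracket :: real^'n \<Rightarrow> real)" unfolding jbracket_def[abs_def] by (intro continuous_intros)
  then have [measurable]: "(jbracket :: real^'n \<Rightarrow> real) \<in> borel_measurable borel" by (rule borel_measurable_continuous_onI)
  have jl: "norm x \<le> jbracket x" for x :: "real^'n" unfolding jbracket_def by (rule real_le_rsqrt) simp
  have um: "u \<in> borel_measurable lebesgue" using assms(3) by (simp add: Bstar0_2_with_def Bstar0_def L2_loc_def)
  have fm: "f \<in> borel_measurable lebesgue"
  proof -
    have "(\<lambda>x. complex_of_real (exp (\<gamma>0 * jbracket x)) * f x) \<in> borel_measurable lebesgue" using assms(6) by (simp add: L2_def)
    moreover have "(\<lambda>x::real^'n. complex_of_real (exp (- (\<gamma>0 * jbracket x)))) \<in> borel_measurable lebesgue"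
      by (rule measurable_completion) measurable
    ultimately have "(\<lambda>x. complex_of_real (exp (- (\<gamma>0 * jbracket x))) * (complex_of_real (exp (\<gamma>0 * jbracket x)) * f x)) \<in> borel_measurable lebesgue"
      by (rule borel_measurable_times[rotated])
    moreover have "complex_of_real (exp (- (\<gamma>0 * jbracket x))) * (complex_of_real (exp (\<gamma>0 * jbracket x)) * f x) = f x" for x
      by (simp add: exp_minus)
    ultimately show ?thesis by simp
  qed
  obtain u0 where u0: "u0 \<in> borel_measurable borel" "AE x in lebesgue. u x = u0 x" by (rule borel_version_complex[OF um], rule that)
  obtain f1 where f1[measurable]: "f1 \<in> borel_measurable borel" and f1e: "AE x in lebesgue. f x = f1 x" by (rule borel_version_complex[OF fm], rule that)
  \<comment> \<open>A null-set modification that makes the support condition hold at every point, as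
    the locale demands.\<close>
  define f0 where "f0 x = (if x $ k < 0 then 0 else f1 x)" for x
  have [measurable]: "(\<lambda>x::real^'n. x $ k) \<in> borel_measurable borel" by (intro borel_measurable_continuous_onI continuous_intros)
  have f0m[measurable]: "f0 \<in> borel_measurable borel" unfolding f0_def[abs_def] by measurable
  have f0e: "AE x in lebesgue. f x = f0 x" using f1e assms(7) by eventually_elim (simp add: f0_def)
  have Bu: "Bstar0_borel u0" by (rule Bstar0_imp_borel[OF _ u0]) (use assms(3) in \<open>simp add: Bstar0_2_with_def\<close>)
  have w: "weak_helm lam u0 f0" by (rule weak_helmholtz[OF assms(3,4) u0(2,1) f0e f0m fm])
  \<comment> \<open>Split the weight as exp (\<gamma>0 |x|) times exp (- \<gamma>0 |x| / 2) and
    bound the product by the sum of squares: half the rate pays for integrability.\<close>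
  have fi: "integrable lborel (\<lambda>x. exp (\<gamma>0 / 2 * norm x) * norm (f0 x))"
  proof -
    have "integrable lebesgue (\<lambda>x. (norm (complex_of_real (exp (\<gamma>0 * jbracket x)) * f x))\<^sup>2)" using assms(6) by (simp add: L2_def)
    moreover have "AE x in lebesgue. (norm (complex_of_real (exp (\<gamma>0 * jbracket x)) * f x))\<^sup>2 = (exp (\<gamma>0 * jbracket x) * norm (f0 x))\<^sup>2"
      using f0e by eventually_elim (simp add: norm_mult)
    moreover have "(\<lambda>x. (exp (\<gamma>0 * jbracket x) * norm (f0 x))\<^sup>2) \<in> borel_measurable lebesgue"
      by (rule measurable_completion) measurable
    ultimately have "integrable lebesgue (\<lambda>x. (exp (\<gamma>0 * jbracket x) * norm (f0 x))\<^sup>2)"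
      by (blast intro: integrable_cong_AE_imp)
    then have i1: "integrable lborel (\<lambda>x. (exp (\<gamma>0 * jbracket x) * norm (f0 x))\<^sup>2)"
      by (subst (asm) integrable_completion) auto
    have i2: "integrable lborel (\<lambda>x::real^'n. exp (- \<gamma>0 * norm x))" by (rule integrable_exp_norm[OF assms(5)])
    show ?thesis
    proof (rule Bochner_Integration.integrable_bound[OF Bochner_Integration.integrable_add[OF i1 i2]])
      show "AE x in lborel. norm (exp (\<gamma>0 / 2 * norm x) * norm (f0 x)) \<le> norm ((exp (\<gamma>0 * jbracket x) * norm (f0 x))\<^sup>2 + exp (- \<gamma>0 * norm x))"
      proof (rule AE_I2)
        fix x
        let ?a = "exp (\<gamma>0 * norm x) * norm (f0 x)" and ?b = "exp (- (\<gamma>0 / 2 * norm x))"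
        have "exp (\<gamma>0 / 2 * norm x) * norm (f0 x) = ?a * ?b" by (simp add: mult_ac flip: exp_add)
        also have "\<dots> \<le> ?a\<^sup>2 + ?b\<^sup>2"
        proof -
          have "2 * (?a * ?b) \<le> ?a\<^sup>2 + ?b\<^sup>2" using sum_squares_bound[of ?a ?b] by (simp only: mult.assoc)
          moreover have "0 \<le> ?a * ?b" by simp
          ultimately show ?thesis by linarith
        qed
        also have "?b\<^sup>2 = exp (- \<gamma>0 * norm x)" by (simp add: power2_eq_square flip: exp_add)
        also have "?a\<^sup>2 \<le> (exp (\<gamma>0 * jbracket x) * norm (f0 x))\<^sup>2"
          using jl[of x] assms(5) by (intro power_mono mult_right_mono) auto
        finally show "norm (exp (\<gamma>0 / 2 * norm x) * norm (f0 x)) \<le> norm ((exp (\<gamma>0 * jbracket x) * norm (f0 x))\<^sup>2 + exp (- \<gamma>0 * norm x))"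
          by simp
      qed
    qed measurable
  qed
  interpret half_space_source f0 "axis k 1" "\<gamma>0 / 2"
    by unfold_locales (use assms(5) fi in \<open>auto simp: f0_def inner_axis f0m norm_eq_1 inner_axis_axis\<close>)
  have "AE x in lebesgue. x \<bullet> axis k 1 < 0 \<longrightarrow> u0 x = 0" by (rule vanishes_AE[OF assms(1,2) w Bu])
  then show ?thesis using u0(2) by eventually_elim (simp add: inner_axis)
qed

end
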